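(* In dimensionless units $m=l=g=1$, for $(j_1,j_2)$ near $(0,0)$ with $j_2\neq0$, the rotation number $W=-\partial I_1(h,j_2)/\partial j_2$ of the spherical pendulum near its focus-focus point is given by $$2\pi W(j_1,j_2)=2\pi\,\mathrm{sgn}\,j_2-\mathrm{Arg}\,\hat j-A\ln|\hat j|+A\,S_1-S_2,\qquad \hat j=j_1+\mathrm i j_2,\quad S_i=\frac{\partial S}{\partial j_i},$$ where $A=\dfrac{\partial\mathcal H/\partial j_2}{\partial\mathcal H/\partial j_1}$ has the expansion $$A(j_1,j_2)=\frac38j_2-\frac{15}{128}j_1j_2+\frac{15}{1024}j_2\left(3j_1^2+2j_2^2\right)-\frac{45}{65536}j_1j_2\left(25j_1^2+43j_2^2\right)+\cdots,$$ the dots denoting terms of degree at least $5$ in $(j_1,j_2)$.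
   Context: Spherical pendulum in dimensionless units: phase space $T^*S^2=\{(\mathbf r,\mathbf p)\in\mathbb R^3\times\mathbb R^3: \|\mathbf r\|=1,\ (\mathbf r,\mathbf p)=0\}$ with the symplectic form induced by $d\mathbf r\wedge d\mathbf p$, $H=\frac12\|\mathbf r\times\mathbf p\|^2+z-1$, second integral $L_z=xp_y-yp_x$. The unstable focus-focus equilibrium is $\mathbf r=(0,0,1)$, $\mathbf p=0$, with $H=0$. Eliasson coordinates: there are analytic symplectic coordinates $(q_1,q_2,p_1,p_2)$ near this equilibrium (centred at it) in which $L_z=J_2$ and $H=\mathcal H(J_1,J_2)$ with $J_1=q_1p_1+q_2p_2$, $J_2=q_1p_2-q_2p_1$ and $\mathcal H=J_1+O(2)$ (Birkhoff normal form). Values of $J_1,J_2$ are denoted $j_1,j_2$, and $h=\mathcal H(j_1,j_2)$ is the energy. The canonical action, as a function of $(h,j_2)$, is $$I_1(h,j_2)=\frac1\pi\int_{\zeta_0}^{\zeta_1}\frac{\sqrt{P(\zeta)}}{1-\zeta^2}\,d\zeta,\qquad P(\zeta)=2(1-\zeta^2)(h+1-\zeta)-j_2^2,$$ where $-1\le\zeta_0\le\zeta_1\le1\le\zeta_2$ are the roots of $P$. The derivative defining $W$ is taken at fixed $h$, and $W$ is then expressed in $(j_1,j_2)$ via $h=\mathcal H(j_1,j_2)$. $\mathrm{Arg}$ is the principal argument. The semi-global symplectic invariant $S(j_1,j_2)$ is the regular (power series) function defined by $$2\pi I_1=8-2\pi|j_2|+j_2\,\mathrm{Arg}\,\hat j-j_1\ln|\hat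 j|+j_1+S(j_1,j_2).$$ *)

theory Defs
  imports "HOL-Analysis.Analysis"
begin

section \<open>Real-analytic functions\<close>

(* Near x0, f is the sum of a convergent power series all of whose terms have total degree at
   least k. A multi-index assigns an exponent to each coordinate direction (element of Basis);
   it is taken in the extensional function space so that every monomial occurs exactly once. *)
definition power_series_from_degree ::
    "nat \<Rightarrow> ('a::euclidean_space \<Rightarrow> 'b::real_normed_vector) \<Rightarrow> 'a \<Rightarrow> bool" where
  "power_series_from_degree k f x0 \<longleftrightarrow>
     (\<exists>c. \<forall>\<^sub>F x in nhds x0.
        ((\<lambda>\<alpha>. (\<Prod>b\<in>Basis. ((x - x0) \<bullet> b) ^ \<alpha> b) *\<^sub>R c \<alpha>) has_sum f x)
          {\<alpha> \<in> Basis \<rightarrow>\<^sub>E (UNIV :: nat set). k \<le> (\<Sum>b\<in>Basis. \<alpha> b)})"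

abbreviation real_analytic_at ::
    "('a::euclidean_space \<Rightarrow> 'b::real_normed_vector) \<Rightarrow> 'a \<Rightarrow> bool" where
  "real_analytic_at \<equiv> power_series_from_degree 0"

definition partial1 :: "(real \<times> real \<Rightarrow> real) \<Rightarrow> real \<times> real \<Rightarrow> real" where
  "partial1 f j = deriv (\<lambda>t. f (t, snd j)) (fst j)"

definition partial2 :: "(real \<times> real \<Rightarrow> real) \<Rightarrow> real \<times> real \<Rightarrow> real" where
  "partial2 f j = deriv (\<lambda>t. f (fst j, t)) (snd j)"


section \<open>The spherical pendulum\<close>

(* Points of phase space are pairs (r, p). *)
definition phase_space :: "((real^3) \<times> (real^3)) set" where
  "phase_space = {(r, p). norm r = 1 \<and> r \<bullet> p = 0}"

definition energy :: "(real^3) \<times> (real^3) \<Rightarrow> real" where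
  "energy = (\<lambda>(r, p). 1/2 * (norm (cross3 r p))\<^sup>2 + r $ 3 - 1)"

definition ang_mom :: "(real^3) \<times> (real^3) \<Rightarrow> real" where
  "ang_mom = (\<lambda>(r, p). r $ 1 * p $ 2 - r $ 2 * p $ 1)"

definition unstable_equilibrium :: "(real^3) \<times> (real^3)" where
  "unstable_equilibrium = (vector [0, 0, 1], 0)"

(* The form dx /\ dy on pairs (x, y). On R^3 x R^3 it is dr /\ dp, whose restriction to tangent
   vectors of phase_space is the symplectic form there; on R^2 x R^2 it is
   dq1 /\ dp1 + dq2 /\ dp2. *)
definition canonical_form :: "'v::real_inner \<times> 'v \<Rightarrow> 'v \<times> 'v \<Rightarrow> real" where
  "canonical_form u v = fst u \<bullet> snd v - snd u \<bullet> fst v"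


section \<open>Eliasson coordinates\<close>

definition J1 :: "(real^2) \<times> (real^2) \<Rightarrow> real" where
  "J1 = (\<lambda>(q, p). q $ 1 * p $ 1 + q $ 2 * p $ 2)"

definition J2 :: "(real^2) \<times> (real^2) \<Rightarrow> real" where
  "J2 = (\<lambda>(q, p). q $ 1 * p $ 2 - q $ 2 * p $ 1)"

(* The coordinate system is given by its inverse, the parametrization \<Phi> of a neighbourhood of
   the equilibrium in phase_space by an open set U of values (q, p). The form is preserved on
   tangent vectors to phase_space because these are the values of the derivative of \<Phi>. *)
definition symplectic_coordinates ::
    "((real^2) \<times> (real^2)) set \<Rightarrow> ((real^2) \<times> (real^2) \<Rightarrow> (real^3) \<times> (real^3)) \<Rightarrow> bool" where
  "symplectic_coordinates U \<Phi> \<longleftrightarrow>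
     open U \<and> 0 \<in> U \<and> \<Phi> 0 = unstable_equilibrium \<and>
     openin (top_of_set phase_space) (\<Phi> ` U) \<and>
     (\<exists>\<Psi>. homeomorphism U (\<Phi> ` U) \<Phi> \<Psi>) \<and>
     (\<forall>x\<in>U. real_analytic_at \<Phi> x) \<and>
     (\<forall>x\<in>U. \<forall>u v. canonical_form (frechet_derivative \<Phi> (at x) u) (frechet_derivative \<Phi> (at x) v)
                    = canonical_form u v)"

(* The last conjunct is the normalization \<H> = J1 + O(2), with \<H> a convergent power series. *)
definition eliasson_coordinates ::
    "((real^2) \<times> (real^2)) set \<Rightarrow> ((real^2) \<times> (real^2) \<Rightarrow> (real^3) \<times> (real^3)) \<Rightarrow>
     (real \<times> real \<Rightarrow> real) \<Rightarrow> bool" where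
  "eliasson_coordinates U \<Phi> \<H> \<longleftrightarrow>
     symplectic_coordinates U \<Phi> \<and>
     (\<forall>x\<in>U. ang_mom (\<Phi> x) = J2 x) \<and>
     (\<forall>x\<in>U. energy (\<Phi> x) = \<H> (J1 x, J2 x)) \<and>
     power_series_from_degree 2 (\<lambda>j. \<H> j - fst j) 0"

definition frequency_ratio :: "(real \<times> real \<Rightarrow> real) \<Rightarrow> real \<times> real \<Rightarrow> real" where
  "frequency_ratio \<H> j = partial2 \<H> j / partial1 \<H> j"


section \<open>Action, rotation number and symplectic invariant\<close>

definition P_poly :: "real \<Rightarrow> real \<Rightarrow> real \<Rightarrow> real" where
  "P_poly h j2 \<zeta> = 2 * (1 - \<zeta>\<^sup>2) * (h + 1 - \<zeta>) - j2\<^sup>2"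

(* The factorization (2 is the leading coefficient) says that the three numbers are the roots of
   P counted with multiplicity. *)
definition are_roots :: "real \<Rightarrow> real \<Rightarrow> real \<times> real \<times> real \<Rightarrow> bool" where
  "are_roots h j2 = (\<lambda>(\<zeta>0, \<zeta>1, \<zeta>2).
     -1 \<le> \<zeta>0 \<and> \<zeta>0 \<le> \<zeta>1 \<and> \<zeta>1 \<le> 1 \<and> 1 \<le> \<zeta>2 \<and>
     (\<forall>\<zeta>. P_poly h j2 \<zeta> = 2 * (\<zeta> - \<zeta>0) * (\<zeta> - \<zeta>1) * (\<zeta> - \<zeta>2)))"

(* Such roots are unique, and they exist for all (h, j2) near (0, 0). *)
definition action1 :: "real \<Rightarrow> real \<Rightarrow> real" where
  "action1 h j2 =
     (let (\<zeta>0, \<zeta>1, \<zeta>2) = (THE z. are_roots h j2 z)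
      in 1 / pi * integral {\<zeta>0..\<zeta>1} (\<lambda>\<zeta>. sqrt (P_poly h j2 \<zeta>) / (1 - \<zeta>\<^sup>2)))"

definition rotation_number :: "real \<Rightarrow> real \<Rightarrow> real" where
  "rotation_number h j2 = - deriv (\<lambda>l. action1 h l) j2"

(* At j = 0 the term j1 ln |j| is 0 (ln 0 = 0), which is its limit, and the Arg term is
   multiplied by j2 = 0. *)
definition symplectic_invariant :: "(real \<times> real \<Rightarrow> real) \<Rightarrow> (real \<times> real \<Rightarrow> real) \<Rightarrow> bool" where
  "symplectic_invariant \<H> S \<longleftrightarrow>
     real_analytic_at S 0 \<and>
     (\<forall>\<^sub>F (j1, j2) in nhds (0, 0).
        2 * pi * action1 (\<H> (j1, j2)) j2 =
          8 - 2 * pi * \<bar>j2\<bar> + j2 * Arg (Complex j1 j2) - j1 * ln (cmod (Complex j1 j2))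
            + j1 + S (j1, j2))"

end

theory Submission
  imports Defs "HOL-Complex_Analysis.Cauchy_Integral_Theorem" "HOL-Real_Asymp.Real_Asymp"
begin

text \<open>Write \<open>I(h, l)\<close> for the action, indices for partial derivatives, and \<open>J(h, l)\<close> for the solution
\<open>j1\<close> of \<open>\<H>(j1, l) = h\<close>, so that the frequency ratio is \<open>A = - J_l\<close>.

The formula for the rotation number is the chain rule. The definition of \<open>S\<close> expresses
\<open>2 \<pi> I(\<H>(j1, j2), j2)\<close> by an explicit function of \<open>j\<close>; its partial derivatives are
\<open>2 \<pi> \<H>_1 I_h = - ln |j| + S_1\<close> and \<open>2 \<pi> (\<H>_2 I_h + I_l) = - 2 \<pi> sgn j2 + Arg j + S_2\<close>, and
eliminating \<open>I_h\<close> gives \<open>- 2 \<pi> I_l\<close> (lemmas \<open>first_order\<close> and \<open>rotation_number_formula\<close>).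

The expansion of \<open>A\<close> rests on two linear equations for the action,
\<open>3 l I_hh - (1 + h) l I_ll - 2 h (2 + h) I_hl = 0\<close> and
\<open>I_h + 2 I_ll + 2 (1 + h) I_hh + 3 l I_hl = 0\<close>.
They hold because these operators turn the integrand \<open>s / (1 - \<zeta>^2)\<close>, where \<open>s^2 = P\<close>, into the
total \<open>\<zeta>\<close>-derivatives of \<open>- l / s\<close> and \<open>- 2 \<zeta> / s\<close> (lemma \<open>period_PDE\<close>). By the definition of \<open>S\<close>,
the derivatives of \<open>2 \<pi> I\<close> that occur here are those of \<open>- J\<close> multiplied by \<open>ln |j|\<close>, plus terms that
multiplication by \<open>|j|^2\<close> turns into power series. A logarithm cannot be cancelled by power series (lemma
\<open>expands_ln_independent\<close>), so its coefficient \<open>J\<close> satisfies the same two equations. They determine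
\<open>J = h + O(2)\<close> completely: in each degree the second equation fixes the Laplacian of the homogeneous
part, and the leading part of the first equation is injective on harmonic polynomials. As all power series are given in
\<open>(j1, j2)\<close>, the equations are used in the form that they take for \<open>\<H>\<close> (lemmas \<open>formal_relations\<close> and
\<open>hamiltonian_coefficients\<close>), and \<open>A\<close> is obtained by dividing \<open>\<H>_2\<close> by \<open>\<H>_1\<close>.

The integral for \<open>I\<close> has moving end points at which the derivative of the integrand is singular. It is
therefore replaced by the integral of a branch of \<open>s / (1 - \<zeta>^2)\<close> over an arc through the upper
half-plane that joins a point \<open>a < \<zeta>0\<close> to a point \<open>b > \<zeta>1\<close> and does not depend on \<open>(h, l)\<close>. Outside
\<open>[\<zeta>0, \<zeta>1]\<close> the branch is imaginary on the real axis, so the real part of this integral is the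
original one (lemma \<open>action1_eq_arc_integral\<close>); for the same reason the real parts of the boundary
terms of the total derivatives vanish. On the arc, differentiation under the integral sign is
harmless.\<close>


unbundle no vec_syntax
unbundle fps_syntax

section \<open>Power series in two variables\<close>

text \<open>Coefficients are kept as a series in the first variable whose coefficients are series in the second,
so that sums, products and inverses of the formal series come with their ring structure. Convergence at the
corner \<open>(r, r)\<close> makes the series absolutely summable on the whole closed square.\<close>

definition expands :: "real \<Rightarrow> real fps fps \<Rightarrow> (real \<times> real \<Rightarrow> real) \<Rightarrow> bool" where
  "expands r F f \<longleftrightarrow> 0 < r \<and> (\<forall>x y. \<bar>x\<bar> \<le> r \<longrightarrow> \<bar>y\<bar> \<le> r \<longrightarrow>
     ((\<lambda>(m, n). F $ m $ n * x ^ m * y ^ n) has_sum f (x, y)) UNIV)"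

lemma expands_pos: "expands r F f \<Longrightarrow> 0 < r"
  by (simp add: expands_def)

lemma expandsD:
  "expands r F f \<Longrightarrow> \<bar>x\<bar> \<le> r \<Longrightarrow> \<bar>y\<bar> \<le> r \<Longrightarrow>
     ((\<lambda>(m, n). F $ m $ n * x ^ m * y ^ n) has_sum f (x, y)) UNIV"
  by (simp add: expands_def)

lemma expands_mono: "expands r F f \<Longrightarrow> 0 < r' \<Longrightarrow> r' \<le> r \<Longrightarrow> expands r' F f"
  by (simp add: expands_def)

lemma expands_cong:
  "expands r F f \<Longrightarrow> (\<And>x y. \<bar>x\<bar> \<le> r \<Longrightarrow> \<bar>y\<bar> \<le> r \<Longrightarrow> f (x, y) = g (x, y)) \<Longrightarrow> expands r F g"
  by (simp add: expands_def)

lemma expands_abs_summable: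
  assumes "expands r F f"
  shows "(\<lambda>(m, n). \<bar>F $ m $ n\<bar> * r ^ m * r ^ n) summable_on UNIV"
proof -
  have "(\<lambda>(m, n). F $ m $ n * r ^ m * r ^ n) summable_on UNIV"
    using expandsD[OF assms, of r r] expands_pos[OF assms] by (auto intro: has_sum_imp_summable)
  hence "(\<lambda>p. norm (case p of (m, n) \<Rightarrow> F $ m $ n * r ^ m * r ^ n)) summable_on UNIV"
    by (rule summable_on_iff_abs_summable_on_real[THEN iffD1])
  moreover have "(\<lambda>p. norm (case p of (m, n) \<Rightarrow> F $ m $ n * r ^ m * r ^ n)) =
      (\<lambda>(m, n). \<bar>F $ m $ n\<bar> * r ^ m * r ^ n)"
    using expands_pos[OF assms] by (auto simp: fun_eq_iff abs_mult)
  ultimately show ?thesis by simp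
qed

lemma expandsI:
  assumes "0 < r" "(\<lambda>(m, n). \<bar>F $ m $ n\<bar> * r ^ m * r ^ n) summable_on UNIV"
    and "\<And>x y. \<bar>x\<bar> \<le> r \<Longrightarrow> \<bar>y\<bar> \<le> r \<Longrightarrow>
      (\<lambda>(m, n). F $ m $ n * x ^ m * y ^ n) summable_on UNIV \<Longrightarrow>
      ((\<lambda>(m, n). F $ m $ n * x ^ m * y ^ n) has_sum f (x, y)) UNIV"
  shows "expands r F f"
  unfolding expands_def
proof (intro conjI allI impI)
  fix x y :: real assume xy: "\<bar>x\<bar> \<le> r" "\<bar>y\<bar> \<le> r"
  have "(\<lambda>p. norm (case p of (m, n) \<Rightarrow> F $ m $ n * x ^ m * y ^ n)) summable_on UNIV"
  proof (rule Infinite_Sum.abs_summable_on_comparison_test'[OF assms(2)])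
    fix p :: "nat \<times> nat"
    obtain m n where p: "p = (m, n)" by (cases p)
    show "norm (case p of (m, n) \<Rightarrow> F $ m $ n * x ^ m * y ^ n) \<le>
        (case p of (m, n) \<Rightarrow> \<bar>F $ m $ n\<bar> * r ^ m * r ^ n)"
      unfolding p using xy
      by (auto simp: abs_mult power_abs intro!: mult_mono power_mono)
  qed
  thus "((\<lambda>(m, n). F $ m $ n * x ^ m * y ^ n) has_sum f (x, y)) UNIV"
    by (intro assms(3) xy) (rule abs_summable_summable)
qed (fact assms(1))

lemma expands_const: "0 < r \<Longrightarrow> expands r (fps_const (fps_const c)) (\<lambda>_. c)"
  unfolding expands_def
proof (intro conjI allI impI)
  fix x y :: real
  show "((\<lambda>(m, n). fps_const (fps_const c) $ m $ n * x ^ m * y ^ n) has_sum c) UNIV"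
    by (rule has_sum_finite_neutralI[where B = "{(0, 0)}"]) (auto split: if_splits)
qed

lemma expands_fst: "0 < r \<Longrightarrow> expands r fps_X (\<lambda>j. fst j)"
  unfolding expands_def
proof (intro conjI allI impI)
  fix x y :: real
  show "((\<lambda>(m, n). fps_X $ m $ n * x ^ m * y ^ n) has_sum fst (x, y)) UNIV"
    by (rule has_sum_finite_neutralI[where B = "{(1, 0)}"]) (auto simp: fps_X_def split: if_splits)
qed

lemma expands_snd: "0 < r \<Longrightarrow> expands r (fps_const fps_X) (\<lambda>j. snd j)"
  unfolding expands_def
proof (intro conjI allI impI)
  fix x y :: real
  show "((\<lambda>(m, n). fps_const fps_X $ m $ n * x ^ m * y ^ n) has_sum snd (x, y)) UNIV"
    by (rule has_sum_finite_neutralI[where B = "{(0, 1)}"]) (auto simp: fps_X_def split: if_splits)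
qed

lemma expands_add:
  assumes "expands r F f" "expands r G g"
  shows "expands r (F + G) (\<lambda>j. f j + g j)"
  unfolding expands_def
proof (intro conjI allI impI)
  fix x y :: real assume xy: "\<bar>x\<bar> \<le> r" "\<bar>y\<bar> \<le> r"
  from has_sum_add[OF expandsD[OF assms(1) xy] expandsD[OF assms(2) xy]]
  show "((\<lambda>(m, n). (F + G) $ m $ n * x ^ m * y ^ n) has_sum f (x, y) + g (x, y)) UNIV"
    by (simp add: case_prod_unfold algebra_simps)
qed (fact expands_pos[OF assms(1)])

lemma summable_on_Times_real:
  fixes f :: "'a \<Rightarrow> real" and g :: "'b \<Rightarrow> real"
  assumes "f summable_on A" "g summable_on B"
  shows "(\<lambda>(a, b). f a * g b) summable_on A \<times> B"
proof -
  have "(\<lambda>p. norm (case p of (a, b) \<Rightarrow> f a * g b)) summable_on A \<times> B"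
  proof (rule Infinite_Sum.abs_summable_on_Sigma_iff[THEN iffD2], intro conjI ballI)
    fix a show "(\<lambda>b. norm (case (a, b) of (a, b) \<Rightarrow> f a * g b)) summable_on B"
      using assms(2)
      by (simp add: summable_on_iff_abs_summable_on_real[of g] abs_mult summable_on_cmult_right)
  next
    have "(\<lambda>a. norm (\<bar>f a\<bar> * (\<Sum>\<^sub>\<infinity>b\<in>B. \<bar>g b\<bar>))) summable_on A"
      using assms(1)
      by (simp add: summable_on_iff_abs_summable_on_real[of f] abs_mult summable_on_cmult_left)
    thus "(\<lambda>a. norm (infsum (\<lambda>b. norm (case (a, b) of (a, b) \<Rightarrow> f a * g b)) B)) summable_on A"
      by (simp add: abs_mult infsum_cmult_right')
  qed
  thus ?thesis by (rule abs_summable_summable)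
qed

lemma has_sum_Times_real:
  fixes f :: "'a \<Rightarrow> real" and g :: "'b \<Rightarrow> real"
  assumes "(f has_sum a) A" "(g has_sum b) B"
  shows "((\<lambda>(x, y). f x * g y) has_sum a * b) (A \<times> B)"
proof (rule has_sum_SigmaI)
  fix x assume "x \<in> A"
  show "((\<lambda>y. case (x, y) of (x, y) \<Rightarrow> f x * g y) has_sum f x * b) B"
    by (simp add: assms(2) has_sum_cmult_right)
next
  show "((\<lambda>x. f x * b) has_sum a * b) A"
    by (simp add: assms(1) has_sum_cmult_left)
next
  show "(\<lambda>(x, y). f x * g y) summable_on A \<times> B"
    by (rule summable_on_Times_real) (use assms in \<open>auto intro: has_sum_imp_summable\<close>)
qed

text \<open>The Cauchy product: the double family of products of terms is summable, and regrouping it by total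
exponents gives finite inner sums.\<close>

lemma expands_mult:
  assumes "expands r F f" "expands r G g"
  shows "expands r (F * G) (\<lambda>j. f j * g j)"
  unfolding expands_def
proof (intro conjI allI impI)
  fix x y :: real assume xy: "\<bar>x\<bar> \<le> r" "\<bar>y\<bar> \<le> r"
  let ?a = "\<lambda>(m, n). F $ m $ n * x ^ m * y ^ n" and ?b = "\<lambda>(m, n). G $ m $ n * x ^ m * y ^ n"
  let ?t = "\<lambda>((m, n), (i, j)). ?a (i, j) * ?b (m - i, n - j)"
  have "((\<lambda>(p, q). ?a p * ?b q) has_sum f (x, y) * g (x, y)) (UNIV \<times> UNIV)"
    by (intro has_sum_Times_real expandsD[OF assms(1)] expandsD[OF assms(2)] xy)
  moreover have "(?t has_sum f (x, y) * g (x, y)) (Sigma UNIV (\<lambda>(m, n). {..m} \<times> {..n}))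
     = ((\<lambda>(p, q). ?a p * ?b q) has_sum f (x, y) * g (x, y)) (UNIV \<times> UNIV)"
    by (rule has_sum_reindex_bij_witness
        [where i = "\<lambda>((i, j), (k, l)). ((i + k, j + l), (i, j))"
           and j = "\<lambda>((m, n), (i, j)). ((i, j), (m - i, n - j))"]) auto
  ultimately have "(?t has_sum f (x, y) * g (x, y)) (Sigma UNIV (\<lambda>(m, n). {..m} \<times> {..n}))"
    by blast
  then show "((\<lambda>(m, n). (F * G) $ m $ n * x ^ m * y ^ n) has_sum f (x, y) * g (x, y)) UNIV"
  proof (rule has_sum_SigmaD)
    fix p :: "nat \<times> nat"
    obtain m n where p: "p = (m, n)" by (cases p)
    have "(F * G) $ m $ n * x ^ m * y ^ n =
        (\<Sum>i\<le>m. \<Sum>j\<le>n. ?a (i, j) * ?b (m - i, n - j))"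
    proof -
      have "(F * G) $ m $ n * x ^ m * y ^ n =
          (\<Sum>i\<le>m. \<Sum>j\<le>n. F $ i $ j * G $ (m - i) $ (n - j)) * x ^ m * y ^ n"
        by (simp add: fps_mult_nth fps_sum_nth atLeast0AtMost)
      also have "\<dots> = (\<Sum>i\<le>m. \<Sum>j\<le>n. F $ i $ j * G $ (m - i) $ (n - j) * x ^ m * y ^ n)"
        by (simp add: sum_distrib_right)
      also have "\<dots> = (\<Sum>i\<le>m. \<Sum>j\<le>n. ?a (i, j) * ?b (m - i, n - j))"
      proof (intro sum.cong refl)
        fix i j assume "i \<in> {..m}" "j \<in> {..n}"
        hence "x ^ m = x ^ i * x ^ (m - i)" "y ^ n = y ^ j * y ^ (n - j)"
          by (simp_all flip: power_add)
        thus "F $ i $ j * G $ (m - i) $ (n - j) * x ^ m * y ^ n = ?a (i, j) * ?b (m - i, n - j)"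
          by simp
      qed
      finally show ?thesis .
    qed
    also have "\<dots> = (\<Sum>q\<in>{..m} \<times> {..n}. ?t (p, q))"
      by (simp add: sum.cartesian_product p case_prod_unfold)
    finally show "((\<lambda>q. ?t (p, q)) has_sum (case p of (m, n) \<Rightarrow> (F * G) $ m $ n * x ^ m * y ^ n))
        (case p of (m, n) \<Rightarrow> {..m} \<times> {..n})"
      unfolding p by (intro has_sum_finiteI) auto
  qed
qed (fact expands_pos[OF assms(1)])

lemma expands_uminus: "expands r F f \<Longrightarrow> expands r (- F) (\<lambda>j. - f j)"
  unfolding expands_def by (auto simp: has_sum_uminus case_prod_unfold)

lemma expands_diff:
  assumes "expands r F f" "expands r G g"
  shows "expands r (F - G) (\<lambda>j. f j - g j)"
  using expands_add[OF assms(1) expands_uminus[OF assms(2)]] by simp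

lemma expands_numeral: "0 < r \<Longrightarrow> expands r (numeral k) (\<lambda>_. numeral k)"
  using expands_const[of r "numeral k"] by (simp add: numeral_fps_const)

lemma expands_one: "0 < r \<Longrightarrow> expands r 1 (\<lambda>_. 1)"
  using expands_const[of r 1] by simp

lemma expands_power: "expands r F f \<Longrightarrow> expands r (F ^ n) (\<lambda>j. f j ^ n)"
  by (induction n) (auto intro: expands_one expands_mult dest: expands_pos)

text \<open>This reduces partial derivatives to the theory of power series in one variable. The case \<open>x = 0\<close> is separate because the terms then
carry no information about the convergence of the higher rows.\<close>

lemma expands_slice:
  assumes "expands r F f" "\<bar>x\<bar> \<le> r" "\<bar>y\<bar> \<le> r"
  shows "((\<lambda>m. (\<Sum>\<^sub>\<infinity>n. F $ m $ n * y ^ n) * x ^ m) has_sum f (x, y)) UNIV"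
proof (cases "x = 0")
  case False
  have "((\<lambda>(m, n). F $ m $ n * x ^ m * y ^ n) has_sum f (x, y)) (UNIV \<times> UNIV)"
    using expandsD[OF assms] by simp
  then show ?thesis
  proof (rule has_sum_SigmaD)
    fix m
    have "(\<lambda>(m, n). F $ m $ n * x ^ m * y ^ n) summable_on (UNIV \<times> UNIV)"
      using expandsD[OF assms] by (auto intro: has_sum_imp_summable)
    hence "(\<lambda>n. F $ m $ n * x ^ m * y ^ n) summable_on UNIV"
      using summable_on_SigmaD1[of "\<lambda>m n. F $ m $ n * x ^ m * y ^ n" UNIV "\<lambda>_. UNIV" m] by simp
    hence "(\<lambda>n. x ^ m * (F $ m $ n * y ^ n)) summable_on UNIV"
      by (simp add: mult_ac)
    hence "(\<lambda>n. F $ m $ n * y ^ n) summable_on UNIV"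
      using False by (simp add: summable_on_cmult_right')
    hence "((\<lambda>n. F $ m $ n * y ^ n) has_sum (\<Sum>\<^sub>\<infinity>n. F $ m $ n * y ^ n)) UNIV"
      by (rule has_sum_infsum)
    from has_sum_cmult_left[OF this, of "x ^ m"]
    show "((\<lambda>n. case (m, n) of (m, n) \<Rightarrow> F $ m $ n * x ^ m * y ^ n) has_sum
        (\<Sum>\<^sub>\<infinity>n. F $ m $ n * y ^ n) * x ^ m) UNIV" by (simp add: mult_ac)
  qed
next
  case True
  have "((\<lambda>(m, n). F $ m $ n * 0 ^ m * y ^ n) has_sum f (x, y)) UNIV"
    using expandsD[OF assms] True by simp
  moreover have "((\<lambda>n. F $ 0 $ n * y ^ n) has_sum f (x, y)) UNIV =
     ((\<lambda>(m, n). F $ m $ n * 0 ^ m * y ^ n) has_sum f (x, y)) ((\<lambda>n. (0, n)) ` UNIV)"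
    by (subst has_sum_reindex) (auto simp: inj_on_def o_def)
  moreover have "((\<lambda>(m, n). F $ m $ n * 0 ^ m * y ^ n) has_sum f (x, y)) ((\<lambda>n. (0, n)) ` UNIV) =
     ((\<lambda>(m, n). F $ m $ n * 0 ^ m * y ^ n) has_sum f (x, y)) UNIV"
    by (rule has_sum_cong_neutral) (auto simp: image_iff)
  ultimately have "((\<lambda>n. F $ 0 $ n * y ^ n) has_sum f (x, y)) UNIV" by blast
  hence "f (x, y) = (\<Sum>\<^sub>\<infinity>n. F $ 0 $ n * y ^ n)" by (simp add: infsumI)
  thus ?thesis using True
    by (intro has_sum_finite_neutralI[where B = "{0}"]) auto
qed

section \<open>Partial derivatives of power series\<close>

text \<open>Every term but the constant one has a factor of at least one power of the variables, so on a square of side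
\<open>\<rho>\<close> it gains the factor \<open>\<rho> / r\<close> over its value at the corner. The two estimates serve for continuity
at the origin and for inverting a series.\<close>

lemma expands_bound:
  assumes "expands r F f"
  shows "\<exists>C\<ge>0. (\<forall>x y \<rho>. \<bar>x\<bar> \<le> \<rho> \<longrightarrow> \<bar>y\<bar> \<le> \<rho> \<longrightarrow> \<rho> \<le> r \<longrightarrow> \<bar>f (x, y) - F $ 0 $ 0\<bar> \<le> \<rho> * C) \<and>
    (\<forall>\<rho>. 0 \<le> \<rho> \<longrightarrow> \<rho> \<le> r \<longrightarrow> (\<lambda>(m, n). \<bar>F $ m $ n\<bar> * \<rho> ^ m * \<rho> ^ n) summable_on UNIV - {(0, 0)} \<and>
        (\<Sum>\<^sub>\<infinity>(m, n)\<in>UNIV - {(0, 0)}. \<bar>F $ m $ n\<bar> * \<rho> ^ m * \<rho> ^ n) \<le> \<rho> * C)"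
proof -
  note r = expands_pos[OF assms]
  let ?a = "\<lambda>\<rho> (m, n). \<bar>F $ m $ n\<bar> * \<rho> ^ m * \<rho> ^ n"
  let ?Z = "UNIV - {(0::nat, 0::nat)}"
  define T where "T = (\<Sum>\<^sub>\<infinity>p\<in>?Z. ?a r p)"
  have sm: "?a r summable_on ?Z"
    using expands_abs_summable[OF assms] by (rule summable_on_subset_banach) auto
  have T0: "0 \<le> T / r"
    unfolding T_def using r by (intro divide_nonneg_pos infsum_nonneg) auto
  have term_le: "?a \<rho> p \<le> \<rho> / r * ?a r p" if \<rho>: "0 \<le> \<rho>" "\<rho> \<le> r" and p: "p \<in> ?Z" for \<rho> p
  proof -
    obtain m n where mn: "p = (m, n)" by (cases p)
    have "\<rho> ^ m * \<rho> ^ n = (\<rho> / r) ^ (m + n) * (r ^ m * r ^ n)"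
      using r by (simp add: power_divide power_add)
    also have "(\<rho> / r) ^ (m + n) \<le> (\<rho> / r) ^ 1"
      using \<rho> r p mn by (intro power_decreasing) auto
    hence "(\<rho> / r) ^ (m + n) * (r ^ m * r ^ n) \<le> (\<rho> / r) * (r ^ m * r ^ n)"
      using r by (intro mult_right_mono) auto
    finally have "\<bar>F $ m $ n\<bar> * (\<rho> ^ m * \<rho> ^ n) \<le> \<bar>F $ m $ n\<bar> * (\<rho> / r * (r ^ m * r ^ n))"
      by (intro mult_left_mono) auto
    thus ?thesis by (simp add: mn mult_ac)
  qed
  have sm_le: "?a \<rho> summable_on ?Z \<and> infsum (?a \<rho>) ?Z \<le> \<rho> * (T / r)"
    if \<rho>: "0 \<le> \<rho>" "\<rho> \<le> r" for \<rho>
  proof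
    have sm': "(\<lambda>p. \<rho> / r * ?a r p) summable_on ?Z"
      using sm by (rule summable_on_cmult_right)
    show sm'': "?a \<rho> summable_on ?Z"
      by (rule summable_on_comparison_test[OF sm' term_le[OF \<rho>]]) (use \<rho> in auto)
    have "infsum (?a \<rho>) ?Z \<le> infsum (\<lambda>p. \<rho> / r * ?a r p) ?Z"
      by (rule infsum_mono[OF sm'' sm' term_le[OF \<rho>]]) auto
    also have "\<dots> = \<rho> / r * T" unfolding T_def by (rule infsum_cmult_right')
    finally show "infsum (?a \<rho>) ?Z \<le> \<rho> * (T / r)" by simp
  qed
  have "\<bar>f (x, y) - F $ 0 $ 0\<bar> \<le> \<rho> * (T / r)" if xy: "\<bar>x\<bar> \<le> \<rho>" "\<bar>y\<bar> \<le> \<rho>" "\<rho> \<le> r" for x y \<rho>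
  proof -
    let ?g = "\<lambda>(m, n). F $ m $ n * x ^ m * y ^ n"
    have \<rho>0: "0 \<le> \<rho>" using xy by linarith
    have hs: "(?g has_sum f (x, y)) UNIV" using expandsD[OF assms, of x y] xy by linarith
    have "(?g has_sum (f (x, y) - F $ 0 $ 0)) ?Z"
      using has_sum_Diff[OF hs, of "{(0,0)}" "F $ 0 $ 0"] by (simp add: has_sum_finite_iff)
    moreover from sm_le[OF \<rho>0 xy(3)] have "(?a \<rho> has_sum infsum (?a \<rho>) ?Z) ?Z" by auto
    ultimately have "norm (f (x, y) - F $ 0 $ 0) \<le> infsum (?a \<rho>) ?Z"
    proof (rule norm_infsum_le)
      fix p :: "nat \<times> nat"
      obtain m n where mn: "p = (m, n)" by (cases p)
      show "norm (?g p) \<le> ?a \<rho> p"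
        using xy \<rho>0 by (auto simp: mn abs_mult power_abs intro!: mult_mono power_mono)
    qed
    with sm_le[OF \<rho>0 xy(3)] show ?thesis by simp
  qed
  with T0 sm_le show ?thesis by (intro exI[of _ "T / r"]) blast
qed

lemma expands_tendsto:
  assumes "expands r F f"
  shows "(f \<longlongrightarrow> F $ 0 $ 0) (nhds (0, 0))"
proof -
  obtain C where C: "0 \<le> C"
    and C2: "\<And>x y \<rho>. \<bar>x\<bar> \<le> \<rho> \<Longrightarrow> \<bar>y\<bar> \<le> \<rho> \<Longrightarrow> \<rho> \<le> r \<Longrightarrow> \<bar>f (x, y) - F $ 0 $ 0\<bar> \<le> \<rho> * C"
    using expands_bound[OF assms] by blast
  have "((\<lambda>j. norm j) \<longlongrightarrow> norm (0::real, 0::real)) (nhds (0::real, 0::real))"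
    by (intro tendsto_norm filterlim_ident)
  hence norm0: "((\<lambda>j. norm j) \<longlongrightarrow> 0) (nhds (0::real, 0::real))"
    by (simp add: norm_Pair)
  have "((\<lambda>j. f j - F $ 0 $ 0) \<longlongrightarrow> 0) (nhds (0, 0))"
  proof (rule Lim_null_comparison)
    have "\<forall>\<^sub>F j in nhds (0::real, 0::real). norm j < r"
      using expands_pos[OF assms] by (intro order_tendstoD(2)[OF norm0])
    thus "\<forall>\<^sub>F j in nhds (0::real, 0::real). norm (f j - F $ 0 $ 0) \<le> norm j * C"
    proof eventually_elim
      case (elim j)
      have "\<bar>fst j\<bar> \<le> norm j" "\<bar>snd j\<bar> \<le> norm j"
        using norm_fst_le[of "fst j" "snd j"] norm_snd_le[of "snd j" "fst j"] by auto
      with C2[of "fst j" "norm j" "snd j"] elim show ?case by simp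
    qed
    show "((\<lambda>j. norm j * C) \<longlongrightarrow> 0) (nhds (0::real, 0::real))"
      using tendsto_mult_right[OF norm0, of C] by simp
  qed
  from tendsto_add[OF this tendsto_const[of "F $ 0 $ 0"]] show ?thesis by simp
qed

definition fps_D1 :: "real fps fps \<Rightarrow> real fps fps" where
  "fps_D1 F = Abs_fps (\<lambda>m. Abs_fps (\<lambda>n. real (Suc m) * F $ Suc m $ n))"

definition fps_D2 :: "real fps fps \<Rightarrow> real fps fps" where
  "fps_D2 F = Abs_fps (\<lambda>m. Abs_fps (\<lambda>n. real (Suc n) * F $ m $ Suc n))"

definition fps_swap :: "real fps fps \<Rightarrow> real fps fps" where
  "fps_swap F = Abs_fps (\<lambda>m. Abs_fps (\<lambda>n. F $ n $ m))"

lemma fps_D1_nth [simp]: "fps_D1 F $ m $ n = real (Suc m) * F $ Suc m $ n"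
  by (simp add: fps_D1_def)

lemma fps_D2_nth [simp]: "fps_D2 F $ m $ n = real (Suc n) * F $ m $ Suc n"
  by (simp add: fps_D2_def)

lemma fps_swap_nth [simp]: "fps_swap F $ m $ n = F $ n $ m"
  by (simp add: fps_swap_def)

text \<open>Termwise differentiation in the first variable. On the square of half the side the factor \<open>m + 1\<close> is
absorbed by \<open>2^m\<close>, which gives the convergence of the differentiated double series.\<close>

lemma expands_partial1_aux:
  assumes "expands r F f"
  shows "\<bar>x\<bar> < r \<Longrightarrow> \<bar>y\<bar> \<le> r \<Longrightarrow> ((\<lambda>t. f (t, y)) has_real_derivative partial1 f (x, y)) (at x)"
    and "expands (r / 2) (fps_D1 F) (partial1 f)"
proof -
  note r = expands_pos[OF assms]
  define a where "a = (\<lambda>y m. \<Sum>\<^sub>\<infinity>n. F $ m $ n * y ^ n)"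
  have sums: "(\<lambda>m. a y m * x ^ m) sums f (x, y)" if "\<bar>x\<bar> \<le> r" "\<bar>y\<bar> \<le> r" for x y
    using expands_slice[OF assms that] unfolding a_def by (rule has_sum_imp_sums)
  have deriv: "((\<lambda>t. f (t, y)) has_real_derivative (\<Sum>n. diffs (a y) n * x ^ n)) (at x)"
    if xy: "\<bar>x\<bar> < r" "\<bar>y\<bar> \<le> r" for x y
  proof -
    have "((\<lambda>t. \<Sum>n. a y n * t ^ n) has_real_derivative (\<Sum>n. diffs (a y) n * x ^ n)) (at x)"
      by (rule termdiffs_strong[of _ r]) (use sums[of r y] xy r in \<open>auto simp: sums_iff\<close>)
    thus ?thesis
    proof (rule has_field_derivative_transform_within_open[where S = "{-r<..<r}"])
      fix t assume "t \<in> {-r<..<r}"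
      thus "(\<Sum>n. a y n * t ^ n) = f (t, y)" using sums[of t y] xy by (auto simp: sums_iff abs_le_iff)
    qed (use xy in auto)
  qed
  have p1: "partial1 f (x, y) = (\<Sum>n. diffs (a y) n * x ^ n)" if xy: "\<bar>x\<bar> < r" "\<bar>y\<bar> \<le> r" for x y
    unfolding partial1_def using DERIV_imp_deriv[OF deriv[OF that]] by simp
  show "((\<lambda>t. f (t, y)) has_real_derivative partial1 f (x, y)) (at x)" if "\<bar>x\<bar> < r" "\<bar>y\<bar> \<le> r"
    using deriv[OF that] p1[OF that] by simp
  define g where "g = (\<lambda>(x, y). \<Sum>\<^sub>\<infinity>(m, n). fps_D1 F $ m $ n * x ^ m * y ^ n)"
  have g: "expands (r / 2) (fps_D1 F) g"
  proof (rule expandsI)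
    have "(\<lambda>(m, n). \<bar>F $ m $ n\<bar> * r ^ m * r ^ n) summable_on (\<lambda>(m, n). (Suc m, n)) ` UNIV"
      by (rule summable_on_subset_banach[OF expands_abs_summable[OF assms]]) auto
    hence "(\<lambda>(m, n). \<bar>F $ Suc m $ n\<bar> * r ^ Suc m * r ^ n) summable_on UNIV"
      by (subst (asm) summable_on_reindex) (auto simp: inj_on_def o_def case_prod_unfold)
    hence sm: "(\<lambda>p. 1 / r * (case p of (m, n) \<Rightarrow> \<bar>F $ Suc m $ n\<bar> * r ^ Suc m * r ^ n)) summable_on UNIV"
      by (rule summable_on_cmult_right)
    show "(\<lambda>(m, n). \<bar>fps_D1 F $ m $ n\<bar> * (r / 2) ^ m * (r / 2) ^ n) summable_on UNIV"
    proof (rule summable_on_comparison_test[OF sm])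
      fix p :: "nat \<times> nat"
      obtain m n where mn: "p = (m, n)" by (cases p)
      have "Suc m \<le> 2 ^ m" using less_exp[of m] by (simp only: Suc_le_eq)
      hence "real (Suc m) \<le> 2 ^ m" using of_nat_mono[of "Suc m" "2 ^ m", where 'a = real] by simp
      hence "real (Suc m) * (r / 2) ^ m \<le> 2 ^ m * (r / 2) ^ m"
        using r by (intro mult_right_mono) auto
      also have "\<dots> = r ^ m" by (simp add: power_divide)
      finally have "real (Suc m) * (r / 2) ^ m * (r / 2) ^ n \<le> r ^ m * r ^ n"
        using r by (intro mult_mono power_mono) auto
      hence "\<bar>F $ Suc m $ n\<bar> * (real (Suc m) * (r / 2) ^ m * (r / 2) ^ n) \<le> \<bar>F $ Suc m $ n\<bar> * (r ^ m * r ^ n)"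
        by (intro mult_left_mono) auto
      thus "(case p of (m, n) \<Rightarrow> \<bar>fps_D1 F $ m $ n\<bar> * (r / 2) ^ m * (r / 2) ^ n) \<le>
          1 / r * (case p of (m, n) \<Rightarrow> \<bar>F $ Suc m $ n\<bar> * r ^ Suc m * r ^ n)"
        using r by (simp add: mn abs_mult mult_ac)
    qed (use r in auto)
  next
    fix x y :: real
    assume "(\<lambda>(m, n). fps_D1 F $ m $ n * x ^ m * y ^ n) summable_on UNIV"
    thus "((\<lambda>(m, n). fps_D1 F $ m $ n * x ^ m * y ^ n) has_sum g (x, y)) UNIV"
      unfolding g_def by simp
  qed (use r in auto)
  show "expands (r / 2) (fps_D1 F) (partial1 f)"
  proof (rule expands_cong[OF g])
    fix x y :: real assume xy: "\<bar>x\<bar> \<le> r / 2" "\<bar>y\<bar> \<le> r / 2"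
    have "(\<lambda>m. (\<Sum>\<^sub>\<infinity>n. fps_D1 F $ m $ n * y ^ n) * x ^ m) sums g (x, y)"
      using expands_slice[OF g xy] by (rule has_sum_imp_sums)
    moreover have "(\<Sum>\<^sub>\<infinity>n. fps_D1 F $ m $ n * y ^ n) = diffs (a y) m" for m
      unfolding diffs_def a_def fps_D1_nth mult.assoc by (rule infsum_cmult_right')
    ultimately have "(\<lambda>m. diffs (a y) m * x ^ m) sums g (x, y)" by simp
    thus "g (x, y) = partial1 f (x, y)" using p1[of x y] xy r by (auto simp: sums_iff)
  qed
qed

lemma expands_swap:
  assumes "expands r F f"
  shows "expands r (fps_swap F) (\<lambda>j. f (snd j, fst j))"
  unfolding expands_def
proof (intro conjI allI impI)
  fix x y :: real assume xy: "\<bar>x\<bar> \<le> r" "\<bar>y\<bar> \<le> r"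
  have "((\<lambda>(m, n). fps_swap F $ m $ n * x ^ m * y ^ n) has_sum f (y, x)) UNIV
     = ((\<lambda>(m, n). F $ m $ n * y ^ m * x ^ n) has_sum f (y, x)) UNIV"
    by (rule has_sum_reindex_bij_witness[where i = "\<lambda>(a, b). (b, a)" and j = "\<lambda>(a, b). (b, a)"]) auto
  with expandsD[OF assms xy(2,1)]
  show "((\<lambda>(m, n). fps_swap F $ m $ n * x ^ m * y ^ n) has_sum f (snd (x, y), fst (x, y))) UNIV"
    by simp
qed (fact expands_pos[OF assms])

lemma partial1_swap: "partial1 (\<lambda>j. f (snd j, fst j)) (y, x) = partial2 f (x, y)"
  by (simp add: partial1_def partial2_def)

lemmas expands_has_partial1 = expands_partial1_aux(1)
lemmas expands_partial1 = expands_partial1_aux(2)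

lemma expands_has_partial2:
  assumes "expands r F f" "\<bar>x\<bar> \<le> r" "\<bar>y\<bar> < r"
  shows "((\<lambda>t. f (x, t)) has_real_derivative partial2 f (x, y)) (at y)"
  using expands_has_partial1[OF expands_swap[OF assms(1)] assms(3,2)] by (simp add: partial1_swap)

lemma expands_partial2:
  assumes "expands r F f"
  shows "expands (r / 2) (fps_D2 F) (partial2 f)"
proof -
  have "fps_swap (fps_D1 (fps_swap F)) = fps_D2 F" by (simp add: fps_eq_iff)
  with expands_swap[OF expands_partial1[OF expands_swap[OF assms]]]
  have "expands (r / 2) (fps_D2 F) (\<lambda>j. partial1 (\<lambda>j. f (snd j, fst j)) (snd j, fst j))" by simp
  thus ?thesis by (rule expands_cong) (simp add: partial1_swap)
qed

section \<open>Inverses of power series and independence of logarithms\<close>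

text \<open>On a square so small that the non-constant terms of \<open>F\<close> sum up to at most half of the constant term
\<open>c\<close>, the recursion for the coefficients of the formal inverse bounds each finite sum \<open>B\<close> of the
absolute values of its terms at the corner by \<open>|c| B \<le> 1 + |c| B / 2\<close>, hence by \<open>2 / |c|\<close>.\<close>

lemma expands_inverse:
  assumes "expands r F f" and c0: "F $ 0 $ 0 \<noteq> 0"
  obtains \<rho> G where "0 < \<rho>" "\<rho> \<le> r" "expands \<rho> G (\<lambda>j. 1 / f j)" "F * G = 1"
proof -
  note r = expands_pos[OF assms(1)]
  define c where "c = F $ 0 $ 0"
  let ?Z = "UNIV - {(0::nat, 0::nat)}"
  obtain C where C: "0 \<le> C"
    and C2: "\<And>\<rho>. 0 \<le> \<rho> \<Longrightarrow> \<rho> \<le> r \<Longrightarrow> (\<lambda>(m, n). \<bar>F $ m $ n\<bar> * \<rho> ^ m * \<rho> ^ n) summable_on ?Z \<and>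
        (\<Sum>\<^sub>\<infinity>(m, n)\<in>?Z. \<bar>F $ m $ n\<bar> * \<rho> ^ m * \<rho> ^ n) \<le> \<rho> * C"
    using expands_bound[OF assms(1)] by blast
  \<comment> \<open>the factor \<open>C + 1\<close> instead of \<open>C\<close> avoids a division by 0\<close>
  define \<rho> where "\<rho> = min r (\<bar>c\<bar> / (2 * (C + 1)))"
  have \<rho>: "0 < \<rho>" "\<rho> \<le> r" using r c0 C by (auto simp: \<rho>_def c_def)
  have "\<rho> * C \<le> \<bar>c\<bar> / (2 * (C + 1)) * (C + 1)"
    using C \<rho>(1) by (intro mult_mono) (auto simp: \<rho>_def)
  also have "\<dots> = \<bar>c\<bar> / 2" using C by (simp add: field_simps)
  finally have \<rho>C: "\<rho> * C \<le> \<bar>c\<bar> / 2" .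
  define a where "a = (\<lambda>(m, n). \<bar>F $ m $ n\<bar> * \<rho> ^ m * \<rho> ^ n)"
  have a0: "a p \<ge> 0" for p using \<rho> by (auto simp: a_def split: prod.splits)
  have a_sum: "sum a X \<le> \<bar>c\<bar> / 2" if "finite X" "X \<subseteq> ?Z" for X
  proof -
    have "a summable_on ?Z" "infsum a ?Z \<le> \<bar>c\<bar> / 2"
      using C2[of \<rho>] \<rho> \<rho>C unfolding a_def by auto
    moreover have "sum a X \<le> infsum a ?Z"
      by (rule finite_sum_le_infsum) (use that a0 calculation in auto)
    ultimately show ?thesis by linarith
  qed
  define y where "y = inverse (F $ 0)"
  define G where "G = fps_right_inverse F y"
  have "F $ 0 * y = 1" unfolding y_def using c0 by (rule inverse_mult_eq_1')
  hence FG: "F * G = 1" unfolding G_def by (rule fps_right_inverse)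
  define b where "b = (\<lambda>(m, n). \<bar>G $ m $ n\<bar> * \<rho> ^ m * \<rho> ^ n)"
  have b0: "b p \<ge> 0" for p using \<rho> by (auto simp: b_def split: prod.splits)
  have rec: "\<bar>c\<bar> * b (m, n) \<le> (if (m, n) = (0, 0) then 1 else 0) +
      (\<Sum>(i, j)\<in>{..m} \<times> {..n} - {(0, 0)}. a (i, j) * b (m - i, n - j))" for m n
  proof -
    have "(F * G) $ m $ n = (\<Sum>i\<le>m. \<Sum>j\<le>n. F $ i $ j * G $ (m - i) $ (n - j))"
      by (simp add: fps_mult_nth fps_sum_nth atLeast0AtMost)
    also have "\<dots> = (\<Sum>(i, j)\<in>{..m} \<times> {..n}. F $ i $ j * G $ (m - i) $ (n - j))"
      by (simp add: sum.cartesian_product)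
    also have "\<dots> = c * G $ m $ n +
        (\<Sum>(i, j)\<in>{..m} \<times> {..n} - {(0, 0)}. F $ i $ j * G $ (m - i) $ (n - j))"
      by (subst sum.remove[where x = "(0, 0)"]) (auto simp: c_def)
    finally have "c * G $ m $ n = (if (m, n) = (0, 0) then 1 else 0) -
        (\<Sum>(i, j)\<in>{..m} \<times> {..n} - {(0, 0)}. F $ i $ j * G $ (m - i) $ (n - j))"
      unfolding FG by (auto split: if_splits)
    hence "\<bar>c * G $ m $ n\<bar> \<le> (if (m, n) = (0, 0) then 1 else 0) +
        \<bar>\<Sum>(i, j)\<in>{..m} \<times> {..n} - {(0, 0)}. F $ i $ j * G $ (m - i) $ (n - j)\<bar>"
      by (auto split: if_splits)
    also have "\<bar>\<Sum>(i, j)\<in>{..m} \<times> {..n} - {(0, 0)}. F $ i $ j * G $ (m - i) $ (n - j)\<bar>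
        \<le> (\<Sum>(i, j)\<in>{..m} \<times> {..n} - {(0, 0)}. \<bar>F $ i $ j\<bar> * \<bar>G $ (m - i) $ (n - j)\<bar>)"
      by (rule order.trans[OF sum_abs]) (simp add: case_prod_unfold abs_mult)
    finally have "\<bar>c * G $ m $ n\<bar> * (\<rho> ^ m * \<rho> ^ n) \<le> ((if (m, n) = (0, 0) then 1 else 0) +
        (\<Sum>(i, j)\<in>{..m} \<times> {..n} - {(0, 0)}. \<bar>F $ i $ j\<bar> * \<bar>G $ (m - i) $ (n - j)\<bar>)) * (\<rho> ^ m * \<rho> ^ n)"
      using \<rho> by (intro mult_right_mono) auto
    also have "\<dots> = (if (m, n) = (0, 0) then 1 else 0) +
        (\<Sum>(i, j)\<in>{..m} \<times> {..n} - {(0, 0)}. \<bar>F $ i $ j\<bar> * \<bar>G $ (m - i) $ (n - j)\<bar> * (\<rho> ^ m * \<rho> ^ n))"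
      by (simp add: distrib_right sum_distrib_right case_prod_unfold)
    also have "(\<Sum>(i, j)\<in>{..m} \<times> {..n} - {(0, 0)}. \<bar>F $ i $ j\<bar> * \<bar>G $ (m - i) $ (n - j)\<bar> * (\<rho> ^ m * \<rho> ^ n))
       = (\<Sum>(i, j)\<in>{..m} \<times> {..n} - {(0, 0)}. a (i, j) * b (m - i, n - j))"
    proof (intro sum.cong refl)
      fix p assume "p \<in> {..m} \<times> {..n} - {(0, 0)}"
      then obtain i j where p: "p = (i, j)" and "i \<le> m" "j \<le> n" by auto
      hence "\<rho> ^ m = \<rho> ^ i * \<rho> ^ (m - i)" "\<rho> ^ n = \<rho> ^ j * \<rho> ^ (n - j)"
        by (simp_all flip: power_add)
      thus "(case p of (i, j) \<Rightarrow> \<bar>F $ i $ j\<bar> * \<bar>G $ (m - i) $ (n - j)\<bar> * (\<rho> ^ m * \<rho> ^ n)) =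
          (case p of (i, j) \<Rightarrow> a (i, j) * b (m - i, n - j))"
        by (simp add: a_def b_def p)
    qed
    finally have "\<bar>c * G $ m $ n\<bar> * (\<rho> ^ m * \<rho> ^ n) \<le> (if (m, n) = (0, 0) then 1 else 0) +
        (\<Sum>(i, j)\<in>{..m} \<times> {..n} - {(0, 0)}. a (i, j) * b (m - i, n - j))" .
    moreover have "\<bar>c * G $ m $ n\<bar> * (\<rho> ^ m * \<rho> ^ n) = \<bar>c\<bar> * b (m, n)"
      by (simp add: b_def abs_mult)
    ultimately show ?thesis by simp
  qed
  have box: "sum b ({..K} \<times> {..K}) \<le> 2 / \<bar>c\<bar>" for K
  proof -
    let ?B = "{..K} \<times> {..K}"
    define D where "D = (\<lambda>(m, n). {..m} \<times> {..n} - {(0::nat, 0::nat)})"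
    have "\<bar>c\<bar> * sum b ?B = (\<Sum>p\<in>?B. \<bar>c\<bar> * b p)"
      by (rule sum_distrib_left)
    also have "\<dots> \<le> (\<Sum>p\<in>?B. (if p = (0, 0) then 1 else 0) +
        (\<Sum>q\<in>D p. a q * b (fst p - fst q, snd p - snd q)))"
    proof (rule sum_mono)
      fix p :: "nat \<times> nat"
      obtain m n where p: "p = (m, n)" by (cases p)
      show "\<bar>c\<bar> * b p \<le> (if p = (0, 0) then 1 else 0) +
          (\<Sum>q\<in>D p. a q * b (fst p - fst q, snd p - snd q))"
        using rec[of m n] unfolding p D_def by (simp add: case_prod_unfold)
    qed
    also have "\<dots> = (\<Sum>p\<in>?B. if p = (0, 0) then 1 else 0) +
        (\<Sum>p\<in>?B. \<Sum>q\<in>D p. a q * b (fst p - fst q, snd p - snd q))"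
      by (rule sum.distrib)
    also have "(\<Sum>p\<in>?B. if p = (0, 0) then 1 else 0) = (1::real)"
      by (rule trans[OF sum.delta]) auto
    also have "(\<Sum>p\<in>?B. \<Sum>q\<in>D p. a q * b (fst p - fst q, snd p - snd q)) =
        (\<Sum>(p, q)\<in>Sigma ?B D. a q * b (fst p - fst q, snd p - snd q))"
      by (subst sum.Sigma) (auto simp: D_def)
    also have "\<dots> = (\<Sum>(q, s)\<in>(\<lambda>(p, q). (q, (fst p - fst q, snd p - snd q))) ` Sigma ?B D. a q * b s)"
      by (subst sum.reindex) (auto simp: inj_on_def D_def case_prod_unfold)
    also have "\<dots> \<le> (\<Sum>(q, s)\<in>(?B - {(0, 0)}) \<times> ?B. a q * b s)"
      by (rule sum_mono2) (auto simp: D_def a0 b0)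
    also have "\<dots> = sum a (?B - {(0, 0)}) * sum b ?B"
      by (simp add: sum_product sum.cartesian_product)
    also have "\<dots> \<le> \<bar>c\<bar> / 2 * sum b ?B"
      by (intro mult_right_mono a_sum sum_nonneg b0) auto
    finally have "\<bar>c\<bar> * sum b ?B \<le> 2" by (simp add: field_simps)
    thus ?thesis using c0 by (simp add: c_def field_simps)
  qed
  have "b summable_on UNIV"
  proof (rule nonneg_bdd_above_summable_on)
    show "bdd_above (sum b ` {X. X \<subseteq> UNIV \<and> finite X})"
    proof (rule bdd_aboveI2)
      fix X assume "X \<in> {X. X \<subseteq> (UNIV :: (nat \<times> nat) set) \<and> finite X}"
      hence "finite X" by simp
      define K where "K = Max (insert 0 (fst ` X \<union> snd ` X))"
      have "X \<subseteq> {..K} \<times> {..K}"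
      proof clarify
        fix m n assume "(m, n) \<in> X"
        hence "m \<in> fst ` X \<union> snd ` X" "n \<in> fst ` X \<union> snd ` X" by (force simp: image_iff)+
        thus "m \<in> {..K} \<and> n \<in> {..K}"
          unfolding K_def using \<open>finite X\<close> by (auto intro!: Max_ge)
      qed
      hence "sum b X \<le> sum b ({..K} \<times> {..K})" by (intro sum_mono2) (auto simp: b0)
      with box[of K] show "sum b X \<le> 2 / \<bar>c\<bar>" by linarith
    qed
  qed (simp add: b0)
  define g where "g = (\<lambda>(x, y). \<Sum>\<^sub>\<infinity>(m, n). G $ m $ n * x ^ m * y ^ n)"
  have g: "expands \<rho> G g"
    by (rule expandsI) (use \<rho> \<open>b summable_on UNIV\<close> in \<open>auto simp: g_def b_def\<close>)
  have prod: "expands \<rho> 1 (\<lambda>j. f j * g j)"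
    using expands_mult[OF expands_mono[OF assms(1) \<rho>] g] by (simp add: FG)
  have "expands \<rho> G (\<lambda>j. 1 / f j)"
  proof (rule expands_cong[OF g])
    fix x y :: real assume "\<bar>x\<bar> \<le> \<rho>" "\<bar>y\<bar> \<le> \<rho>"
    from expandsD[OF prod this] expandsD[OF expands_one[OF \<rho>(1)] this]
    have fg: "f (x, y) * g (x, y) = 1" using has_sum_unique by blast
    hence "f (x, y) \<noteq> 0" by auto
    with fg show "g (x, y) = 1 / f (x, y)" by (simp add: field_simps)
  qed
  with \<rho> FG show ?thesis using that by blast
qed

text \<open>This reduces statements on coefficients to one variable: the coefficients on the line are the values at
\<open>(c, 1)\<close> of the homogeneous parts of \<open>F\<close>.\<close>

lemma expands_ray:
  assumes "expands r F f" "\<bar>c\<bar> \<le> 1" "\<bar>t\<bar> \<le> r"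
  shows "(\<lambda>k. (\<Sum>i\<le>k. F $ i $ (k - i) * c ^ i) * t ^ k) sums f (c * t, t)"
proof -
  have "\<bar>c * t\<bar> \<le> 1 * r" unfolding abs_mult using assms by (intro mult_mono) auto
  hence "((\<lambda>(m, n). F $ m $ n * (c * t) ^ m * t ^ n) has_sum f (c * t, t)) UNIV"
    using expandsD[OF assms(1)] assms(3) by simp
  moreover have "((\<lambda>(k, i). F $ i $ (k - i) * (c * t) ^ i * t ^ (k - i)) has_sum f (c * t, t)) (Sigma UNIV (\<lambda>k. {..k}))
     = ((\<lambda>(m, n). F $ m $ n * (c * t) ^ m * t ^ n) has_sum f (c * t, t)) UNIV"
    by (rule has_sum_reindex_bij_witness
      [where i = "\<lambda>(m, n). (m + n, m)" and j = "\<lambda>(k, i). (i, k - i)"]) auto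
  ultimately have "((\<lambda>(k, i). F $ i $ (k - i) * (c * t) ^ i * t ^ (k - i)) has_sum f (c * t, t)) (Sigma UNIV (\<lambda>k. {..k}))"
    by blast
  hence "((\<lambda>k. (\<Sum>i\<le>k. F $ i $ (k - i) * c ^ i) * t ^ k) has_sum f (c * t, t)) UNIV"
  proof (rule has_sum_SigmaD)
    fix k
    have "(\<Sum>i\<le>k. F $ i $ (k - i) * c ^ i) * t ^ k = (\<Sum>i\<le>k. F $ i $ (k - i) * (c * t) ^ i * t ^ (k - i))"
      unfolding sum_distrib_right
    proof (intro sum.cong refl)
      fix i assume "i \<in> {..k}"
      hence "t ^ k = t ^ i * t ^ (k - i)" by (simp flip: power_add)
      thus "F $ i $ (k - i) * c ^ i * t ^ k = F $ i $ (k - i) * (c * t) ^ i * t ^ (k - i)"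
        by (simp add: power_mult_distrib)
    qed
    thus "((\<lambda>i. case (k, i) of (k, i) \<Rightarrow> F $ i $ (k - i) * (c * t) ^ i * t ^ (k - i)) has_sum
        (\<Sum>i\<le>k. F $ i $ (k - i) * c ^ i) * t ^ k) {..k}"
      by (intro has_sum_finiteI) auto
  qed
  thus ?thesis by (rule has_sum_imp_sums)
qed

text \<open>If the first \<open>k\<close> coefficients of both series vanish, then dividing by \<open>t^k ln t\<close> and letting \<open>t\<close>
tend to 0 gives \<open>a k = 0\<close>; now \<open>f t / t^k = O(t)\<close>, and dividing by \<open>t^k\<close> gives \<open>b k = 0\<close>.\<close>

lemma ln_powser_independent:
  fixes a b :: "nat \<Rightarrow> real"
  assumes r: "0 < r"
    and a: "\<And>t. \<bar>t\<bar> < r \<Longrightarrow> (\<lambda>k. a k * t ^ k) sums f t"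
    and b: "\<And>t. \<bar>t\<bar> < r \<Longrightarrow> (\<lambda>k. b k * t ^ k) sums g t"
    and eq: "\<And>t. 0 < t \<Longrightarrow> t < r \<Longrightarrow> f t * ln t + g t = 0"
  shows "a k = 0"
proof -
  have lim: "((\<lambda>t. h t / t ^ k) \<longlongrightarrow> d k) (at_right 0)"
    if d: "\<And>t. \<bar>t\<bar> < r \<Longrightarrow> (\<lambda>k. d k * t ^ k) sums h t" and z: "\<And>i. i < k \<Longrightarrow> d i = 0"
    for d h and k :: nat
  proof -
    have "((\<lambda>t. h t / t ^ k) \<longlongrightarrow> d (0 + k)) (at 0)"
    proof (rule powser_limit_0_strong[OF r, of "\<lambda>i. d (i + k)"])
      fix t :: real assume t: "t \<noteq> 0" "norm t < r"
      hence "(\<lambda>n. d (n + k) * t ^ (n + k)) sums (h t - (\<Sum>i<k. d i * t ^ i))"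
        using d[of t] by (subst sums_iff_shift) auto
      hence "(\<lambda>n. d (n + k) * t ^ (n + k) / t ^ k) sums (h t / t ^ k)"
        using z by (intro sums_divide) simp
      thus "(\<lambda>n. d (n + k) * t ^ n) sums (h t / t ^ k)" using t by (simp add: power_add)
    qed
    thus ?thesis by (rule filterlim_mono) (auto simp: at_within_le_at)
  qed
  have "a k = 0 \<and> b k = 0"
  proof (induction k rule: less_induct)
    case (less k)
    have la: "((\<lambda>t. f t / t ^ k) \<longlongrightarrow> a k) (at_right 0)" using lim[OF a, of k] less by blast
    have lb: "((\<lambda>t. g t / t ^ k) \<longlongrightarrow> b k) (at_right 0)" using lim[OF b, of k] less by blast
    have ev: "\<forall>\<^sub>F t in at_right 0. 0 < t \<and> t < r"
      using r by (auto simp: eventually_at_right_less eventually_at_right intro!: exI[of _ r])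
    have ln0: "((\<lambda>t. 1 / ln t) \<longlongrightarrow> 0) (at_right (0::real))" by real_asymp
    have "\<forall>\<^sub>F t in at_right 0. t < (1::real)"
      by (rule order_tendstoD(2)[OF tendsto_ident_at]) simp
    with ev have e1: "\<forall>\<^sub>F t in at_right 0. - (g t / t ^ k * (1 / ln t)) = f t / t ^ k"
    proof eventually_elim
      case (elim t)
      hence "ln t \<noteq> 0" by simp
      with eq[of t] elim show ?case by (simp add: field_simps)
    qed
    have "((\<lambda>t. - (g t / t ^ k * (1 / ln t))) \<longlongrightarrow> - (b k * 0)) (at_right 0)"
      by (intro tendsto_intros lb ln0)
    hence "((\<lambda>t. f t / t ^ k) \<longlongrightarrow> 0) (at_right 0)"
      using e1 by (simp add: tendsto_cong)
    with la have ak: "a k = 0" using tendsto_unique trivial_limit_at_right_real by blast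
    have la': "((\<lambda>t. f t / t ^ Suc k) \<longlongrightarrow> a (Suc k)) (at_right 0)"
      using lim[OF a, of "Suc k"] less ak by (auto simp: less_Suc_eq)
    have tl: "((\<lambda>t. t * ln t) \<longlongrightarrow> 0) (at_right (0::real))" by real_asymp
    have "((\<lambda>t. - (f t / t ^ Suc k * (t * ln t))) \<longlongrightarrow> - (a (Suc k) * 0)) (at_right 0)"
      by (intro tendsto_intros la' tl)
    moreover have "\<forall>\<^sub>F t in at_right 0. - (f t / t ^ Suc k * (t * ln t)) = g t / t ^ k"
      using ev
    proof eventually_elim
      case (elim t)
      have "f t / t ^ Suc k * (t * ln t) = f t * ln t / t ^ k" using elim by simp
      also have "f t * ln t = - g t" using eq[of t] elim by simp
      finally show ?case by simp
    qed
    ultimately have "((\<lambda>t. g t / t ^ k) \<longlongrightarrow> 0) (at_right 0)" by (simp add: tendsto_cong)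
    with lb have "b k = 0" using tendsto_unique trivial_limit_at_right_real by blast
    with ak show ?case by simp
  qed
  thus ?thesis by simp
qed

text \<open>On the ray \<open>(c t, t)\<close> the logarithm is \<open>2 ln t\<close> plus a constant, so the homogeneous parts of \<open>F\<close>
vanish at \<open>(c, 1)\<close> for infinitely many \<open>c\<close>.\<close>

lemma expands_ln_independent:
  assumes F: "expands r F f" and G: "expands r G g"
    and eq: "\<And>x y. 0 < y \<Longrightarrow> y < r \<Longrightarrow> \<bar>x\<bar> \<le> y \<Longrightarrow> f (x, y) * ln (x\<^sup>2 + y\<^sup>2) + g (x, y) = 0"
  shows "F = 0"
proof -
  note r = expands_pos[OF F]
  have ray: "(\<Sum>i\<le>k. F $ i $ (k - i) * c ^ i) = 0" if c: "\<bar>c\<bar> \<le> 1" for k c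
  proof -
    let ?L = "ln (c\<^sup>2 + 1)"
    let ?e = "\<lambda>H k. \<Sum>i\<le>k. H $ i $ (k - i) * c ^ i"
    have "2 * ?e F k = 0"
    proof (rule ln_powser_independent[OF r, where a = "\<lambda>k. 2 * ?e F k" and f = "\<lambda>t. 2 * f (c * t, t)"
          and b = "\<lambda>k. ?e G k + ?L * ?e F k" and g = "\<lambda>t. g (c * t, t) + ?L * f (c * t, t)"])
      fix t assume t: "\<bar>t\<bar> < r"
      have sF: "(\<lambda>k. ?e F k * t ^ k) sums f (c * t, t)" using expands_ray[OF F c] t by simp
      have sG: "(\<lambda>k. ?e G k * t ^ k) sums g (c * t, t)" using expands_ray[OF G c] t by simp
      show "(\<lambda>k. 2 * ?e F k * t ^ k) sums (2 * f (c * t, t))"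
        using sums_mult[OF sF, of 2] by (simp only: mult.assoc)
      show "(\<lambda>k. (?e G k + ?L * ?e F k) * t ^ k) sums (g (c * t, t) + ?L * f (c * t, t))"
        using sums_add[OF sG sums_mult[OF sF, of ?L]] by (simp only: mult.assoc distrib_right)
    next
      fix t assume t: "0 < t" "t < r"
      have "\<bar>c * t\<bar> \<le> 1 * t" unfolding abs_mult using c t by (intro mult_mono) auto
      hence "f (c * t, t) * ln ((c * t)\<^sup>2 + t\<^sup>2) + g (c * t, t) = 0" using eq[of t "c * t"] t by simp
      moreover have "(c * t)\<^sup>2 + t\<^sup>2 = (c\<^sup>2 + 1) * t\<^sup>2" by (simp add: power_mult_distrib algebra_simps)
      moreover have "ln ((c\<^sup>2 + 1) * t\<^sup>2) = ?L + 2 * ln t"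
        using t add_nonneg_pos[of "c\<^sup>2" 1] by (subst ln_mult_pos) (auto simp: ln_realpow)
      ultimately show "2 * f (c * t, t) * ln t + (g (c * t, t) + ?L * f (c * t, t)) = 0"
        by (simp add: algebra_simps)
    qed
    thus ?thesis by simp
  qed
  have "F $ m $ n = 0" for m n
  proof (rule ccontr)
    assume "F $ m $ n \<noteq> 0"
    hence "\<exists>i\<le>m + n. F $ i $ (m + n - i) \<noteq> 0" by (intro exI[of _ m]) auto
    hence "finite {c. (\<Sum>i\<le>m + n. F $ i $ (m + n - i) * c ^ i) = 0}"
      using polyfun_finite_roots[of "\<lambda>i. F $ i $ (m + n - i)" "m + n"] by blast
    moreover have "{-1..1::real} \<subseteq> {c. (\<Sum>i\<le>m + n. F $ i $ (m + n - i) * c ^ i) = 0}"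
      using ray by auto
    ultimately have "finite {-1..1::real}" by (rule finite_subset[rotated])
    thus False by (simp add: infinite_Icc)
  qed
  thus ?thesis by (simp add: fps_eq_iff)
qed

section \<open>Power series indexed by multi-indices\<close>

lemma Basis_real_real: "(Basis :: (real \<times> real) set) = {(1, 0), (0, 1)}"
  by (auto simp: Basis_prod_def)

text \<open>The multi-index with given exponents; outside the basis it is the default value that the extensional
function space requires.\<close>

abbreviation index_of :: "nat \<times> nat \<Rightarrow> real \<times> real \<Rightarrow> nat" where
  "index_of p \<equiv> restrict (\<lambda>b. if b = (1, 0) then fst p else snd p) Basis"

lemma has_sum_multi_index:
  fixes c :: "(real \<times> real \<Rightarrow> nat) \<Rightarrow> real"
  shows "((\<lambda>\<alpha>. (\<Prod>b\<in>Basis. ((x, y) \<bullet> b) ^ \<alpha> b) *\<^sub>R c \<alpha>) has_sum s)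
          {\<alpha> \<in> Basis \<rightarrow>\<^sub>E (UNIV :: nat set). k \<le> (\<Sum>b\<in>Basis. \<alpha> b)} \<longleftrightarrow>
     ((\<lambda>(m, n). c (index_of (m, n)) * x ^ m * y ^ n) has_sum s) {(m, n). k \<le> m + n}"
proof (rule has_sum_reindex_bij_witness[where i = index_of and j = "\<lambda>\<alpha>. (\<alpha> (1, 0), \<alpha> (0, 1))"])
  fix \<alpha> :: "real \<times> real \<Rightarrow> nat"
  assume "\<alpha> \<in> {\<alpha> \<in> Basis \<rightarrow>\<^sub>E (UNIV :: nat set). k \<le> (\<Sum>b\<in>Basis. \<alpha> b)}"
  hence a: "\<alpha> \<in> extensional Basis" "k \<le> \<alpha> (1, 0) + \<alpha> (0, 1)"
    by (auto simp: PiE_def Basis_real_real)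
  show eq: "index_of (\<alpha> (1, 0), \<alpha> (0, 1)) = \<alpha>"
    using a(1) by (auto simp: fun_eq_iff restrict_def extensional_def Basis_real_real)
  show "(\<alpha> (1, 0), \<alpha> (0, 1)) \<in> {(m, n). k \<le> m + n}" using a(2) by simp
  show "(case (\<alpha> (1, 0), \<alpha> (0, 1)) of (m, n) \<Rightarrow> c (index_of (m, n)) * x ^ m * y ^ n) =
      (\<Prod>b\<in>Basis. ((x, y) \<bullet> b) ^ \<alpha> b) *\<^sub>R c \<alpha>"
    by (simp only: prod.case eq) (simp add: Basis_real_real)
qed (auto simp: Basis_real_real)

lemma power_series_from_degree_iff:
  fixes f :: "real \<times> real \<Rightarrow> real"
  shows "power_series_from_degree k f 0 \<longleftrightarrow>
    (\<exists>r F. expands r F f \<and> (\<forall>m n. m + n < k \<longrightarrow> F $ m $ n = 0))"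
proof
  assume "power_series_from_degree k f 0"
  then obtain c where c: "\<forall>\<^sub>F x in nhds 0. ((\<lambda>\<alpha>. (\<Prod>b\<in>Basis. (x \<bullet> b) ^ \<alpha> b) *\<^sub>R c \<alpha>) has_sum f x)
          {\<alpha> \<in> Basis \<rightarrow>\<^sub>E (UNIV :: nat set). k \<le> (\<Sum>b\<in>Basis. \<alpha> b)}"
    unfolding power_series_from_degree_def by (simp only: diff_0_right) blast
  then obtain d where d: "0 < d" and dd: "\<And>x. dist x 0 < d \<Longrightarrow>
      ((\<lambda>\<alpha>. (\<Prod>b\<in>Basis. (x \<bullet> b) ^ \<alpha> b) *\<^sub>R c \<alpha>) has_sum f x)
          {\<alpha> \<in> Basis \<rightarrow>\<^sub>E (UNIV :: nat set). k \<le> (\<Sum>b\<in>Basis. \<alpha> b)}"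
    unfolding eventually_nhds_metric by blast
  define F where "F = Abs_fps (\<lambda>m. Abs_fps (\<lambda>n. if k \<le> m + n then c (index_of (m, n)) else 0))"
  have "expands (d / 3) F f"
    unfolding expands_def
  proof (intro conjI allI impI)
    fix x y :: real assume "\<bar>x\<bar> \<le> d / 3" "\<bar>y\<bar> \<le> d / 3"
    hence "norm (x, y) < d" using norm_Pair_le[of x y] d by simp
    hence "((\<lambda>(m, n). c (index_of (m, n)) * x ^ m * y ^ n) has_sum f (x, y)) {(m, n). k \<le> m + n}"
      using dd[of "(x, y)"] unfolding has_sum_multi_index by (simp only: dist_0_norm dist_commute[of _ 0])
    moreover have "((\<lambda>(m, n). c (index_of (m, n)) * x ^ m * y ^ n) has_sum f (x, y)) {(m, n). k \<le> m + n}
      = ((\<lambda>(m, n). F $ m $ n * x ^ m * y ^ n) has_sum f (x, y)) UNIV"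
      by (rule has_sum_cong_neutral) (auto simp: F_def)
    ultimately show "((\<lambda>(m, n). F $ m $ n * x ^ m * y ^ n) has_sum f (x, y)) UNIV" by blast
  qed (use d in simp)
  thus "\<exists>r F. expands r F f \<and> (\<forall>m n. m + n < k \<longrightarrow> F $ m $ n = 0)"
    by (intro exI[of _ "d / 3"] exI[of _ F]) (simp add: F_def)
next
  assume "\<exists>r F. expands r F f \<and> (\<forall>m n. m + n < k \<longrightarrow> F $ m $ n = 0)"
  then obtain r F where F: "expands r F f" and z: "\<And>m n. m + n < k \<Longrightarrow> F $ m $ n = 0" by blast
  define c where "c = (\<lambda>\<alpha>. F $ (\<alpha> (1::real, 0::real)) $ (\<alpha> (0, 1)))"
  have "\<forall>\<^sub>F x in nhds 0. ((\<lambda>\<alpha>. (\<Prod>b\<in>Basis. (x \<bullet> b) ^ \<alpha> b) *\<^sub>R c \<alpha>) has_sum f x)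
          {\<alpha> \<in> Basis \<rightarrow>\<^sub>E (UNIV :: nat set). k \<le> (\<Sum>b\<in>Basis. \<alpha> b)}"
    unfolding eventually_nhds_metric
  proof (intro exI[of _ r] conjI allI impI)
    fix p :: "real \<times> real" assume p: "dist p 0 < r"
    obtain x y where xy: "p = (x, y)" by (cases p)
    have "\<bar>x\<bar> \<le> r" "\<bar>y\<bar> \<le> r"
      using p norm_fst_le[of x y] norm_snd_le[of y x] by (auto simp: xy)
    hence "((\<lambda>(m, n). F $ m $ n * x ^ m * y ^ n) has_sum f (x, y)) UNIV" by (rule expandsD[OF F])
    moreover have "((\<lambda>(m, n). c (index_of (m, n)) * x ^ m * y ^ n) has_sum f (x, y)) {(m, n). k \<le> m + n}
      = ((\<lambda>(m, n). F $ m $ n * x ^ m * y ^ n) has_sum f (x, y)) UNIV"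
      by (rule has_sum_cong_neutral) (auto simp: c_def z Basis_real_real)
    ultimately show "((\<lambda>\<alpha>. (\<Prod>b\<in>Basis. (p \<bullet> b) ^ \<alpha> b) *\<^sub>R c \<alpha>) has_sum f p)
          {\<alpha> \<in> Basis \<rightarrow>\<^sub>E (UNIV :: nat set). k \<le> (\<Sum>b\<in>Basis. \<alpha> b)}"
      unfolding xy has_sum_multi_index by blast
  qed (fact expands_pos[OF F])
  thus "power_series_from_degree k f 0"
    unfolding power_series_from_degree_def by (simp only: diff_0_right) blast
qed

section \<open>The cubic P and a branch of its square root\<close>

text \<open>The signs of \<open>P\<close> at \<open>-1, 0, 1, 3\<close> separate the roots, and Vieta's formulas follow from divided
differences. In this form the factorization transfers to complex arguments.\<close>

lemma P_poly_roots:
  fixes h l :: real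
  assumes "\<bar>h\<bar> < 1/2" "l \<noteq> 0" "\<bar>l\<bar> < 1/2"
  obtains z0 z1 z2 where "-1 < z0" "z0 < 0" "0 < z1" "z1 < 1" "1 < z2"
    "h + 1 = z0 + z1 + z2" "z0 * z1 + z0 * z2 + z1 * z2 = -1" "2 * (h + 1) - l\<^sup>2 = - 2 * z0 * z1 * z2"
proof -
  have l2: "0 < l\<^sup>2" "l\<^sup>2 < 1"
    using assms by (auto simp: abs_square_less_1)
  have c: "continuous_on S (P_poly h l)" for S
    unfolding P_poly_def by (intro continuous_intros)
  have v: "P_poly h l (-1) < 0" "0 < P_poly h l 0" "P_poly h l 1 < 0" "0 < P_poly h l 3"
    using assms l2 unfolding P_poly_def by (auto simp: power2_eq_square field_simps)
  obtain z0 where z0: "-1 \<le> z0" "z0 \<le> 0" "P_poly h l z0 = 0"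
    using IVT'[of "P_poly h l" "-1" 0 0] v c by auto
  obtain z1 where z1: "0 \<le> z1" "z1 \<le> 1" "P_poly h l z1 = 0"
    using IVT2'[of "P_poly h l" 1 0 0] v c by auto
  obtain z2 where z2: "1 \<le> z2" "z2 \<le> 3" "P_poly h l z2 = 0"
    using IVT'[of "P_poly h l" 1 0 3] v c by auto
  have ne: "z0 \<noteq> -1" "z0 \<noteq> 0" "z1 \<noteq> 0" "z1 \<noteq> 1" "z2 \<noteq> 1"
    using v z0(3) z1(3) z2(3) by auto
  hence lt: "-1 < z0" "z0 < 0" "0 < z1" "z1 < 1" "1 < z2" using z0 z1 z2 by linarith+
  have Q: "x\<^sup>2 + x * y + y\<^sup>2 - (h + 1) * (x + y) - 1 = 0"
    if "P_poly h l x = 0" "P_poly h l y = 0" "x \<noteq> y" for x y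
  proof -
    have "2 * (x - y) * (x\<^sup>2 + x * y + y\<^sup>2 - (h + 1) * (x + y) - 1) = P_poly h l x - P_poly h l y"
      unfolding P_poly_def by (simp add: power2_eq_square algebra_simps)
    with that show ?thesis by simp
  qed
  have q1: "z0\<^sup>2 + z0 * z1 + z1\<^sup>2 - (h + 1) * (z0 + z1) - 1 = 0"
    and q2: "z0\<^sup>2 + z0 * z2 + z2\<^sup>2 - (h + 1) * (z0 + z2) - 1 = 0"
    using Q z0 z1 z2 lt by auto
  have "(z1 - z2) * (z0 + z1 + z2 - (h + 1)) =
     (z0\<^sup>2 + z0 * z1 + z1\<^sup>2 - (h + 1) * (z0 + z1) - 1) - (z0\<^sup>2 + z0 * z2 + z2\<^sup>2 - (h + 1) * (z0 + z2) - 1)"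
    by (simp add: power2_eq_square algebra_simps)
  hence e1: "h + 1 = z0 + z1 + z2" using q1 q2 lt by simp
  have e2: "z0 * z1 + z0 * z2 + z1 * z2 = -1"
    using q1 unfolding e1 by (simp add: power2_eq_square algebra_simps)
  have "2 * (h + 1) - l\<^sup>2 = P_poly h l z0 + 2 * z0 * (1 + (h + 1) * z0 - z0\<^sup>2)"
    unfolding P_poly_def by (simp add: power2_eq_square algebra_simps)
  also have "\<dots> = 2 * z0 * (- (z0 * z1 + z0 * z2 + z1 * z2) + (z0 + z1 + z2) * z0 - z0\<^sup>2)"
    using z0(3) e1 e2 by simp
  also have "\<dots> = - 2 * z0 * z1 * z2"
    by (simp add: power2_eq_square algebra_simps)
  finally show ?thesis using that lt e1 e2 by blast
qed

lemma P_poly_factor: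
  assumes "h + 1 = z0 + z1 + z2" "z0 * z1 + z0 * z2 + z1 * z2 = -1"
    "2 * (h + 1) - l\<^sup>2 = - 2 * z0 * z1 * z2"
  shows "P_poly h l x = 2 * (x - z0) * (x - z1) * (x - z2)"
proof -
  have "P_poly h l x = 2 * x^3 - 2 * (h + 1) * x\<^sup>2 - 2 * x + (2 * (h + 1) - l\<^sup>2)"
    unfolding P_poly_def by (simp add: power2_eq_square power3_eq_cube algebra_simps)
  also have "\<dots> = 2 * x^3 - 2 * (z0 + z1 + z2) * x\<^sup>2 + 2 * (z0 * z1 + z0 * z2 + z1 * z2) * x - 2 * z0 * z1 * z2"
    unfolding assms(3) unfolding assms(1,2) by simp
  also have "\<dots> = 2 * (x - z0) * (x - z1) * (x - z2)"
    by (simp add: power2_eq_square power3_eq_cube algebra_simps)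
  finally show ?thesis .
qed

lemma action1_eq_integral:
  assumes z: "-1 < z0" "z0 < 0" "0 < z1" "z1 < 1" "1 < z2"
    and f: "\<And>x. P_poly h l x = 2 * (x - z0) * (x - z1) * (x - z2)"
  shows "action1 h l = 1 / pi * integral {z0..z1} (\<lambda>\<zeta>. sqrt (P_poly h l \<zeta>) / (1 - \<zeta>\<^sup>2))"
proof -
  have "(THE z. are_roots h l z) = (z0, z1, z2)"
  proof (rule the_equality)
    show "are_roots h l (z0, z1, z2)" using z f by (auto simp: are_roots_def)
  next
    fix w assume "are_roots h l w"
    then obtain w0 w1 w2 where w: "w = (w0, w1, w2)" "-1 \<le> w0" "w0 \<le> w1" "w1 \<le> 1" "1 \<le> w2"
      and fw: "\<And>x. P_poly h l x = 2 * (x - w0) * (x - w1) * (x - w2)"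
      by (cases w) (auto simp: are_roots_def)
    have pos: "0 < P_poly h l 0" "P_poly h l 1 < 0"
      using z by (auto simp: f mult_less_0_iff zero_less_mult_iff)
    hence "w0 * w1 * w2 < 0" "w2 \<noteq> 1" "w1 \<noteq> 1" using fw[of 0] fw[of 1] by auto
    with w have lt: "w0 < 0" "0 < w1" "w1 < 1" "1 < w2"
      by (auto simp: mult_less_0_iff zero_less_mult_iff)
    have "x = z0 \<or> x = z1 \<or> x = z2" if "P_poly h l x = 0" for x
      using that unfolding f by auto
    moreover have "P_poly h l w0 = 0" "P_poly h l w1 = 0" "P_poly h l w2 = 0" by (simp_all add: fw)
    ultimately have "w0 = z0" "w1 = z1" "w2 = z2" using lt z
      by (metis less_asym less_trans zero_less_one)+
    thus "w = (z0, z1, z2)" using w by simp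
  qed
  thus ?thesis by (simp add: action1_def)
qed

text \<open>The principal root takes on the negative axis its limits from above. The rotation by \<open>- \<i>\<close> moves the closed upper
half-plane into the right one, where continuity holds away from the origin by analyticity.\<close>

lemma continuous_on_csqrt_upper: "continuous_on {z. 0 \<le> Im z} csqrt"
proof -
  define w :: complex where "w = Complex (1 / sqrt 2) (1 / sqrt 2)"
  have w2: "w\<^sup>2 = \<i>" by (simp add: w_def power2_eq_square complex_eq_iff)
  have eq: "csqrt z = w * csqrt (- \<i> * z)" if "0 \<le> Im z" for z
  proof (rule csqrt_unique)
    define v where "v = csqrt (- \<i> * z)"
    have v2: "v\<^sup>2 = - \<i> * z" by (simp add: v_def)
    show "(w * csqrt (- \<i> * z))\<^sup>2 = z" by (simp add: power_mult_distrib w2)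
    have "(Im v)\<^sup>2 \<le> (Re v)\<^sup>2" using arg_cong[OF v2, of Re] that by (simp add: power2_eq_square)
    moreover have "0 \<le> Re v" unfolding v_def using csqrt_principal[of "- \<i> * z"] by linarith
    ultimately have "\<bar>Im v\<bar> \<le> Re v" using abs_le_square_iff[of "Im v" "Re v"] by simp
    hence "0 \<le> Re v - Im v" "0 \<le> Re v + Im v" by linarith+
    moreover have "Re (w * v) = (Re v - Im v) / sqrt 2" "Im (w * v) = (Re v + Im v) / sqrt 2"
      by (auto simp: w_def field_simps)
    ultimately show "0 < Re (w * csqrt (- \<i> * z)) \<or> Re (w * csqrt (- \<i> * z)) = 0 \<and> 0 \<le> Im (w * csqrt (- \<i> * z))"
      unfolding v_def[symmetric] by (auto simp: less_le)
  qed
  have c0: "isCont csqrt 0"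
    unfolding isCont_def
  proof -
    have "((\<lambda>z. sqrt (cmod z)) \<longlongrightarrow> sqrt (cmod 0)) (at 0)" by (intro tendsto_intros)
    hence "((\<lambda>z. cmod (csqrt z)) \<longlongrightarrow> 0) (at 0)" by (simp del: csqrt.sel)
    hence "(csqrt \<longlongrightarrow> 0) (at 0)" by (rule tendsto_norm_zero_cancel)
    thus "(csqrt \<longlongrightarrow> csqrt 0) (at 0)" by simp
  qed
  have "continuous_on {z. 0 \<le> Im z} (\<lambda>z. w * csqrt (- \<i> * z))"
  proof (intro continuous_intros continuous_at_imp_continuous_on ballI)
    fix z assume z: "z \<in> {z. 0 \<le> Im z}"
    have "isCont csqrt (- \<i> * z)"
    proof (cases "z = 0")
      case False
      have "- \<i> * z \<notin> \<real>\<^sub>\<le>\<^sub>0" using z False by (auto simp: complex_nonpos_Reals_iff complex_eq_iff)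
      thus ?thesis by (rule continuous_at_csqrt)
    qed (use c0 in simp)
    thus "isCont (\<lambda>z. csqrt (- \<i> * z)) z"
      by (intro isCont_o2[where g = csqrt and f = "\<lambda>z. - \<i> * z"] continuous_intros)
  qed
  thus ?thesis by (rule continuous_on_eq) (simp add: eq)
qed

text \<open>The branch of \<open>\<surd>P\<close> on the closed upper half-plane that is positive between the two smaller roots. Each
\<open>csqrt (\<zeta> - z)\<close> equals \<open>\<i> \<surd>(z - \<zeta>)\<close> to the left of \<open>z\<close>, and the sign makes up for the two such factors.\<close>

definition root_P :: "real \<Rightarrow> real \<Rightarrow> real \<Rightarrow> complex \<Rightarrow> complex" where
  "root_P z0 z1 z2 \<zeta> = - of_real (sqrt 2) * (csqrt (\<zeta> - of_real z0) * csqrt (\<zeta> - of_real z1) * csqrt (\<zeta> - of_real z2))"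

lemma root_P_square: "(root_P z0 z1 z2 \<zeta>)\<^sup>2 = 2 * (\<zeta> - of_real z0) * (\<zeta> - of_real z1) * (\<zeta> - of_real z2)"
proof -
  have "(complex_of_real (sqrt 2))\<^sup>2 = 2" by (simp flip: of_real_power)
  thus ?thesis by (simp add: root_P_def power_mult_distrib)
qed

lemma continuous_on_root_P: "continuous_on {z. 0 \<le> Im z} (root_P z0 z1 z2)"
  unfolding root_P_def
  by (intro continuous_intros continuous_on_compose2[OF continuous_on_csqrt_upper]) auto

lemma root_P_field_differentiable:
  assumes "0 < Im \<zeta>"
  shows "root_P z0 z1 z2 field_differentiable (at \<zeta>)"
proof -
  have n: "\<zeta> - of_real c \<notin> \<real>\<^sub>\<le>\<^sub>0" for c using assms by (auto simp: complex_nonpos_Reals_iff)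
  show ?thesis unfolding root_P_def field_differentiable_def
    by (rule exI) (rule derivative_eq_intros refl n)+
qed

lemma csqrt_of_real_neg: "x < 0 \<Longrightarrow> csqrt (of_real x) = \<i> * of_real (sqrt (- x))"
  by (simp add: complex_eq_iff)

lemma root_P_below:
  assumes "x < z0" "z0 < z1" "z1 < z2"
  shows "root_P z0 z1 z2 (of_real x) = \<i> * of_real (sqrt (- (2 * (x - z0) * (x - z1) * (x - z2))))"
proof -
  have e: "csqrt (of_real x - of_real c) = \<i> * of_real (sqrt (c - x))" if "x < c" for c
    using csqrt_of_real_neg[of "x - c"] that by simp
  have "- (2 * (x - z0) * (x - z1) * (x - z2)) = 2 * (z0 - x) * (z1 - x) * (z2 - x)"
    by (simp add: algebra_simps)
  hence "sqrt (- (2 * (x - z0) * (x - z1) * (x - z2))) = sqrt 2 * sqrt (z0 - x) * sqrt (z1 - x) * sqrt (z2 - x)"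
    by (simp only: real_sqrt_mult)
  moreover have "root_P z0 z1 z2 (of_real x) = \<i> * of_real (sqrt 2 * sqrt (z0 - x) * sqrt (z1 - x) * sqrt (z2 - x))"
    using assms by (simp add: root_P_def e complex_eq_iff)
  ultimately show ?thesis by simp
qed

lemma root_P_between:
  assumes "z0 \<le> x" "x \<le> z1" "z1 < z2"
  shows "root_P z0 z1 z2 (of_real x) = of_real (sqrt (2 * (x - z0) * (x - z1) * (x - z2)))"
proof -
  have e: "csqrt (of_real x - of_real c) = \<i> * of_real (sqrt (c - x))" if "x \<le> c" for c
    using csqrt_of_real_neg[of "x - c"] that by (cases "x = c") auto
  have e': "csqrt (of_real x - of_real z0) = of_real (sqrt (x - z0))"
    using csqrt_of_real_nonneg[of "x - z0"] assms by simp
  have "2 * (x - z0) * (x - z1) * (x - z2) = 2 * (x - z0) * (z1 - x) * (z2 - x)"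
    by (simp add: algebra_simps)
  hence "sqrt (2 * (x - z0) * (x - z1) * (x - z2)) = sqrt 2 * sqrt (x - z0) * sqrt (z1 - x) * sqrt (z2 - x)"
    by (simp only: real_sqrt_mult)
  moreover have "root_P z0 z1 z2 (of_real x) = of_real (sqrt 2 * sqrt (x - z0) * sqrt (z1 - x) * sqrt (z2 - x))"
    using assms by (simp add: root_P_def e e' complex_eq_iff)
  ultimately show ?thesis by simp
qed

lemma root_P_above:
  assumes "z0 < z1" "z1 < x" "x < z2"
  shows "Re (root_P z0 z1 z2 (of_real x)) = 0"
proof -
  have e: "csqrt (of_real x - of_real z2) = \<i> * of_real (sqrt (z2 - x))"
    using csqrt_of_real_neg[of "x - z2"] assms by simp
  have e': "csqrt (of_real x - of_real c) = of_real (sqrt (x - c))" if "c < x" for c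
    using csqrt_of_real_nonneg[of "x - c"] that by simp
  show ?thesis using assms by (simp add: root_P_def e e')
qed

section \<open>The action as an integral over an arc in the upper half-plane\<close>

definition complex_P :: "real \<times> real \<Rightarrow> complex \<Rightarrow> complex" where
  "complex_P x \<zeta> = 2 * (1 - \<zeta>\<^sup>2) * (of_real (fst x) + 1 - \<zeta>) - (of_real (snd x))\<^sup>2"

lemma complex_P_of_real: "complex_P x (of_real t) = of_real (P_poly (fst x) (snd x) t)"
  by (simp add: complex_P_def P_poly_def)

lemma complex_P_factor:
  assumes "h + 1 = z0 + z1 + z2" "z0 * z1 + z0 * z2 + z1 * z2 = -1"
    "2 * (h + 1) - l\<^sup>2 = - 2 * z0 * z1 * z2"
  shows "complex_P (h, l) \<zeta> = 2 * (\<zeta> - of_real z0) * (\<zeta> - of_real z1) * (\<zeta> - of_real z2)"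
proof -
  have e1: "complex_of_real h + 1 = of_real z0 + of_real z1 + of_real z2"
    using arg_cong[OF assms(1), of complex_of_real] by simp
  have e2: "complex_of_real z0 * of_real z1 + of_real z0 * of_real z2 + of_real z1 * of_real z2 = -1"
    using arg_cong[OF assms(2), of complex_of_real] by simp
  have e3: "2 * (complex_of_real h + 1) - (of_real l)\<^sup>2 = - 2 * of_real z0 * of_real z1 * of_real z2"
    using arg_cong[OF assms(3), of complex_of_real] by simp
  have "complex_P (h, l) \<zeta> = 2 * \<zeta>^3 - 2 * (of_real h + 1) * \<zeta>\<^sup>2 - 2 * \<zeta> + (2 * (of_real h + 1) - (of_real l)\<^sup>2)"
    unfolding complex_P_def by (simp add: power2_eq_square power3_eq_cube algebra_simps)
  also have "\<dots> = 2 * \<zeta>^3 - 2 * (of_real z0 + of_real z1 + of_real z2) * \<zeta>\<^sup>2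
      + 2 * (of_real z0 * of_real z1 + of_real z0 * of_real z2 + of_real z1 * of_real z2) * \<zeta>
      - 2 * of_real z0 * of_real z1 * of_real z2"
    unfolding e3 unfolding e1 e2 by simp
  also have "\<dots> = 2 * (\<zeta> - of_real z0) * (\<zeta> - of_real z1) * (\<zeta> - of_real z2)"
    by (simp add: power2_eq_square power3_eq_cube algebra_simps)
  finally show ?thesis .
qed

text \<open>A neighbourhood of the critical value \<open>(0, 0)\<close> without the axis \<open>l = 0\<close>; on it the roots of \<open>P\<close> are
simple and differ from the poles \<open>\<plusminus> 1\<close>.\<close>

definition regular_values :: "(real \<times> real) set" where
  "regular_values = {x. \<bar>fst x\<bar> < 1/2 \<and> snd x \<noteq> 0 \<and> \<bar>snd x\<bar> < 1/2}"

lemma open_regular_values: "open regular_values"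
  unfolding regular_values_def
  by (intro open_Collect_conj open_Collect_less open_Collect_neq continuous_intros)

text \<open>The real points \<open>a\<close> and \<open>b\<close> separate the interval between the two smaller roots from the poles
\<open>\<plusminus> 1\<close>, for the parameter \<open>x0 = (h, l)\<close> and hence for all nearby ones.\<close>

locale upper_arc =
  fixes a b :: real and x0 :: "real \<times> real"
  assumes a: "-1 < a" "a < 0" and b: "0 < b" "b < 1" and x0: "x0 \<in> regular_values"
    and Pa: "P_poly (fst x0) (snd x0) a < 0" and Pb: "P_poly (fst x0) (snd x0) b < 0"
begin

definition \<gamma> :: "real \<Rightarrow> complex" where "\<gamma> t = Complex t ((t - a) * (b - t))"

definition \<gamma>' :: "real \<Rightarrow> complex" where "\<gamma>' t = Complex 1 (a + b - 2 * t)"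

lemma \<gamma>_endpoints: "\<gamma> a = of_real a" "\<gamma> b = of_real b"
  by (simp_all add: \<gamma>_def complex_eq_iff)

lemma \<gamma>_eq: "\<gamma> = (\<lambda>t. of_real t + \<i> * of_real ((t - a) * (b - t)))"
  by (auto simp: \<gamma>_def complex_eq_iff)

lemma \<gamma>'_eq: "\<gamma>' = (\<lambda>t. 1 + \<i> * of_real (a + b - 2 * t))"
  by (auto simp: \<gamma>'_def complex_eq_iff)

lemma \<gamma>_deriv: "(\<gamma> has_vector_derivative \<gamma>' t) (at t within S)"
proof -
  have "((\<lambda>t. of_real t + \<i> * of_real ((t - a) * (b - t))) has_vector_derivative
      (of_real 1 + \<i> * of_real (1 * (b - t) + (t - a) * (- 1)))) (at t within S)"
    by (auto intro!: derivative_eq_intros simp: algebra_simps)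
  thus ?thesis unfolding \<gamma>_eq \<gamma>'_eq by (simp add: algebra_simps)
qed

lemma continuous_\<gamma>: "continuous_on S \<gamma>" "continuous_on S \<gamma>'"
  unfolding \<gamma>_eq \<gamma>'_eq by (intro continuous_intros)+

lemma \<gamma>_in: "t \<in> {a..b} \<Longrightarrow> 0 \<le> Im (\<gamma> t)" "t \<in> {a<..<b} \<Longrightarrow> 0 < Im (\<gamma> t)" "Re (\<gamma> t) = t"
  by (auto simp: \<gamma>_def)

lemma pole_free: "a \<le> Re \<zeta> \<Longrightarrow> Re \<zeta> \<le> b \<Longrightarrow> 1 - \<zeta>\<^sup>2 \<noteq> 0"
  using a b by (auto simp: power2_eq_1_iff)

lemma \<gamma>_pole_free: "t \<in> {a..b} \<Longrightarrow> 1 - (\<gamma> t)\<^sup>2 \<noteq> 0"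
  by (rule pole_free) (auto simp: \<gamma>_in)

lemma roots_outside:
  assumes x: "(h, l) \<in> regular_values" and P: "P_poly h l a < 0" "P_poly h l b < 0"
  shows "\<exists>z0 z1 z2. -1 < z0 \<and> z0 < 0 \<and> 0 < z1 \<and> z1 < 1 \<and> 1 < z2 \<and> a < z0 \<and> z1 < b \<and>
    (\<forall>\<zeta>. complex_P (h, l) \<zeta> = 2 * (\<zeta> - of_real z0) * (\<zeta> - of_real z1) * (\<zeta> - of_real z2)) \<and>
    (\<forall>x. P_poly h l x = 2 * (x - z0) * (x - z1) * (x - z2))"
proof -
  obtain z0 z1 z2 where z: "-1 < z0" "z0 < 0" "0 < z1" "z1 < 1" "1 < z2"
    "h + 1 = z0 + z1 + z2" "z0 * z1 + z0 * z2 + z1 * z2 = -1" "2 * (h + 1) - l\<^sup>2 = - 2 * z0 * z1 * z2"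
    using P_poly_roots[of h l] x by (auto simp: regular_values_def)
  have f: "P_poly h l x = 2 * (x - z0) * (x - z1) * (x - z2)" for x
    using z by (intro P_poly_factor) auto
  have "a < z0" using P(1) a z unfolding f by (auto simp: mult_less_0_iff zero_less_mult_iff)
  moreover have "z1 < b" using P(2) b z unfolding f by (auto simp: mult_less_0_iff zero_less_mult_iff)
  ultimately show ?thesis using z f complex_P_factor[OF z(6-8)] by blast
qed

lemma complex_P_nonzero:
  assumes x: "x \<in> regular_values" and P: "P_poly (fst x) (snd x) a < 0" "P_poly (fst x) (snd x) b < 0"
    and t: "t \<in> {a..b}"
  shows "complex_P x (\<gamma> t) \<noteq> 0"
proof -
  obtain h l where hl: "x = (h, l)" by (cases x)
  obtain z0 z1 z2 where z: "z0 < 0" "0 < z1" "1 < z2" "a < z0" "z1 < b"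
    "\<And>\<zeta>. complex_P (h, l) \<zeta> = 2 * (\<zeta> - of_real z0) * (\<zeta> - of_real z1) * (\<zeta> - of_real z2)"
    using roots_outside[of h l] x P unfolding hl fst_conv snd_conv by blast
  have "\<gamma> t \<noteq> of_real z" if "a < z" "z < b \<or> 1 < z" for z
  proof
    assume "\<gamma> t = of_real z"
    hence "t = z" "(t - a) * (b - t) = 0" by (auto simp: \<gamma>_def complex_eq_iff)
    thus False using that t b by auto
  qed
  thus ?thesis using z a b unfolding hl z(6) by auto
qed

text \<open>Both sides are increments of a primitive of \<open>root_P / (1 - \<zeta>^2)\<close> on the half-strip above \<open>[a, b]\<close>,
once along the arc and once along the real axis. On the real axis only the part between the roots
contributes to the real part.\<close>

lemma action1_eq_arc_integral:
  assumes x: "(h, l) \<in> regular_values" and P: "P_poly h l a < 0" "P_poly h l b < 0"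
    and z: "-1 < z0" "z0 < 0" "0 < z1" "z1 < 1" "1 < z2" "a < z0" "z1 < b"
    and f: "\<And>x. P_poly h l x = 2 * (x - z0) * (x - z1) * (x - z2)"
  shows "action1 h l = 1 / pi * Re (integral {a..b} (\<lambda>t. \<gamma>' t * root_P z0 z1 z2 (\<gamma> t) / (1 - (\<gamma> t)\<^sup>2)))"
proof -
  define S where "S = {\<zeta>. 0 \<le> Im \<zeta> \<and> a \<le> Re \<zeta> \<and> Re \<zeta> \<le> b}"
  define F where "F = (\<lambda>\<zeta>. root_P z0 z1 z2 \<zeta> / (1 - \<zeta>\<^sup>2))"
  have conv: "convex S"
  proof -
    have "S = {\<zeta>. Im \<zeta> \<ge> 0} \<inter> {\<zeta>. Re \<zeta> \<ge> a} \<inter> {\<zeta>. Re \<zeta> \<le> b}" by (auto simp: S_def)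
    thus ?thesis by (simp add: convex_Int convex_halfspace_Im_ge convex_halfspace_Re_ge convex_halfspace_Re_le)
  qed
  have cont: "continuous_on S F"
    unfolding F_def
    by (intro continuous_on_divide continuous_on_subset[OF continuous_on_root_P] continuous_intros)
       (use pole_free in \<open>auto simp: S_def\<close>)
  have sub: "interior S \<subseteq> {\<zeta>. 0 < Im \<zeta>}"
  proof
    fix \<zeta> assume "\<zeta> \<in> interior S"
    then obtain e where e: "0 < e" "ball \<zeta> e \<subseteq> S" by (auto simp: mem_interior)
    have "\<zeta> - \<i> * of_real (e / 2) \<in> ball \<zeta> e" using e(1) by (simp add: dist_norm norm_mult)
    hence "\<zeta> - \<i> * of_real (e / 2) \<in> S" using e(2) by blast
    hence "0 \<le> Im (\<zeta> - \<i> * of_real (e / 2))" unfolding S_def by blast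
    thus "\<zeta> \<in> {\<zeta>. 0 < Im \<zeta>}" using e(1) by simp
  qed
  obtain g where g: "\<And>\<zeta>. \<zeta> \<in> S \<Longrightarrow> (g has_field_derivative F \<zeta>) (at \<zeta> within S)"
  proof (rule holomorphic_convex_primitive[OF conv _ cont])
    fix \<zeta> assume "\<zeta> \<in> interior S - {}"
    hence "\<zeta> \<in> S" "0 < Im \<zeta>" using sub interior_subset by auto
    thus "F field_differentiable at \<zeta>"
      unfolding F_def S_def
      by (intro field_differentiable_divide root_P_field_differentiable derivative_intros field_differentiable_diff field_differentiable_power field_differentiable_ident field_differentiable_const pole_free) auto
  qed auto
  have ftc: "((\<lambda>t. c' t * F (c t)) has_integral g (of_real b) - g (of_real a)) {a..b}"
    if c: "\<And>t. t \<in> {a..b} \<Longrightarrow> (c has_vector_derivative c' t) (at t within {a..b})"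
      and cS: "c ` {a..b} \<subseteq> S" and e: "c a = of_real a" "c b = of_real b" for c c'
  proof -
    have "((\<lambda>t. c' t * F (c t)) has_integral (g \<circ> c) b - (g \<circ> c) a) {a..b}"
    proof (rule fundamental_theorem_of_calculus)
      fix t assume t: "t \<in> {a..b}"
      show "((g \<circ> c) has_vector_derivative c' t * F (c t)) (at t within {a..b})"
        by (rule field_vector_diff_chain_within[OF c[OF t] DERIV_subset[OF g]]) (use cS t in auto)
    qed (use a b in simp)
    thus ?thesis by (simp add: e)
  qed
  have I1: "((\<lambda>t. \<gamma>' t * F (\<gamma> t)) has_integral g (of_real b) - g (of_real a)) {a..b}"
    by (rule ftc) (auto simp: \<gamma>_deriv \<gamma>_endpoints \<gamma>_in S_def)
  have I2: "((\<lambda>t. 1 * F (of_real t)) has_integral g (of_real b) - g (of_real a)) {a..b}"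
    by (rule ftc) (auto simp: S_def intro!: derivative_eq_intros)
  have "((\<lambda>t. Re (F (of_real t))) has_integral Re (g (of_real b) - g (of_real a))) {a..b}"
    using has_integral_Re[OF I2] by simp
  hence "Re (integral {a..b} (\<lambda>t. \<gamma>' t * F (\<gamma> t))) = integral {a..b} (\<lambda>t. Re (F (of_real t)))"
    using I1 by (simp add: integral_unique)
  also have "integral {a..b} (\<lambda>t. Re (F (of_real t))) =
      integral {a..b} (\<lambda>t. if t \<in> {z0..z1} then sqrt (P_poly h l t) / (1 - t\<^sup>2) else 0)"
  proof (rule integral_cong)
    fix t assume t: "t \<in> {a..b}"
    have d: "F (of_real t) = root_P z0 z1 z2 (of_real t) / of_real (1 - t\<^sup>2)" by (simp add: F_def)
    have R: "Re (F (of_real t)) = Re (root_P z0 z1 z2 (of_real t)) / (1 - t\<^sup>2)"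
      unfolding d by (rule Re_divide_of_real)
    consider "t < z0" | "t \<in> {z0..z1}" | "z1 < t" by fastforce
    thus "Re (F (of_real t)) = (if t \<in> {z0..z1} then sqrt (P_poly h l t) / (1 - t\<^sup>2) else 0)"
    proof cases
      case 1 thus ?thesis using z by (simp add: R root_P_below)
    next
      case 2 thus ?thesis using z by (simp add: R root_P_between f)
    next
      case 3 thus ?thesis using z t b by (simp add: R root_P_above)
    qed
  qed
  also have "\<dots> = integral ({z0..z1} \<inter> {a..b}) (\<lambda>t. sqrt (P_poly h l t) / (1 - t\<^sup>2))"
    by (rule Henstock_Kurzweil_Integration.integral_restrict_Int)
  also have "{z0..z1} \<inter> {a..b} = {z0..z1}" using z by auto
  finally show ?thesis
    unfolding action1_eq_integral[OF z(1-5) f] by (simp add: F_def)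
qed

end

section \<open>A branch of the root that depends smoothly on the parameters\<close>

text \<open>The two partial derivatives are packed into one bounded linear map, which reduces the statement to
differentiation under the integral sign for a single vector-valued parameter.\<close>

lemma leibniz_rule_plane:
  fixes f fh fl :: "real \<times> real \<Rightarrow> real \<Rightarrow> complex"
  assumes U: "open U" "convex U" "x \<in> U"
    and d: "\<And>x t. x \<in> U \<Longrightarrow> t \<in> {a..b} \<Longrightarrow>
      ((\<lambda>x. f x t) has_derivative (\<lambda>v. of_real (fst v) * fh x t + of_real (snd v) * fl x t)) (at x)"
    and c: "continuous_on (U \<times> {a..b}) (\<lambda>(x, t). f x t)"
      "continuous_on (U \<times> {a..b}) (\<lambda>(x, t). fh x t)"
      "continuous_on (U \<times> {a..b}) (\<lambda>(x, t). fl x t)"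
  shows "((\<lambda>x. Re (integral {a..b} (f x))) has_derivative
    (\<lambda>v. fst v * Re (integral {a..b} (fh x)) + snd v * Re (integral {a..b} (fl x)))) (at x)"
proof -
  have slice: "continuous_on {a..b} (g x)" if "continuous_on (U \<times> {a..b}) (\<lambda>(x, t). g x t)" "x \<in> U"
    for g :: "real \<times> real \<Rightarrow> real \<Rightarrow> complex" and x
  proof -
    have "continuous_on {a..b} (\<lambda>t. (x, t))"
      by (intro continuous_on_Pair continuous_on_const continuous_on_id)
    from continuous_on_compose2[OF that(1) this] that(2) show ?thesis by auto
  qed
  define B where "B = (\<lambda>z w :: complex. (blinfun_scaleR_left z o\<^sub>L fst_blinfun) + (blinfun_scaleR_left w o\<^sub>L snd_blinfun))"
  have B: "blinfun_apply (B z w) v = of_real (fst v) * z + of_real (snd v) * w" for z w v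
    by (simp add: B_def blinfun.add_left scaleR_conv_of_real)
  have Bf: "blinfun_apply (B z w) = (\<lambda>v. of_real (fst v) * z + of_real (snd v) * w)" for z w
    by (rule ext) (rule B)
  have contB: "continuous_on T (\<lambda>p. B (u p) (w p))"
    if "continuous_on T u" "continuous_on T w" for T and u w :: "'c::topological_space \<Rightarrow> complex"
    unfolding B_def using that by (intro continuous_intros)
  have der: "((\<lambda>x. integral (cbox a b) (f x)) has_derivative blinfun_apply (integral (cbox a b) (\<lambda>t. B (fh x t) (fl x t)))) (at x within U)"
  proof (rule leibniz_rule[OF _ _ _ U(3,2)])
    fix x t assume "x \<in> U" "t \<in> cbox a b"
    thus "((\<lambda>x. f x t) has_derivative blinfun_apply (B (fh x t) (fl x t))) (at x within U)"
      unfolding Bf by (intro has_derivative_at_withinI[OF d]) auto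
  next
    fix x assume "x \<in> U"
    thus "f x integrable_on cbox a b" by (auto intro!: integrable_continuous_real slice[OF c(1)] simp del: split_paired_All)
  next
    show "continuous_on (U \<times> cbox a b) (\<lambda>(x, t). B (fh x t) (fl x t))"
      using contB[OF c(2,3)] by (simp add: case_prod_unfold)
  qed
  have "blinfun_apply (integral (cbox a b) (\<lambda>t. B (fh x t) (fl x t))) v =
      of_real (fst v) * integral {a..b} (fh x) + of_real (snd v) * integral {a..b} (fl x)" for v
  proof -
    have i: "fh x integrable_on {a..b}" "fl x integrable_on {a..b}"
      by (intro integrable_continuous_real slice[OF c(2) U(3)] slice[OF c(3) U(3)])+
    have "(\<lambda>t. B (fh x t) (fl x t)) integrable_on {a..b}"
      by (intro integrable_continuous_real contB slice[OF c(2) U(3)] slice[OF c(3) U(3)])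
    hence "blinfun_apply (integral (cbox a b) (\<lambda>t. B (fh x t) (fl x t))) v =
        integral {a..b} (\<lambda>t. of_real (fst v) * fh x t + of_real (snd v) * fl x t)"
      using integral_linear[OF _ blinfun.bounded_linear_left, of "\<lambda>t. B (fh x t) (fl x t)" "{a..b}" v]
      by (simp add: o_def B)
    thus ?thesis using i by (simp add: integral_add integrable_on_mult_right)
  qed
  hence "blinfun_apply (integral (cbox a b) (\<lambda>t. B (fh x t) (fl x t))) =
      (\<lambda>v. of_real (fst v) * integral {a..b} (fh x) + of_real (snd v) * integral {a..b} (fl x))"
    by (rule ext)
  from der[unfolded this, unfolded at_within_open[OF U(3,1)] cbox_interval]
  have "((\<lambda>x. integral {a..b} (f x)) has_derivative
      (\<lambda>v. of_real (fst v) * integral {a..b} (fh x) + of_real (snd v) * integral {a..b} (fl x))) (at x)"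
    .
  from bounded_linear.has_derivative[OF bounded_linear_Re this] show ?thesis by simp
qed

context upper_arc
begin

text \<open>The last condition keeps the quotient \<open>P_x / P_x0\<close> in the right half-plane along the arc, where the
principal root is analytic.\<close>

definition nbhd :: "(real \<times> real) set" where
  "nbhd = {x \<in> regular_values. P_poly (fst x) (snd x) a < 0 \<and> P_poly (fst x) (snd x) b < 0 \<and>
     (\<forall>t\<in>{a..b}. cmod (complex_P x (\<gamma> t) - complex_P x0 (\<gamma> t)) < cmod (complex_P x0 (\<gamma> t)))}"

lemma nbhd_D:
  assumes "x \<in> nbhd"
  shows "x \<in> regular_values" "P_poly (fst x) (snd x) a < 0" "P_poly (fst x) (snd x) b < 0"
  using assms by (auto simp: nbhd_def)

lemma P0_nonzero: "t \<in> {a..b} \<Longrightarrow> complex_P x0 (\<gamma> t) \<noteq> 0"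
  by (rule complex_P_nonzero[OF x0 Pa Pb])

lemma P_nonzero: "x \<in> nbhd \<Longrightarrow> t \<in> {a..b} \<Longrightarrow> complex_P x (\<gamma> t) \<noteq> 0"
  by (intro complex_P_nonzero nbhd_D)

lemma continuous_complex_P: "continuous_on S (\<lambda>(x, t). complex_P x (\<gamma> t))"
  unfolding complex_P_def \<gamma>_eq case_prod_unfold by (intro continuous_intros)

lemma ball_in_nbhd: obtains d where "0 < d" "ball x0 d \<subseteq> nbhd"
proof -
  have "compact ((\<lambda>t. cmod (complex_P x0 (\<gamma> t))) ` {a..b})"
    unfolding complex_P_def \<gamma>_eq by (intro compact_continuous_image continuous_intros) simp
  moreover have "(\<lambda>t. cmod (complex_P x0 (\<gamma> t))) ` {a..b} \<noteq> {}" using a b by auto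
  ultimately obtain t0 where t0: "t0 \<in> {a..b}"
      "\<And>t. t \<in> {a..b} \<Longrightarrow> cmod (complex_P x0 (\<gamma> t0)) \<le> cmod (complex_P x0 (\<gamma> t))"
    using compact_attains_inf[of "(\<lambda>t. cmod (complex_P x0 (\<gamma> t))) ` {a..b}"] by auto
  define \<mu> where "\<mu> = cmod (complex_P x0 (\<gamma> t0))"
  have \<mu>: "0 < \<mu>" using P0_nonzero[OF t0(1)] by (simp add: \<mu>_def)
  have "compact ((\<lambda>t. cmod (2 * (1 - (\<gamma> t)\<^sup>2))) ` {a..b})"
    unfolding \<gamma>_eq by (intro compact_continuous_image continuous_intros) simp
  from compact_imp_bounded[OF this] obtain M where
    "\<forall>y\<in>(\<lambda>t. cmod (2 * (1 - (\<gamma> t)\<^sup>2))) ` {a..b}. norm y \<le> M"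
    unfolding bounded_iff by blast
  hence M: "cmod (2 * (1 - (\<gamma> t)\<^sup>2)) \<le> M" if "t \<in> {a..b}" for t
    using that by (metis imageI real_norm_def norm_ge_zero abs_of_nonneg)
  have lim: "((\<lambda>x. M * \<bar>fst x - fst x0\<bar> + \<bar>(snd x0)\<^sup>2 - (snd x)\<^sup>2\<bar>) \<longlongrightarrow>
      M * \<bar>fst x0 - fst x0\<bar> + \<bar>(snd x0)\<^sup>2 - (snd x0)\<^sup>2\<bar>) (nhds x0)"
    by (intro tendsto_intros filterlim_ident)
  have "\<forall>\<^sub>F x in nhds x0. M * \<bar>fst x - fst x0\<bar> + \<bar>(snd x0)\<^sup>2 - (snd x)\<^sup>2\<bar> < \<mu>"
    using order_tendstoD(2)[OF lim] \<mu> by simp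
  moreover have "\<forall>\<^sub>F x in nhds x0. x \<in> regular_values"
    by (rule eventually_nhds_in_open[OF open_regular_values x0])
  moreover have "\<forall>\<^sub>F x in nhds x0. P_poly (fst x) (snd x) c < 0" if "P_poly (fst x0) (snd x0) c < 0" for c
    by (rule order_tendstoD(2)[OF _ that]) (unfold P_poly_def, intro tendsto_intros filterlim_ident)
  note this[OF Pa] this[OF Pb]
  ultimately have "\<forall>\<^sub>F x in nhds x0. x \<in> nbhd"
  proof eventually_elim
    case (elim x)
    have "cmod (complex_P x (\<gamma> t) - complex_P x0 (\<gamma> t)) < cmod (complex_P x0 (\<gamma> t))" if t: "t \<in> {a..b}" for t
    proof -
      have "complex_P x (\<gamma> t) - complex_P x0 (\<gamma> t) =
          2 * (1 - (\<gamma> t)\<^sup>2) * of_real (fst x - fst x0) + of_real ((snd x0)\<^sup>2 - (snd x)\<^sup>2)"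
        by (simp add: complex_P_def algebra_simps)
      hence "cmod (complex_P x (\<gamma> t) - complex_P x0 (\<gamma> t)) \<le>
          cmod (2 * (1 - (\<gamma> t)\<^sup>2)) * \<bar>fst x - fst x0\<bar> + \<bar>(snd x0)\<^sup>2 - (snd x)\<^sup>2\<bar>"
        by (metis norm_triangle_ineq norm_mult norm_of_real)
      also have "\<dots> \<le> M * \<bar>fst x - fst x0\<bar> + \<bar>(snd x0)\<^sup>2 - (snd x)\<^sup>2\<bar>"
        using M[OF t] by (intro add_right_mono mult_right_mono) auto
      also have "\<dots> < \<mu>" by (rule elim(1))
      also have "\<mu> \<le> cmod (complex_P x0 (\<gamma> t))" unfolding \<mu>_def by (rule t0(2)[OF t])
      finally show ?thesis .
    qed
    with elim show ?case by (simp add: nbhd_def)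
  qed
  then obtain d where "0 < d" "\<And>x. dist x x0 < d \<Longrightarrow> x \<in> nbhd"
    unfolding eventually_nhds_metric by blast
  hence "ball x0 d \<subseteq> nbhd" by (simp add: subset_iff dist_commute)
  with \<open>0 < d\<close> show ?thesis by (rule that)
qed

text \<open>The branch is fixed once at \<open>x0\<close>, by \<open>root_P\<close> with the roots for \<open>x0\<close>, and continued to nearby
parameters \<open>x\<close> by a factor that depends on \<open>x\<close> only through \<open>P\<close>. So it can be differentiated in
the parameters without differentiating the roots.\<close>

definition ref_roots :: "real \<times> real \<times> real" where
  "ref_roots = (SOME (z0, z1, z2). -1 < z0 \<and> z0 < 0 \<and> 0 < z1 \<and> z1 < 1 \<and> 1 < z2 \<and> a < z0 \<and> z1 < b \<and>
    (\<forall>\<zeta>. complex_P x0 \<zeta> = 2 * (\<zeta> - of_real z0) * (\<zeta> - of_real z1) * (\<zeta> - of_real z2)) \<and>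
    (\<forall>x. P_poly (fst x0) (snd x0) x = 2 * (x - z0) * (x - z1) * (x - z2)))"

definition s0 :: "complex \<Rightarrow> complex" where
  "s0 = (case ref_roots of (z0, z1, z2) \<Rightarrow> root_P z0 z1 z2)"

definition s :: "real \<times> real \<Rightarrow> real \<Rightarrow> complex" where
  "s x t = s0 (\<gamma> t) * csqrt (complex_P x (\<gamma> t) / complex_P x0 (\<gamma> t))"

lemma s0_props:
  shows "(s0 \<zeta>)\<^sup>2 = complex_P x0 \<zeta>" "continuous_on {\<zeta>. 0 \<le> Im \<zeta>} s0"
    "s0 (of_real a) = \<i> * of_real (sqrt (- P_poly (fst x0) (snd x0) a))"
proof -
  have "\<exists>r. (case r of (z0, z1, z2) \<Rightarrow> -1 < z0 \<and> z0 < 0 \<and> 0 < z1 \<and> z1 < 1 \<and> 1 < z2 \<and> a < z0 \<and> z1 < b \<and>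
    (\<forall>\<zeta>. complex_P x0 \<zeta> = 2 * (\<zeta> - of_real z0) * (\<zeta> - of_real z1) * (\<zeta> - of_real z2)) \<and>
    (\<forall>x. P_poly (fst x0) (snd x0) x = 2 * (x - z0) * (x - z1) * (x - z2)))"
    using roots_outside[of "fst x0" "snd x0"] x0 Pa Pb by simp
  hence "case ref_roots of (z0, z1, z2) \<Rightarrow> -1 < z0 \<and> z0 < 0 \<and> 0 < z1 \<and> z1 < 1 \<and> 1 < z2 \<and> a < z0 \<and> z1 < b \<and>
    (\<forall>\<zeta>. complex_P x0 \<zeta> = 2 * (\<zeta> - of_real z0) * (\<zeta> - of_real z1) * (\<zeta> - of_real z2)) \<and>
    (\<forall>x. P_poly (fst x0) (snd x0) x = 2 * (x - z0) * (x - z1) * (x - z2))"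
    unfolding ref_roots_def by (rule someI_ex)
  then obtain z0 z1 z2 where r: "ref_roots = (z0, z1, z2)"
    and z: "z0 < 0" "0 < z1" "z1 < 1" "1 < z2" "a < z0"
    "\<And>\<zeta>. complex_P x0 \<zeta> = 2 * (\<zeta> - of_real z0) * (\<zeta> - of_real z1) * (\<zeta> - of_real z2)"
    "\<And>x. P_poly (fst x0) (snd x0) x = 2 * (x - z0) * (x - z1) * (x - z2)"
    by (cases ref_roots) simp
  show "(s0 \<zeta>)\<^sup>2 = complex_P x0 \<zeta>" "continuous_on {\<zeta>. 0 \<le> Im \<zeta>} s0"
    by (simp_all add: s0_def r root_P_square z(6) continuous_on_root_P)
  show "s0 (of_real a) = \<i> * of_real (sqrt (- P_poly (fst x0) (snd x0) a))"
    using z by (simp add: s0_def r root_P_below z(7))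
qed

lemma ratio_slit:
  assumes "x \<in> nbhd" "t \<in> {a..b}"
  shows "complex_P x (\<gamma> t) / complex_P x0 (\<gamma> t) \<notin> \<real>\<^sub>\<le>\<^sub>0"
proof -
  let ?q = "complex_P x (\<gamma> t) / complex_P x0 (\<gamma> t)"
  have "?q - 1 = (complex_P x (\<gamma> t) - complex_P x0 (\<gamma> t)) / complex_P x0 (\<gamma> t)"
    using P0_nonzero[OF assms(2)] by (simp add: diff_divide_distrib)
  hence "cmod (?q - 1) < 1"
    using assms P0_nonzero[OF assms(2)] by (simp add: nbhd_def norm_divide)
  hence "\<bar>Re (?q - 1)\<bar> < 1" using abs_Re_le_cmod order_le_less_trans by blast
  moreover have "Re (?q - 1) = Re ?q - 1" by simp
  ultimately have "0 < Re ?q" by linarith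
  thus ?thesis by (auto simp: complex_nonpos_Reals_iff)
qed

lemma s_square: "t \<in> {a..b} \<Longrightarrow> (s x t)\<^sup>2 = complex_P x (\<gamma> t)"
  using P0_nonzero by (simp add: s_def power_mult_distrib s0_props)

lemma s_nonzero: "x \<in> nbhd \<Longrightarrow> t \<in> {a..b} \<Longrightarrow> s x t \<noteq> 0"
  using s_square[of t x] P_nonzero[of x t] by auto

lemma continuous_s: "continuous_on (nbhd \<times> {a..b}) (\<lambda>(x, t). s x t)"
proof -
  have "continuous_on (nbhd \<times> {a..b}) (\<lambda>p. s0 (\<gamma> (snd p)))"
    by (rule continuous_on_compose2[OF s0_props(2)])
       (auto simp: \<gamma>_in intro!: continuous_on_compose2[OF continuous_\<gamma>(1)] continuous_intros)
  moreover have "continuous_on (nbhd \<times> {a..b}) (\<lambda>p. csqrt (complex_P (fst p) (\<gamma> (snd p)) / complex_P x0 (\<gamma> (snd p))))"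
  proof (rule continuous_on_compose2[OF continuous_on_csqrt])
    show "continuous_on (nbhd \<times> {a..b}) (\<lambda>p. complex_P (fst p) (\<gamma> (snd p)) / complex_P x0 (\<gamma> (snd p)))"
    proof (rule continuous_on_divide)
      show "continuous_on (nbhd \<times> {a..b}) (\<lambda>p. complex_P (fst p) (\<gamma> (snd p)))"
        using continuous_complex_P by (simp add: case_prod_unfold)
      show "continuous_on (nbhd \<times> {a..b}) (\<lambda>p. complex_P x0 (\<gamma> (snd p)))"
        unfolding complex_P_def \<gamma>_eq by (intro continuous_intros)
    qed (use P0_nonzero in auto)
  qed (use ratio_slit in auto)
  ultimately show ?thesis unfolding s_def case_prod_unfold by (rule continuous_on_mult)
qed

lemma s_has_derivative:
  assumes "x \<in> nbhd" "t \<in> {a..b}"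
  shows "((\<lambda>x. s x t) has_derivative
    (\<lambda>v. of_real (fst v) * ((1 - (\<gamma> t)\<^sup>2) / s x t) + of_real (snd v) * (- of_real (snd x) / s x t))) (at x)"
proof -
  let ?c = "complex_P x0 (\<gamma> t)" and ?q = "\<lambda>x. complex_P x (\<gamma> t) / complex_P x0 (\<gamma> t)"
  have r: "csqrt (?q x) \<noteq> 0" using P_nonzero[OF assms] P0_nonzero[OF assms(2)] by simp
  have "((\<lambda>x. complex_P x (\<gamma> t) / ?c) has_derivative
     (\<lambda>v. (2 * (1 - (\<gamma> t)\<^sup>2) * of_real (fst v) - 2 * of_real (snd x) * of_real (snd v)) / ?c)) (at x)"
    unfolding complex_P_def
    by (rule derivative_eq_intros refl has_derivative_of_real has_derivative_fst has_derivative_snd has_derivative_ident | use P0_nonzero[OF assms(2)] in \<open>simp add: complex_P_def fun_eq_iff field_simps\<close>)+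
  from has_derivative_compose[OF this has_field_derivative_imp_has_derivative[OF has_field_derivative_csqrt[OF ratio_slit[OF assms]]]]
  have "((\<lambda>x. csqrt (?q x)) has_derivative (\<lambda>v. inverse (2 * csqrt (?q x)) *
      ((2 * (1 - (\<gamma> t)\<^sup>2) * of_real (fst v) - 2 * of_real (snd x) * of_real (snd v)) / ?c))) (at x)"
    by simp
  from has_derivative_mult_right[OF this, of "s0 (\<gamma> t)"]
  have "((\<lambda>x. s x t) has_derivative (\<lambda>v. s0 (\<gamma> t) * (inverse (2 * csqrt (?q x)) *
      ((2 * (1 - (\<gamma> t)\<^sup>2) * of_real (fst v) - 2 * of_real (snd x) * of_real (snd v)) / ?c)))) (at x)"
    by (simp add: s_def)
  moreover have "s0 (\<gamma> t) * (inverse (2 * csqrt (?q x)) *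
      ((2 * (1 - (\<gamma> t)\<^sup>2) * of_real (fst v) - 2 * of_real (snd x) * of_real (snd v)) / ?c)) =
      of_real (fst v) * ((1 - (\<gamma> t)\<^sup>2) / s x t) + of_real (snd v) * (- of_real (snd x) / s x t)" for v
  proof -
    have s00: "s0 (\<gamma> t) \<noteq> 0" using s_nonzero[OF assms] by (auto simp: s_def)
    have c: "?c = s0 (\<gamma> t) * s0 (\<gamma> t)" using s0_props(1)[of "\<gamma> t"] by (simp add: power2_eq_square)
    define w where "w = csqrt (?q x)"
    have "s x t = s0 (\<gamma> t) * w" by (simp add: s_def w_def)
    thus ?thesis using r s00 unfolding w_def[symmetric] unfolding c by (simp add: field_simps)
  qed
  ultimately show ?thesis by simp
qed

text \<open>The quotient of the two branches is continuous along the arc with values \<open>\<plusminus> 1\<close>, and it is 1 at the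
end point \<open>a\<close>, where both are \<open>\<i> \<surd>(- P)\<close>.\<close>

lemma s_eq_root_P:
  assumes x: "(h, l) \<in> nbhd"
    and z: "z0 < z1" "z1 < z2" "a < z0"
    and f: "\<And>\<zeta>. complex_P (h, l) \<zeta> = 2 * (\<zeta> - of_real z0) * (\<zeta> - of_real z1) * (\<zeta> - of_real z2)"
    and f': "\<And>x. P_poly h l x = 2 * (x - z0) * (x - z1) * (x - z2)"
    and t: "t \<in> {a..b}"
  shows "s (h, l) t = root_P z0 z1 z2 (\<gamma> t)"
proof -
  let ?q = "\<lambda>t. root_P z0 z1 z2 (\<gamma> t) / s (h, l) t"
  have "continuous_on {a..b} ?q"
  proof (rule continuous_on_divide)
    show "continuous_on {a..b} (\<lambda>t. root_P z0 z1 z2 (\<gamma> t))"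
      by (rule continuous_on_compose2[OF continuous_on_root_P continuous_\<gamma>(1)]) (auto simp: \<gamma>_in)
    show "continuous_on {a..b} (s (h, l))"
    proof -
      have "continuous_on {a..b} (\<lambda>t. ((h, l), t))"
        by (intro continuous_on_Pair continuous_on_const continuous_on_id)
      from continuous_on_compose2[OF continuous_s this] x show ?thesis by auto
    qed
  qed (use s_nonzero[OF x] in auto)
  moreover have "?q t \<in> {1, -1}" if "t \<in> {a..b}" for t
  proof -
    have "(?q t)\<^sup>2 = 1"
      using that P_nonzero[OF x that] by (simp add: power_divide root_P_square s_square f)
    thus ?thesis by (auto simp: power2_eq_1_iff)
  qed
  hence "?q ` {a..b} \<subseteq> {1, -1}" by (rule image_subsetI)
  hence "finite (?q ` {a..b})" by (rule finite_subset) simp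
  ultimately have "?q constant_on {a..b}" by (rule continuous_finite_range_constant[OF connected_Icc])
  hence "?q t = ?q a" using t a b unfolding constant_on_def by (metis atLeastAtMost_iff less_imp_le less_trans order_refl)
  also have "?q a = 1"
  proof -
    have P: "P_poly h l a < 0" using nbhd_D(2)[OF x] by simp
    have 1: "root_P z0 z1 z2 (\<gamma> a) = \<i> * of_real (sqrt (- P_poly h l a))"
      unfolding \<gamma>_endpoints f' using z by (intro root_P_below) auto
    have "complex_P (h, l) (\<gamma> a) / complex_P x0 (\<gamma> a) =
        of_real ((- P_poly h l a) / (- P_poly (fst x0) (snd x0) a))"
      unfolding \<gamma>_endpoints complex_P_of_real by simp
    hence "csqrt (complex_P (h, l) (\<gamma> a) / complex_P x0 (\<gamma> a)) =
        of_real (sqrt ((- P_poly h l a) / (- P_poly (fst x0) (snd x0) a)))"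
      using csqrt_of_real_nonneg[of "(- P_poly h l a) / (- P_poly (fst x0) (snd x0) a)"] P Pa
      by (simp add: divide_nonpos_nonpos)
    hence "s (h, l) a = \<i> * of_real (sqrt (- P_poly (fst x0) (snd x0) a) * sqrt ((- P_poly h l a) / (- P_poly (fst x0) (snd x0) a)))"
      by (simp add: s_def \<gamma>_endpoints s0_props)
    also have "sqrt (- P_poly (fst x0) (snd x0) a) * sqrt ((- P_poly h l a) / (- P_poly (fst x0) (snd x0) a))
       = sqrt (- P_poly h l a)"
      using Pa P by (subst real_sqrt_mult[symmetric]) simp
    finally show ?thesis using 1 P by simp
  qed
  finally show ?thesis using s_nonzero[OF x t] by simp
qed

end

section \<open>Differential equations for the action\<close>

lemma has_derivative_fst_snd_unique:
  fixes f :: "real \<times> real \<Rightarrow> real"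
  assumes "(f has_derivative (\<lambda>v. fst v * p + snd v * q)) (at x)"
  shows "partial1 f x = p" "partial2 f x = q"
proof -
  obtain u w where x: "x = (u, w)" by (cases x)
  note d = assms[unfolded x]
  have "((\<lambda>t. f (t, w)) has_derivative (\<lambda>t. fst (t, 0) * p + snd (t, 0) * q)) (at u)"
    by (rule has_derivative_eq_rhs[OF has_derivative_compose
          [OF has_derivative_Pair[OF has_derivative_ident has_derivative_const] d]]) simp
  hence "((\<lambda>t. f (t, w)) has_real_derivative p) (at u)"
    by (rule has_derivative_imp_has_field_derivative) simp
  thus "partial1 f x = p" by (simp add: partial1_def x DERIV_imp_deriv)
  have "((\<lambda>t. f (u, t)) has_derivative (\<lambda>t. fst (0, t) * p + snd (0, t) * q)) (at w)"
    by (rule has_derivative_eq_rhs[OF has_derivative_compose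
          [OF has_derivative_Pair[OF has_derivative_const has_derivative_ident] d]]) simp
  hence "((\<lambda>t. f (u, t)) has_real_derivative q) (at w)"
    by (rule has_derivative_imp_has_field_derivative) simp
  thus "partial2 f x = q" by (simp add: partial2_def x DERIV_imp_deriv)
qed

definition action_fun :: "real \<times> real \<Rightarrow> real" where
  "action_fun = (\<lambda>(h, l). action1 h l)"

context upper_arc
begin

text \<open>The integrand of the action along the arc, followed by its derivatives of first and second order in
the parameters \<open>(h, l)\<close>. They all follow from \<open>s^2 = P\<close>, that is from \<open>s_h = (1 - \<zeta>^2) / s\<close> and
\<open>s_l = - l / s\<close>.\<close>

definition integrand :: "real \<times> real \<Rightarrow> real \<Rightarrow> complex" where
  "integrand x t = \<gamma>' t * s x t / (1 - (\<gamma> t)\<^sup>2)"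

definition integrand_h :: "real \<times> real \<Rightarrow> real \<Rightarrow> complex" where
  "integrand_h x t = \<gamma>' t / s x t"

definition integrand_l :: "real \<times> real \<Rightarrow> real \<Rightarrow> complex" where
  "integrand_l x t = - \<gamma>' t * of_real (snd x) / ((1 - (\<gamma> t)\<^sup>2) * s x t)"

definition integrand_hh :: "real \<times> real \<Rightarrow> real \<Rightarrow> complex" where
  "integrand_hh x t = - \<gamma>' t * (1 - (\<gamma> t)\<^sup>2) / s x t ^ 3"

definition integrand_hl :: "real \<times> real \<Rightarrow> real \<Rightarrow> complex" where
  "integrand_hl x t = \<gamma>' t * of_real (snd x) / s x t ^ 3"

definition integrand_ll :: "real \<times> real \<Rightarrow> real \<Rightarrow> complex" where
  "integrand_ll x t = - \<gamma>' t / ((1 - (\<gamma> t)\<^sup>2) * s x t) - \<gamma>' t * (of_real (snd x))\<^sup>2 / ((1 - (\<gamma> t)\<^sup>2) * s x t ^ 3)"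

lemma integrand_has_derivative:
  assumes x: "x \<in> nbhd" and t: "t \<in> {a..b}"
  shows "((\<lambda>x. integrand x t) has_derivative (\<lambda>v. of_real (fst v) * integrand_h x t + of_real (snd v) * integrand_l x t)) (at x)"
    and "((\<lambda>x. integrand_h x t) has_derivative (\<lambda>v. of_real (fst v) * integrand_hh x t + of_real (snd v) * integrand_hl x t)) (at x)"
    and "((\<lambda>x. integrand_l x t) has_derivative (\<lambda>v. of_real (fst v) * integrand_hl x t + of_real (snd v) * integrand_ll x t)) (at x)"
proof -
  define q where "q = 1 - (\<gamma> t)\<^sup>2"
  have q: "q \<noteq> 0" unfolding q_def by (rule \<gamma>_pole_free[OF t])
  have s: "s x t \<noteq> 0" by (rule s_nonzero[OF x t])
  note ds = s_has_derivative[OF x t, folded q_def]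
  note di = Deriv.has_derivative_inverse[OF s ds]
  have e: "integrand = (\<lambda>x t. \<gamma>' t / (1 - (\<gamma> t)\<^sup>2) * s x t)" "integrand_h = (\<lambda>x t. \<gamma>' t * inverse (s x t))"
    "integrand_l = (\<lambda>x t. - \<gamma>' t / (1 - (\<gamma> t)\<^sup>2) * (of_real (snd x) * inverse (s x t)))"
    by (auto simp: integrand_def integrand_h_def integrand_l_def fun_eq_iff field_simps)
  show "((\<lambda>x. integrand x t) has_derivative (\<lambda>v. of_real (fst v) * integrand_h x t + of_real (snd v) * integrand_l x t)) (at x)"
    unfolding e(1) q_def[symmetric]
    by (rule has_derivative_eq_rhs[OF has_derivative_mult_right[OF ds]])
       (use q s in \<open>auto simp: integrand_h_def integrand_l_def q_def[symmetric] fun_eq_iff field_simps\<close>)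
  show "((\<lambda>x. integrand_h x t) has_derivative (\<lambda>v. of_real (fst v) * integrand_hh x t + of_real (snd v) * integrand_hl x t)) (at x)"
    unfolding e(2)
    by (rule has_derivative_eq_rhs[OF has_derivative_mult_right[OF di]])
       (use s in \<open>auto simp: integrand_hh_def integrand_hl_def q_def[symmetric] fun_eq_iff field_simps power3_eq_cube\<close>)
  have dl: "((\<lambda>x. complex_of_real (snd x)) has_derivative (\<lambda>v. of_real (snd v))) (at x)"
    by (intro has_derivative_of_real has_derivative_snd has_derivative_ident)
  show "((\<lambda>x. integrand_l x t) has_derivative (\<lambda>v. of_real (fst v) * integrand_hl x t + of_real (snd v) * integrand_ll x t)) (at x)"
    unfolding e(3) q_def[symmetric]
    by (rule has_derivative_eq_rhs[OF has_derivative_mult_right[OF has_derivative_mult[OF dl di]]])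
       (unfold integrand_hl_def integrand_ll_def q_def[symmetric],
        use q s in \<open>auto simp: fun_eq_iff field_simps power2_eq_square power3_eq_cube\<close>)
qed

lemma continuous_integrand:
  "continuous_on (nbhd \<times> {a..b}) (\<lambda>(x, t). integrand x t)" "continuous_on (nbhd \<times> {a..b}) (\<lambda>(x, t). integrand_h x t)"
  "continuous_on (nbhd \<times> {a..b}) (\<lambda>(x, t). integrand_l x t)" "continuous_on (nbhd \<times> {a..b}) (\<lambda>(x, t). integrand_hh x t)"
  "continuous_on (nbhd \<times> {a..b}) (\<lambda>(x, t). integrand_hl x t)" "continuous_on (nbhd \<times> {a..b}) (\<lambda>(x, t). integrand_ll x t)"
proof -
  have c: "continuous_on (nbhd \<times> {a..b}) (\<lambda>p. s (fst p) (snd p))"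
    using continuous_s by (simp add: case_prod_unfold)
  have g: "continuous_on (nbhd \<times> {a..b}) (\<lambda>p. \<gamma> (snd p))" "continuous_on (nbhd \<times> {a..b}) (\<lambda>p. \<gamma>' (snd p))"
    by (auto intro!: continuous_on_compose2[OF continuous_\<gamma>(1)] continuous_on_compose2[OF continuous_\<gamma>(2)] continuous_intros)
  have n: "s (fst p) (snd p) \<noteq> 0" "1 - (\<gamma> (snd p))\<^sup>2 \<noteq> 0" if "p \<in> nbhd \<times> {a..b}" for p
    using s_nonzero \<gamma>_pole_free that by auto
  note defs = integrand_def integrand_h_def integrand_l_def integrand_hh_def integrand_hl_def integrand_ll_def case_prod_unfold
  show "continuous_on (nbhd \<times> {a..b}) (\<lambda>(x, t). integrand x t)" "continuous_on (nbhd \<times> {a..b}) (\<lambda>(x, t). integrand_h x t)"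
    "continuous_on (nbhd \<times> {a..b}) (\<lambda>(x, t). integrand_l x t)" "continuous_on (nbhd \<times> {a..b}) (\<lambda>(x, t). integrand_hh x t)"
    "continuous_on (nbhd \<times> {a..b}) (\<lambda>(x, t). integrand_hl x t)" "continuous_on (nbhd \<times> {a..b}) (\<lambda>(x, t). integrand_ll x t)"
    unfolding defs by (intro continuous_intros c g; use n in simp)+
qed

definition period :: "(real \<times> real \<Rightarrow> real \<Rightarrow> complex) \<Rightarrow> real \<times> real \<Rightarrow> real" where
  "period f x = 1 / pi * Re (integral {a..b} (f x))"

lemma action_eq_period:
  assumes x: "x \<in> nbhd"
  shows "action_fun x = period integrand x"
proof -
  obtain h l where hl: "x = (h, l)" by (cases x)
  obtain z0 z1 z2 where z: "-1 < z0" "z0 < 0" "0 < z1" "z1 < 1" "1 < z2" "a < z0" "z1 < b"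
    and f: "\<And>\<zeta>. complex_P (h, l) \<zeta> = 2 * (\<zeta> - of_real z0) * (\<zeta> - of_real z1) * (\<zeta> - of_real z2)"
    and f': "\<And>x. P_poly h l x = 2 * (x - z0) * (x - z1) * (x - z2)"
    using roots_outside[of h l] nbhd_D[OF x] unfolding hl fst_conv snd_conv by blast
  have "action1 h l = 1 / pi * Re (integral {a..b} (\<lambda>t. \<gamma>' t * root_P z0 z1 z2 (\<gamma> t) / (1 - (\<gamma> t)\<^sup>2)))"
    using nbhd_D[OF x] by (intro action1_eq_arc_integral z f') (auto simp: hl)
  also have "integral {a..b} (\<lambda>t. \<gamma>' t * root_P z0 z1 z2 (\<gamma> t) / (1 - (\<gamma> t)\<^sup>2)) = integral {a..b} (integrand (h, l))"
    by (rule integral_cong) (use s_eq_root_P[OF x[unfolded hl] _ _ _ f f'] z in \<open>auto simp: integrand_def\<close>)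
  finally show ?thesis by (simp add: action_fun_def period_def hl)
qed

lemma period_has_derivative:
  assumes U: "open U" "convex U" "U \<subseteq> nbhd" "x \<in> U"
    and d: "\<And>x t. x \<in> nbhd \<Longrightarrow> t \<in> {a..b} \<Longrightarrow>
      ((\<lambda>x. f x t) has_derivative (\<lambda>v. of_real (fst v) * fh x t + of_real (snd v) * fl x t)) (at x)"
    and c: "continuous_on (nbhd \<times> {a..b}) (\<lambda>(x, t). f x t)"
      "continuous_on (nbhd \<times> {a..b}) (\<lambda>(x, t). fh x t)"
      "continuous_on (nbhd \<times> {a..b}) (\<lambda>(x, t). fl x t)"
  shows "(period f has_derivative (\<lambda>v. fst v * period fh x + snd v * period fl x)) (at x)"
proof -
  have sub: "U \<times> {a..b} \<subseteq> nbhd \<times> {a..b}" using U by auto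
  have "((\<lambda>x. Re (integral {a..b} (f x))) has_derivative
    (\<lambda>v. fst v * Re (integral {a..b} (fh x)) + snd v * Re (integral {a..b} (fl x)))) (at x)"
    by (rule leibniz_rule_plane[OF U(1,2,4)]) (use U d continuous_on_subset[OF _ sub] c in auto)
  from has_derivative_mult_right[OF this, of "1 / pi"] show ?thesis
    by (simp add: period_def[abs_def] algebra_simps add_divide_distrib)
qed

text \<open>At the ends of the arc \<open>s^2 = P\<close> is real and negative.\<close>

lemma s_real_part_endpoint:
  assumes x: "x \<in> nbhd" and t: "t = a \<or> t = b"
  shows "Re (s x t) = 0"
proof -
  have "t \<in> {a..b}" using t a b by auto
  hence "(s x t)\<^sup>2 = of_real (P_poly (fst x) (snd x) t)"
    using s_square t \<gamma>_endpoints complex_P_of_real by metis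
  moreover have "P_poly (fst x) (snd x) t < 0" using nbhd_D[OF x] t by auto
  ultimately have "Re (s x t) * Im (s x t) = 0" "(Re (s x t))\<^sup>2 < (Im (s x t))\<^sup>2"
    by (auto simp: complex_eq_iff power2_eq_square)
  thus ?thesis by auto
qed

lemma s_deriv:
  assumes x: "x \<in> nbhd" and t: "t \<in> {a<..<b}"
  shows "(s x has_vector_derivative
    \<gamma>' t * (- 2 * \<gamma> t * (of_real (fst x) + 1 - \<gamma> t) - (1 - (\<gamma> t)\<^sup>2)) / s x t) (at t)"
proof -
  obtain h l where hl: "x = (h, l)" by (cases x)
  obtain z0 z1 z2 where z: "-1 < z0" "z0 < 0" "0 < z1" "z1 < 1" "1 < z2" "a < z0" "z1 < b"
    and f: "\<And>\<zeta>. complex_P (h, l) \<zeta> = 2 * (\<zeta> - of_real z0) * (\<zeta> - of_real z1) * (\<zeta> - of_real z2)"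
    and f': "\<And>x. P_poly h l x = 2 * (x - z0) * (x - z1) * (x - z2)"
    using roots_outside[of h l] nbhd_D[OF x] unfolding hl fst_conv snd_conv by blast
  let ?R = "root_P z0 z1 z2"
  have seq: "s x t = ?R (\<gamma> t)" if "t \<in> {a..b}" for t
    unfolding hl by (rule s_eq_root_P[OF x[unfolded hl] _ _ _ f f' that]) (use z in auto)
  obtain D where D: "(?R has_field_derivative D) (at (\<gamma> t))"
    using root_P_field_differentiable[of "\<gamma> t"] \<gamma>_in(2)[OF t] unfolding field_differentiable_def by blast
  have "((\<lambda>\<zeta>. (?R \<zeta>)\<^sup>2) has_field_derivative 2 * (?R (\<gamma> t) * D)) (at (\<gamma> t))"
    by (rule derivative_eq_intros D refl | simp)+
  moreover have "(\<lambda>\<zeta>. (?R \<zeta>)\<^sup>2) = complex_P x" by (auto simp: root_P_square f hl)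
  moreover have "(complex_P x has_field_derivative
      2 * (- 2 * \<gamma> t * (of_real (fst x) + 1 - \<gamma> t) - (1 - (\<gamma> t)\<^sup>2))) (at (\<gamma> t))"
    unfolding complex_P_def by (rule derivative_eq_intros refl | simp add: algebra_simps)+
  ultimately have "2 * (?R (\<gamma> t) * D) = 2 * (- 2 * \<gamma> t * (of_real (fst x) + 1 - \<gamma> t) - (1 - (\<gamma> t)\<^sup>2))"
    using DERIV_unique unfolding mult.assoc by metis
  hence "?R (\<gamma> t) * D = - 2 * \<gamma> t * (of_real (fst x) + 1 - \<gamma> t) - (1 - (\<gamma> t)\<^sup>2)"
    by (rule mult_left_cancel[THEN iffD1, rotated]) simp
  moreover have "?R (\<gamma> t) = s x t" "s x t \<noteq> 0" using seq[of t] s_nonzero[OF x, of t] t by auto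
  ultimately have D': "D = (- 2 * \<gamma> t * (of_real (fst x) + 1 - \<gamma> t) - (1 - (\<gamma> t)\<^sup>2)) / s x t"
    by (simp add: eq_divide_eq mult.commute)
  have "((?R \<circ> \<gamma>) has_vector_derivative \<gamma>' t * D) (at t)"
    by (rule field_vector_diff_chain_at[OF \<gamma>_deriv D])
  hence "(s x has_vector_derivative \<gamma>' t * D) (at t)"
    by (rule has_vector_derivative_transform_within_open[where S = "{a<..<b}"]) (use t seq in auto)
  thus ?thesis by (simp add: D')
qed

lemma integrand_integrable:
  fixes f :: "real \<times> real \<Rightarrow> real \<Rightarrow> complex"
  assumes "x \<in> nbhd" "continuous_on (nbhd \<times> {a..b}) (\<lambda>(x, t). f x t)"
  shows "f x integrable_on {a..b}"
proof -
  have "continuous_on {a..b} (\<lambda>t. (x, t))"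
    by (intro continuous_on_Pair continuous_on_const continuous_on_id)
  hence "continuous_on {a..b} (\<lambda>t. case (x, t) of (x, t) \<Rightarrow> f x t)"
    by (rule continuous_on_compose2[OF assms(2)]) (use assms(1) in auto)
  thus ?thesis by (simp add: integrable_continuous_real)
qed

text \<open>An integrand that is the derivative of \<open>c / s\<close> along the arc: its integral consists of boundary terms,
which are imaginary.\<close>

lemma boundary_integral:
  assumes x: "x \<in> nbhd"
    and c: "continuous_on {a..b} c" "c a \<in> \<real>" "c b \<in> \<real>"
      "\<And>t. t \<in> {a<..<b} \<Longrightarrow> (c has_vector_derivative c' t) (at t)"
    and f: "f integrable_on {a..b}" "\<And>t. t \<in> {a<..<b} \<Longrightarrow> f t = c' t / s x t -
      c t * (\<gamma>' t * (- 2 * \<gamma> t * (of_real (fst x) + 1 - \<gamma> t) - (1 - (\<gamma> t)\<^sup>2))) / s x t ^ 3"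
  shows "Re (integral {a..b} f) = 0"
proof -
  have cs: "continuous_on {a..b} (s x)"
  proof -
    have "continuous_on {a..b} (\<lambda>t. (x, t))"
      by (intro continuous_on_Pair continuous_on_const continuous_on_id)
    from continuous_on_compose2[OF continuous_s this] x show ?thesis by auto
  qed
  have "(f has_integral c b / s x b - c a / s x a) {a..b}"
  proof (rule fundamental_theorem_of_calculus_interior)
    show "a \<le> b" using a b by simp
    show "continuous_on {a..b} (\<lambda>t. c t / s x t)"
      using s_nonzero[OF x] by (intro continuous_on_divide c cs) auto
  next
    fix t assume t: "t \<in> {a<..<b}"
    hence sn: "s x t \<noteq> 0" using s_nonzero[OF x, of t] by simp
    have i: "((\<lambda>t. inverse (s x t)) has_vector_derivative
        (\<gamma>' t * (- 2 * \<gamma> t * (of_real (fst x) + 1 - \<gamma> t) - (1 - (\<gamma> t)\<^sup>2)) / s x t) * (- (inverse (s x t) ^ 2))) (at t)"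
    proof -
      have "(inverse has_field_derivative - (inverse (s x t) ^ Suc (Suc 0))) (at (s x t))"
        by (rule DERIV_inverse[OF sn])
      from field_vector_diff_chain_at[OF s_deriv[OF x t] this] show ?thesis
        by (simp add: o_def power2_eq_square)
    qed
    have "((\<lambda>t. c t * inverse (s x t)) has_vector_derivative
       (c t * ((\<gamma>' t * (- 2 * \<gamma> t * (of_real (fst x) + 1 - \<gamma> t) - (1 - (\<gamma> t)\<^sup>2)) / s x t) * (- (inverse (s x t) ^ 2)))
         + c' t * inverse (s x t))) (at t)"
      by (rule has_vector_derivative_mult[OF c(4)[OF t] i])
    moreover have "c t * ((\<gamma>' t * (- 2 * \<gamma> t * (of_real (fst x) + 1 - \<gamma> t) - (1 - (\<gamma> t)\<^sup>2)) / s x t) * (- (inverse (s x t) ^ 2)))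
         + c' t * inverse (s x t) = f t"
      unfolding f(2)[OF t] using sn by (simp add: power2_eq_square power3_eq_cube divide_inverse mult_ac)
    ultimately show "((\<lambda>t. c t / s x t) has_vector_derivative f t) (at t)"
      by (simp add: divide_inverse)
  qed
  hence "integral {a..b} f = c b / s x b - c a / s x a" by (rule integral_unique)
  moreover have "Re (c t / s x t) = 0" if "t = a \<or> t = b" for t
    using s_real_part_endpoint[OF x that] c(2,3) that by (auto elim!: Reals_cases simp: Re_divide)
  ultimately show ?thesis by simp
qed

text \<open>The identity \<open>P + l^2 = 2 (1 - \<zeta>^2) (1 + h - \<zeta>)\<close> cancels the poles at \<open>\<plusminus> 1\<close>: the action and its
derivative in \<open>l\<close> are integrals of the third kind, but their second derivatives are not.\<close>

lemma integrand_ll_eq: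
  assumes x: "x \<in> nbhd" and t: "t \<in> {a..b}"
  shows "integrand_ll x t = - \<gamma>' t * (2 * (of_real (fst x) + 1 - \<gamma> t)) / s x t ^ 3"
proof -
  define S q where "S = s x t" and "q = 1 - (\<gamma> t)\<^sup>2"
  have S: "S \<noteq> 0" using s_nonzero[OF x t] by (simp add: S_def)
  have q: "q \<noteq> 0" using \<gamma>_pole_free[OF t] by (simp add: q_def)
  have S2: "S * S = 2 * q * (of_real (fst x) + 1 - \<gamma> t) - of_real (snd x) * of_real (snd x)"
    using s_square[OF t, of x] by (simp add: S_def q_def complex_P_def power2_eq_square)
  have "integrand_ll x t = - \<gamma>' t * (S * S + of_real (snd x) * of_real (snd x)) / (q * S ^ 3)"
    unfolding integrand_ll_def S_def[symmetric] q_def[symmetric]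
    using S q by (simp add: field_simps power2_eq_square power3_eq_cube)
  also have "\<dots> = - \<gamma>' t * (2 * (of_real (fst x) + 1 - \<gamma> t)) / S ^ 3"
    unfolding S2 using S q by (simp add: field_simps)
  finally show ?thesis by (simp only: S_def)
qed

text \<open>With \<open>P + l^2 = 2 (1 - \<zeta>^2) (1 + h - \<zeta>)\<close> all second derivatives of the integrand become polynomials
in \<open>\<zeta>\<close> over \<open>s^3\<close>. The two combinations are the derivatives of \<open>- l / s\<close> and \<open>- 2 \<zeta> / s\<close>.\<close>

lemma period_PDE:
  assumes x: "(h, l) \<in> nbhd"
  shows "3 * l * period integrand_hh (h, l) - (1 + h) * l * period integrand_ll (h, l) - 2 * h * (2 + h) * period integrand_hl (h, l) = 0"
    and "period integrand_h (h, l) + 2 * period integrand_ll (h, l) + 2 * (1 + h) * period integrand_hh (h, l) + 3 * l * period integrand_hl (h, l) = 0"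
proof -
  let ?x = "(h, l)" and ?h = "complex_of_real h" and ?l = "complex_of_real l"
  define f where "f = (\<lambda>t. 3 * ?l * integrand_hh ?x t - (1 + ?h) * ?l * integrand_ll ?x t - 2 * ?h * (2 + ?h) * integrand_hl ?x t)"
  define g where "g = (\<lambda>t. integrand_h ?x t + 2 * integrand_ll ?x t + 2 * (1 + ?h) * integrand_hh ?x t + 3 * ?l * integrand_hl ?x t)"
  note int = integrand_integrable[OF x continuous_integrand(2)] integrand_integrable[OF x continuous_integrand(4)]
    integrand_integrable[OF x continuous_integrand(5)] integrand_integrable[OF x continuous_integrand(6)]
  have key: "s ?x t * s ?x t = 2 * (1 - (\<gamma> t)\<^sup>2) * (of_real h + 1 - \<gamma> t) - (of_real l)\<^sup>2"
    if "t \<in> {a<..<b}" for t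
    using s_square[of t ?x] that by (simp add: complex_P_def power2_eq_square)
  have hf: "(f has_integral (3 * ?l * integral {a..b} (integrand_hh ?x) - (1 + ?h) * ?l * integral {a..b} (integrand_ll ?x)
      - 2 * ?h * (2 + ?h) * integral {a..b} (integrand_hl ?x))) {a..b}"
    unfolding f_def by (intro has_integral_add has_integral_diff has_integral_mult_right integrable_integral int)
  have "Re (integral {a..b} f) = 0"
  proof (rule boundary_integral[OF x, where c = "\<lambda>_. - of_real l" and c' = "\<lambda>_. 0"])
    fix t assume t: "t \<in> {a<..<b}"
    define S q G L E where "S = s ?x t" and "q = 1 - (\<gamma> t)\<^sup>2" and "G = \<gamma> t" and "L = complex_of_real l"
      and "E = complex_of_real h"
    have S: "S \<noteq> 0" using s_nonzero[OF x, of t] t by (simp add: S_def)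
    have qG: "q = 1 - G * G" by (simp add: q_def G_def power2_eq_square)
    have integrand_ll: "integrand_ll ?x t = - \<gamma>' t * (2 * (E + 1 - G)) / S ^ 3"
      using integrand_ll_eq[OF x, of t] t by (simp add: S_def E_def G_def)
    have "f t = \<gamma>' t * L * (- 3 * q + (1 + E) * (2 * (E + 1 - G)) - 2 * E * (2 + E)) / S ^ 3"
      unfolding f_def integrand_ll unfolding integrand_hh_def integrand_hl_def S_def[symmetric] q_def[symmetric] snd_conv
      using S by (simp add: L_def E_def field_simps)
    also have "\<dots> = L * (\<gamma>' t * (- 2 * G * (E + 1 - G) - q)) / S ^ 3"
      unfolding qG by (simp add: algebra_simps)
    also have "\<dots> = 0 / S - (- L) * (\<gamma>' t * (- 2 * G * (E + 1 - G) - q)) / S ^ 3"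
      by simp
    finally show "f t = 0 / s ?x t - (- of_real l) * (\<gamma>' t * (- 2 * \<gamma> t * (of_real (fst ?x) + 1 - \<gamma> t) - (1 - (\<gamma> t)\<^sup>2))) / s ?x t ^ 3"
      by (simp only: S_def q_def G_def L_def E_def fst_conv)
  qed (use hf in \<open>auto simp: integrable_on_def\<close>)
  hence "3 * l * Re (integral {a..b} (integrand_hh ?x)) - (1 + h) * l * Re (integral {a..b} (integrand_ll ?x))
      - 2 * h * (2 + h) * Re (integral {a..b} (integrand_hl ?x)) = 0"
    unfolding integral_unique[OF hf] by simp
  hence "1 / pi * (3 * l * Re (integral {a..b} (integrand_hh ?x)) - (1 + h) * l * Re (integral {a..b} (integrand_ll ?x))
      - 2 * h * (2 + h) * Re (integral {a..b} (integrand_hl ?x))) = 0" by simp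
  thus "3 * l * period integrand_hh ?x - (1 + h) * l * period integrand_ll ?x - 2 * h * (2 + h) * period integrand_hl ?x = 0"
    unfolding period_def by (simp only: algebra_simps)
  have hg: "(g has_integral (integral {a..b} (integrand_h ?x) + 2 * integral {a..b} (integrand_ll ?x)
      + 2 * (1 + ?h) * integral {a..b} (integrand_hh ?x) + 3 * ?l * integral {a..b} (integrand_hl ?x))) {a..b}"
    unfolding g_def by (intro has_integral_add has_integral_diff has_integral_mult_right integrable_integral int)
  have "Re (integral {a..b} g) = 0"
  proof (rule boundary_integral[OF x, where c = "\<lambda>t. - 2 * \<gamma> t" and c' = "\<lambda>t. - 2 * \<gamma>' t"])
    fix t assume t: "t \<in> {a<..<b}"
    show "((\<lambda>t. - 2 * \<gamma> t) has_vector_derivative - 2 * \<gamma>' t) (at t)"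
      by (intro has_vector_derivative_mult_right \<gamma>_deriv)
    define S q G L E where "S = s ?x t" and "q = 1 - (\<gamma> t)\<^sup>2" and "G = \<gamma> t" and "L = complex_of_real l"
      and "E = complex_of_real h"
    have S: "S \<noteq> 0" using s_nonzero[OF x, of t] t by (simp add: S_def)
    have S2: "S * S = 2 * q * (E + 1 - G) - L * L" using key[OF t] by (simp add: S_def q_def G_def L_def E_def power2_eq_square)
    have qG: "q = 1 - G * G" by (simp add: q_def G_def power2_eq_square)
    have integrand_ll: "integrand_ll ?x t = - \<gamma>' t * (2 * (E + 1 - G)) / S ^ 3"
      using integrand_ll_eq[OF x, of t] t by (simp add: S_def E_def G_def)
    have "g t = \<gamma>' t * (S * S - 4 * (E + 1 - G) - 2 * (1 + E) * q + 3 * L * L) / S ^ 3"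
      unfolding g_def integrand_ll unfolding integrand_h_def integrand_hh_def integrand_hl_def S_def[symmetric] q_def[symmetric] snd_conv
      using S by (simp add: L_def E_def field_simps power3_eq_cube)
    also have "\<dots> = \<gamma>' t * (- 2 * (S * S) + 2 * G * (- 2 * G * (E + 1 - G) - q)) / S ^ 3"
      unfolding S2 qG by (simp add: algebra_simps)
    also have "\<dots> = (- 2 * \<gamma>' t) / S - (- 2 * G) * (\<gamma>' t * (- 2 * G * (E + 1 - G) - q)) / S ^ 3"
      using S by (simp add: field_simps power3_eq_cube)
    finally show "g t = (- 2 * \<gamma>' t) / s ?x t - (- 2 * \<gamma> t) * (\<gamma>' t * (- 2 * \<gamma> t * (of_real (fst ?x) + 1 - \<gamma> t) - (1 - (\<gamma> t)\<^sup>2))) / s ?x t ^ 3"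
      by (simp only: S_def q_def G_def L_def E_def fst_conv)
  qed (use hg in \<open>auto simp: integrable_on_def \<gamma>_endpoints intro!: continuous_intros continuous_\<gamma>\<close>)
  hence "Re (integral {a..b} (integrand_h ?x)) + 2 * Re (integral {a..b} (integrand_ll ?x))
      + 2 * (1 + h) * Re (integral {a..b} (integrand_hh ?x)) + 3 * l * Re (integral {a..b} (integrand_hl ?x)) = 0"
    unfolding integral_unique[OF hg] by simp
  hence "1 / pi * (Re (integral {a..b} (integrand_h ?x)) + 2 * Re (integral {a..b} (integrand_ll ?x))
      + 2 * (1 + h) * Re (integral {a..b} (integrand_hh ?x)) + 3 * l * Re (integral {a..b} (integrand_hl ?x))) = 0" by simp
  thus "period integrand_h ?x + 2 * period integrand_ll ?x + 2 * (1 + h) * period integrand_hh ?x + 3 * l * period integrand_hl ?x = 0"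
    unfolding period_def by (simp only: algebra_simps)
qed

end

text \<open>Near \<open>\<plusminus> 1\<close> the factor \<open>1 - \<zeta>^2\<close> is small and \<open>P\<close> is close to \<open>- l^2\<close>; the distance
\<open>l^2 / 20\<close> suffices because the other factors of \<open>P\<close> are bounded.\<close>

lemma upper_arc_exists:
  assumes "x \<in> regular_values"
  obtains a b where "upper_arc a b x"
proof -
  obtain h l where x: "x = (h, l)" by (cases x)
  have hl: "\<bar>h\<bar> < 1/2" "l \<noteq> 0" "\<bar>l\<bar> < 1/2" using assms by (auto simp: regular_values_def x)
  define y where "y = l\<^sup>2 / 20"
  have "l\<^sup>2 < 1" using hl by (simp add: abs_square_less_1)
  hence y: "0 < y" "y < 1/20" "20 * y = l\<^sup>2" using hl by (auto simp: y_def)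
  have bound: "2 * y * (2 - y) * c < l\<^sup>2" if "c \<le> 5/2" for c
  proof (cases "c \<le> 0")
    case True
    hence "2 * y * (2 - y) * c \<le> 0" using y by (intro mult_nonneg_nonpos) auto
    thus ?thesis using y by linarith
  next
    case False
    have "2 * y * (2 - y) * c \<le> 2 * y * 2 * (5/2)" using y that False by (intro mult_mono) auto
    thus ?thesis using y by linarith
  qed
  have "P_poly h l (-1 + y) = 2 * y * (2 - y) * (h + 2 - y) - l\<^sup>2"
    by (simp add: P_poly_def power2_eq_square algebra_simps)
  moreover have "P_poly h l (1 - y) = 2 * y * (2 - y) * (h + y) - l\<^sup>2"
    by (simp add: P_poly_def power2_eq_square algebra_simps)
  moreover have "2 * y * (2 - y) * (h + 2 - y) < l\<^sup>2" "2 * y * (2 - y) * (h + y) < l\<^sup>2"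
    using hl(1) y by (auto intro!: bound)
  ultimately have "upper_arc (-1 + y) (1 - y) x"
    using y assms by unfold_locales (auto simp: x)
  thus ?thesis by (rule that)
qed

lemma action_fun_twice_differentiable:
  assumes x: "x \<in> regular_values"
  shows "(action_fun has_derivative (\<lambda>v. fst v * partial1 action_fun x + snd v * partial2 action_fun x)) (at x)" (is ?A)
    and "(partial1 action_fun has_derivative
      (\<lambda>v. fst v * partial1 (partial1 action_fun) x + snd v * partial1 (partial2 action_fun) x)) (at x)" (is ?B)
    and "(partial2 action_fun has_derivative
      (\<lambda>v. fst v * partial1 (partial2 action_fun) x + snd v * partial2 (partial2 action_fun) x)) (at x)" (is ?C)
    and "3 * snd x * partial1 (partial1 action_fun) x - (1 + fst x) * snd x * partial2 (partial2 action_fun) x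
      - 2 * fst x * (2 + fst x) * partial1 (partial2 action_fun) x = 0" (is ?D)
    and "partial1 action_fun x + 2 * partial2 (partial2 action_fun) x
      + 2 * (1 + fst x) * partial1 (partial1 action_fun) x + 3 * snd x * partial1 (partial2 action_fun) x = 0" (is ?E)
proof -
  obtain a b where "upper_arc a b x" using upper_arc_exists[OF x] .
  then interpret upper_arc a b x .
  obtain d where d: "0 < d" "ball x d \<subseteq> nbhd" by (rule ball_in_nbhd)
  have xb: "x \<in> ball x d" using d by simp
  note per = period_has_derivative[OF open_ball convex_ball d(2)]
  have 1: "(action_fun has_derivative (\<lambda>v. fst v * period integrand_h y + snd v * period integrand_l y)) (at y)"
    if y: "y \<in> ball x d" for y
  proof (rule has_derivative_transform_within_open[OF _ open_ball y])
    show "(period integrand has_derivative (\<lambda>v. fst v * period integrand_h y + snd v * period integrand_l y)) (at y)"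
      by (rule per[OF y integrand_has_derivative(1) continuous_integrand(1-3)])
  qed (use action_eq_period d in auto)
  note p = has_derivative_fst_snd_unique[OF 1]
  have 2: "(partial1 action_fun has_derivative (\<lambda>v. fst v * period integrand_hh x + snd v * period integrand_hl x)) (at x)"
  proof (rule has_derivative_transform_within_open[OF _ open_ball xb])
    show "(period integrand_h has_derivative (\<lambda>v. fst v * period integrand_hh x + snd v * period integrand_hl x)) (at x)"
      by (rule per[OF xb integrand_has_derivative(2) continuous_integrand(2,4,5)])
  qed (use p in auto)
  have 3: "(partial2 action_fun has_derivative (\<lambda>v. fst v * period integrand_hl x + snd v * period integrand_ll x)) (at x)"
  proof (rule has_derivative_transform_within_open[OF _ open_ball xb])
    show "(period integrand_l has_derivative (\<lambda>v. fst v * period integrand_hl x + snd v * period integrand_ll x)) (at x)"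
      by (rule per[OF xb integrand_has_derivative(3) continuous_integrand(3,5,6)])
  qed (use p in auto)
  note p' = p[OF xb] has_derivative_fst_snd_unique[OF 2] has_derivative_fst_snd_unique[OF 3]
  show ?A using 1[OF xb] by (simp only: p')
  show ?B using 2 by (simp only: p')
  show ?C using 3 by (simp only: p')
  have nbhd: "(fst x, snd x) \<in> nbhd" using d xb by auto
  show ?D using period_PDE(1)[OF nbhd] by (simp only: p' prod.collapse)
  show ?E using period_PDE(2)[OF nbhd] by (simp only: p' prod.collapse)
qed

section \<open>The action in Eliasson coordinates\<close>

lemma ln_cmod_Complex: "ln (cmod (Complex x y)) = ln (x\<^sup>2 + y\<^sup>2) / 2"
proof (cases "x\<^sup>2 + y\<^sup>2 = 0")
  case False
  hence "0 < x\<^sup>2 + y\<^sup>2" by (metis less_le sum_power2_ge_zero)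
  thus ?thesis by (simp add: cmod_def ln_sqrt)
qed (simp add: cmod_def)

lemma Arg_Complex:
  assumes "y \<noteq> 0"
  shows "Arg (Complex x y) = sgn y * pi / 2 - arctan (x / y)"
proof (rule cis_Arg_unique)
  let ?a = "arctan (x / y)"
  have bnd: "- (pi / 2) < ?a" "?a < pi / 2" using arctan_lbound arctan_ubound by auto
  have s: "sgn y = 1 \<or> sgn y = -1" using assms by (auto simp: sgn_if)
  thus "- pi < sgn y * pi / 2 - ?a" "sgn y * pi / 2 - ?a \<le> pi" using bnd by auto
  have c: "cos (sgn y * pi / 2 - ?a) = sgn y * sin ?a" "sin (sgn y * pi / 2 - ?a) = sgn y * cos ?a"
    using s by (auto simp: cos_diff sin_diff)
  have pos: "0 < sqrt (x\<^sup>2 + y\<^sup>2)" using assms by (simp add: add_nonneg_pos)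
  have "1 + (x / y)\<^sup>2 = (x\<^sup>2 + y\<^sup>2) / y\<^sup>2" using assms by (simp add: field_simps)
  hence q: "sqrt (1 + (x / y)\<^sup>2) = sqrt (x\<^sup>2 + y\<^sup>2) / \<bar>y\<bar>" by (simp add: real_sqrt_divide)
  have y: "sgn y * \<bar>y\<bar> = y" "sgn y * x * \<bar>y\<bar> / y = x" using assms by (auto simp: sgn_if)
  have "sgn y * sin ?a = x / sqrt (x\<^sup>2 + y\<^sup>2)" "sgn y * cos ?a = y / sqrt (x\<^sup>2 + y\<^sup>2)"
    unfolding sin_arctan cos_arctan q using y assms by (auto simp: field_simps)
  thus "sgn (Complex x y) = cis (sgn y * pi / 2 - ?a)"
    unfolding sgn_eq cmod_def complex.sel by (simp only: complex_eq_iff cis.sel c Re_divide_of_real Im_divide_of_real complex.sel)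
qed

lemma has_real_derivative_compose_plane:
  fixes f :: "real \<times> real \<Rightarrow> real"
  assumes "(f has_derivative (\<lambda>v. fst v * p + snd v * q)) (at (u x, w x))"
    and "(u has_real_derivative u') (at x)" "(w has_real_derivative w') (at x)"
  shows "((\<lambda>t. f (u t, w t)) has_real_derivative (u' * p + w' * q)) (at x)"
proof -
  have "((\<lambda>t. (u t, w t)) has_derivative (\<lambda>h. (u' * h, w' * h))) (at x)"
    by (intro has_derivative_Pair assms(2,3)[THEN has_field_derivative_imp_has_derivative])
  from has_derivative_compose[OF this assms(1)]
  have "((\<lambda>t. f (u t, w t)) has_derivative (\<lambda>h. fst (u' * h, w' * h) * p + snd (u' * h, w' * h) * q)) (at x)"
    by simp
  thus ?thesis by (rule has_derivative_imp_has_field_derivative) (simp add: algebra_simps)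
qed

text \<open>The part of \<open>2 \<pi> I_1\<close> that is not a power series in \<open>(j1, j2)\<close>, together with the elementary terms that
accompany it in the definition of \<open>S\<close>.\<close>

definition singular_part :: "real \<times> real \<Rightarrow> real" where
  "singular_part = (\<lambda>(x, y). 8 - 2 * pi * \<bar>y\<bar> + y * Arg (Complex x y) - x * ln (cmod (Complex x y)) + x)"

lemma DERIV_arctan_quotient:
  fixes x y :: real
  assumes "y \<noteq> 0"
  shows "((\<lambda>t. arctan (t / y)) has_real_derivative y / (x\<^sup>2 + y\<^sup>2)) (at x)"
    and "((\<lambda>t. arctan (x / t)) has_real_derivative - (x / (x\<^sup>2 + y\<^sup>2))) (at y)"
proof -
  have q: "1 + (x / y)\<^sup>2 = (x\<^sup>2 + y\<^sup>2) / y\<^sup>2" using assms by (simp add: field_simps)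
  have N: "x\<^sup>2 + y\<^sup>2 \<noteq> 0" using assms by (simp add: sum_power2_eq_zero_iff)
  have "((\<lambda>t. t / y) has_real_derivative 1 / y) (at x)"
    by (rule DERIV_cdivide[OF DERIV_ident])
  from DERIV_chain2[OF DERIV_arctan this]
  have "((\<lambda>t. arctan (t / y)) has_real_derivative inverse (1 + (x / y)\<^sup>2) * (1 / y)) (at x)" .
  moreover have "inverse (1 + (x / y)\<^sup>2) * (1 / y) = y / (x\<^sup>2 + y\<^sup>2)"
    unfolding q using assms N by (simp add: power2_eq_square)
  ultimately show "((\<lambda>t. arctan (t / y)) has_real_derivative y / (x\<^sup>2 + y\<^sup>2)) (at x)" by simp
  have "((\<lambda>t. x / t) has_real_derivative - (x / y\<^sup>2)) (at y)"
    using DERIV_cmult[OF DERIV_inverse[OF assms], of x] by (simp add: divide_inverse power2_eq_square)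
  from DERIV_chain2[OF DERIV_arctan this]
  have "((\<lambda>t. arctan (x / t)) has_real_derivative inverse (1 + (x / y)\<^sup>2) * - (x / y\<^sup>2)) (at y)" .
  moreover have "inverse (1 + (x / y)\<^sup>2) * - (x / y\<^sup>2) = - (x / (x\<^sup>2 + y\<^sup>2))"
    unfolding q using assms N by simp
  ultimately show "((\<lambda>t. arctan (x / t)) has_real_derivative - (x / (x\<^sup>2 + y\<^sup>2))) (at y)" by simp
qed

lemma DERIV_ln_sum_squares:
  fixes x y :: real
  assumes "y \<noteq> 0"
  shows "((\<lambda>t. ln (t\<^sup>2 + y\<^sup>2) / 2) has_real_derivative x / (x\<^sup>2 + y\<^sup>2)) (at x)"
    and "((\<lambda>t. ln (x\<^sup>2 + t\<^sup>2) / 2) has_real_derivative y / (x\<^sup>2 + y\<^sup>2)) (at y)"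
proof -
  have N: "0 < x\<^sup>2 + y\<^sup>2" using assms by (simp add: add_nonneg_pos)
  have e: "1 / n * (2 * u) / 2 = u / n" for n u :: real by simp
  have "((\<lambda>t. t\<^sup>2 + y\<^sup>2) has_real_derivative 2 * x) (at x)"
    by (auto intro!: derivative_eq_intros)
  from DERIV_cdivide[OF DERIV_chain2[OF DERIV_ln_divide[OF N] this], of 2, unfolded e]
  show "((\<lambda>t. ln (t\<^sup>2 + y\<^sup>2) / 2) has_real_derivative x / (x\<^sup>2 + y\<^sup>2)) (at x)" .
  have "((\<lambda>t. x\<^sup>2 + t\<^sup>2) has_real_derivative 2 * y) (at y)"
    by (auto intro!: derivative_eq_intros)
  from DERIV_cdivide[OF DERIV_chain2[OF DERIV_ln_divide[OF N] this], of 2, unfolded e]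
  show "((\<lambda>t. ln (x\<^sup>2 + t\<^sup>2) / 2) has_real_derivative y / (x\<^sup>2 + y\<^sup>2)) (at y)" .
qed

text \<open>The rational terms \<open>y (Arg j)_x - x (ln |j|)_x\<close> add up to \<open>-1\<close> and are cancelled by the derivative of
the last term \<open>x\<close>; the corresponding terms of the derivative in \<open>y\<close> cancel each other.\<close>

lemma singular_part_derivatives:
  assumes "y \<noteq> 0"
  shows "((\<lambda>t. singular_part (t, y)) has_real_derivative - (ln (x\<^sup>2 + y\<^sup>2) / 2)) (at x)"
    and "((\<lambda>t. singular_part (x, t)) has_real_derivative (- 2 * pi * sgn y + Arg (Complex x y))) (at y)"
proof -
  have N: "x\<^sup>2 + y\<^sup>2 \<noteq> 0" using assms by (simp add: sum_power2_eq_zero_iff)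
  have "((\<lambda>t. 8 - 2 * pi * \<bar>y\<bar> + y * (sgn y * pi / 2 - arctan (t / y)) - t * (ln (t\<^sup>2 + y\<^sup>2) / 2) + t) has_real_derivative
      (0 + y * (0 - y / (x\<^sup>2 + y\<^sup>2)) - (1 * (ln (x\<^sup>2 + y\<^sup>2) / 2) + x / (x\<^sup>2 + y\<^sup>2) * x) + 1)) (at x)"
    by (intro DERIV_add DERIV_diff DERIV_mult DERIV_cmult DERIV_const DERIV_ident
        DERIV_arctan_quotient DERIV_ln_sum_squares assms)
  moreover have "y * (0 - y / (x\<^sup>2 + y\<^sup>2)) - x / (x\<^sup>2 + y\<^sup>2) * x = -1"
    using N by (simp add: divide_simps) (simp add: power2_eq_square)
  hence "0 + y * (0 - y / (x\<^sup>2 + y\<^sup>2)) - (1 * (ln (x\<^sup>2 + y\<^sup>2) / 2) + x / (x\<^sup>2 + y\<^sup>2) * x) + 1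
      = - (ln (x\<^sup>2 + y\<^sup>2) / 2)"
    by linarith
  ultimately show "((\<lambda>t. singular_part (t, y)) has_real_derivative - (ln (x\<^sup>2 + y\<^sup>2) / 2)) (at x)"
    using assms by (simp only: singular_part_def prod.case ln_cmod_Complex Arg_Complex not_False_eq_True)
  \<comment> \<open>the side of the axis on which \<open>y\<close> lies, where \<open>sgn\<close> is constant\<close>
  define U where "U = (if y > 0 then {0<..} else {..<0::real})"
  have U: "open U" "y \<in> U" using assms by (auto simp: U_def)
  have Uy: "t \<noteq> 0" "sgn t = sgn y" "\<bar>t\<bar> = sgn y * t" if "t \<in> U" for t
    using that assms by (auto simp: U_def sgn_if split: if_splits)
  have d: "((\<lambda>t. 8 - 2 * pi * (sgn y * t) + t * (sgn y * pi / 2 - arctan (x / t)) - x * (ln (x\<^sup>2 + t\<^sup>2) / 2) + x) has_real_derivative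
      (0 - 2 * pi * (sgn y * 1) + (1 * (sgn y * pi / 2 - arctan (x / y)) + (0 - - (x / (x\<^sup>2 + y\<^sup>2))) * y)
        - x * (y / (x\<^sup>2 + y\<^sup>2)) + 0)) (at y)"
    by (intro DERIV_add DERIV_diff DERIV_mult DERIV_cmult DERIV_const DERIV_ident
        DERIV_arctan_quotient DERIV_ln_sum_squares assms)
  have e: "0 - 2 * pi * (sgn y * 1) + (1 * (sgn y * pi / 2 - arctan (x / y)) + (0 - - (x / (x\<^sup>2 + y\<^sup>2))) * y)
        - x * (y / (x\<^sup>2 + y\<^sup>2)) + 0 = - 2 * pi * sgn y + Arg (Complex x y)"
    unfolding Arg_Complex[OF assms] by simp
  show "((\<lambda>t. singular_part (x, t)) has_real_derivative (- 2 * pi * sgn y + Arg (Complex x y))) (at y)"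
    by (rule has_field_derivative_transform_within_open[OF d[unfolded e] U])
       (simp add: singular_part_def ln_cmod_Complex Arg_Complex Uy)
qed

lemma singular_part_second_derivatives:
  assumes "0 < y"
  shows "((\<lambda>t. - (ln (t\<^sup>2 + y\<^sup>2) / 2)) has_real_derivative - (x / (x\<^sup>2 + y\<^sup>2))) (at x)"
    and "((\<lambda>t. - (ln (x\<^sup>2 + t\<^sup>2) / 2)) has_real_derivative - (y / (x\<^sup>2 + y\<^sup>2))) (at y)"
    and "((\<lambda>t. - 2 * pi * sgn t + Arg (Complex x t)) has_real_derivative x / (x\<^sup>2 + y\<^sup>2)) (at y)"
proof -
  have y: "y \<noteq> 0" using assms by simp
  show "((\<lambda>t. - (ln (t\<^sup>2 + y\<^sup>2) / 2)) has_real_derivative - (x / (x\<^sup>2 + y\<^sup>2))) (at x)"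
    "((\<lambda>t. - (ln (x\<^sup>2 + t\<^sup>2) / 2)) has_real_derivative - (y / (x\<^sup>2 + y\<^sup>2))) (at y)"
    by (intro DERIV_minus DERIV_ln_sum_squares y)+
  have "((\<lambda>t. - 2 * pi + (pi / 2 - arctan (x / t))) has_real_derivative 0 + (0 - - (x / (x\<^sup>2 + y\<^sup>2)))) (at y)"
    by (intro DERIV_add DERIV_diff DERIV_const DERIV_arctan_quotient y)
  hence d: "((\<lambda>t. - 2 * pi + (pi / 2 - arctan (x / t))) has_real_derivative x / (x\<^sup>2 + y\<^sup>2)) (at y)" by simp
  show "((\<lambda>t. - 2 * pi * sgn t + Arg (Complex x t)) has_real_derivative x / (x\<^sup>2 + y\<^sup>2)) (at y)"
    by (rule has_field_derivative_transform_within_open[OF d, of "{0<..}"])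
       (use assms in \<open>auto simp: Arg_Complex\<close>)
qed

text \<open>The series of \<open>H\<close> and \<open>S\<close> are required to converge up to \<open>4 r\<close> because each of two
differentiations halves the size of the square.\<close>

locale near_equilibrium =
  fixes H S :: "real \<times> real \<Rightarrow> real" and FH FS :: "real fps fps" and r :: real
  assumes expands_H4: "expands (4 * r) FH H" and expands_S4: "expands (4 * r) FS S"
    and r_small: "r < 1/2"
    and H_small: "\<And>x y. \<bar>x\<bar> \<le> r \<Longrightarrow> \<bar>y\<bar> \<le> r \<Longrightarrow> \<bar>H (x, y)\<bar> < 1/2"
    and H1_nonzero: "\<And>x y. \<bar>x\<bar> \<le> r \<Longrightarrow> \<bar>y\<bar> \<le> r \<Longrightarrow> partial1 H (x, y) \<noteq> 0"
    and action_formula: "\<And>x y. \<bar>x\<bar> \<le> r \<Longrightarrow> \<bar>y\<bar> \<le> r \<Longrightarrow>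
        2 * pi * action1 (H (x, y)) y = singular_part (x, y) + S (x, y)"
begin

lemma r: "0 < r"
  using expands_pos[OF expands_H4] by simp

abbreviation "H1 \<equiv> partial1 H"
abbreviation "H2 \<equiv> partial2 H"
abbreviation "H11 \<equiv> partial1 (partial1 H)"
abbreviation "H12 \<equiv> partial2 (partial1 H)"
abbreviation "H22 \<equiv> partial2 (partial2 H)"
abbreviation "S1 \<equiv> partial1 S"
abbreviation "S2 \<equiv> partial2 S"
abbreviation "S11 \<equiv> partial1 (partial1 S)"
abbreviation "S12 \<equiv> partial2 (partial1 S)"
abbreviation "S22 \<equiv> partial2 (partial2 S)"

lemma expands_first:
  "expands (2 * r) (fps_D1 FH) H1" "expands (2 * r) (fps_D2 FH) H2"
  "expands (2 * r) (fps_D1 FS) S1" "expands (2 * r) (fps_D2 FS) S2"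
  using expands_partial1[OF expands_H4] expands_partial2[OF expands_H4] expands_partial1[OF expands_S4] expands_partial2[OF expands_S4]
  by simp_all

lemma expands_all:
  "expands r FH H" "expands r FS S"
  "expands r (fps_D1 FH) H1" "expands r (fps_D2 FH) H2" "expands r (fps_D1 FS) S1" "expands r (fps_D2 FS) S2"
  "expands r (fps_D1 (fps_D1 FH)) H11" "expands r (fps_D2 (fps_D1 FH)) H12" "expands r (fps_D2 (fps_D2 FH)) H22"
  "expands r (fps_D1 (fps_D1 FS)) S11" "expands r (fps_D2 (fps_D1 FS)) S12" "expands r (fps_D2 (fps_D2 FS)) S22"
  using expands_partial1[OF expands_first(1)] expands_partial2[OF expands_first(1)] expands_partial2[OF expands_first(2)]
    expands_partial1[OF expands_first(3)] expands_partial2[OF expands_first(3)] expands_partial2[OF expands_first(4)]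
    expands_first[THEN expands_mono, of r] r expands_mono[OF expands_H4, of r] expands_mono[OF expands_S4, of r]
  by simp_all

lemma regular: "\<bar>x\<bar> \<le> r \<Longrightarrow> \<bar>y\<bar> \<le> r \<Longrightarrow> y \<noteq> 0 \<Longrightarrow> (H (x, y), y) \<in> regular_values"
  using H_small[of x y] r_small by (auto simp: regular_values_def)

text \<open>The chain rule for \<open>I(H(x, y), y)\<close>, compared with the definition of \<open>S\<close>.\<close>

lemma first_order:
  assumes xy: "\<bar>x\<bar> < r" "\<bar>y\<bar> < r" "y \<noteq> 0"
  shows "H1 (x, y) * (2 * pi * partial1 action_fun (H (x, y), y)) = - (ln (x\<^sup>2 + y\<^sup>2) / 2) + S1 (x, y)"
    and "2 * pi * partial2 action_fun (H (x, y), y) + H2 (x, y) * (2 * pi * partial1 action_fun (H (x, y), y)) =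
      - 2 * pi * sgn y + Arg (Complex x y) + S2 (x, y)"
proof -
  note A = action_fun_twice_differentiable(1)[OF regular[of x y]]
  have bnd: "\<bar>x\<bar> < 4 * r" "\<bar>y\<bar> < 4 * r" "\<bar>x\<bar> \<le> 4 * r" "\<bar>y\<bar> \<le> 4 * r" using xy by auto
  have "((\<lambda>t. action_fun (H (t, y), y)) has_real_derivative
      (H1 (x, y) * partial1 action_fun (H (x, y), y) + 0 * partial2 action_fun (H (x, y), y))) (at x)"
    by (rule has_real_derivative_compose_plane[OF A expands_has_partial1[OF expands_H4 bnd(1,4)] DERIV_const])
       (use xy in auto)
  from DERIV_cmult[OF this, of "2 * pi"]
  have "((\<lambda>t. 2 * pi * action_fun (H (t, y), y)) has_real_derivative
      H1 (x, y) * (2 * pi * partial1 action_fun (H (x, y), y))) (at x)" by (simp add: mult_ac)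
  moreover have "((\<lambda>t. 2 * pi * action_fun (H (t, y), y)) has_real_derivative - (ln (x\<^sup>2 + y\<^sup>2) / 2) + S1 (x, y)) (at x)"
  proof (rule has_field_derivative_transform_within_open)
    show "((\<lambda>t. singular_part (t, y) + S (t, y)) has_real_derivative - (ln (x\<^sup>2 + y\<^sup>2) / 2) + S1 (x, y)) (at x)"
      by (intro DERIV_add singular_part_derivatives xy expands_has_partial1[OF expands_S4 bnd(1,4)])
    show "x \<in> {-r<..<r}" using xy by auto
  qed (use action_formula xy in \<open>auto simp: action_fun_def\<close>)
  ultimately show "H1 (x, y) * (2 * pi * partial1 action_fun (H (x, y), y)) = - (ln (x\<^sup>2 + y\<^sup>2) / 2) + S1 (x, y)"
    by (rule DERIV_unique)
  have "((\<lambda>t. action_fun (H (x, t), t)) has_real_derivative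
      (H2 (x, y) * partial1 action_fun (H (x, y), y) + 1 * partial2 action_fun (H (x, y), y))) (at y)"
    by (rule has_real_derivative_compose_plane[OF A expands_has_partial2[OF expands_H4 bnd(3,2)] DERIV_ident])
       (use xy in auto)
  from DERIV_cmult[OF this, of "2 * pi"]
  have "((\<lambda>t. 2 * pi * action_fun (H (x, t), t)) has_real_derivative
      2 * pi * partial2 action_fun (H (x, y), y) + H2 (x, y) * (2 * pi * partial1 action_fun (H (x, y), y))) (at y)"
    by (simp add: algebra_simps)
  moreover have "((\<lambda>t. 2 * pi * action_fun (H (x, t), t)) has_real_derivative
      - 2 * pi * sgn y + Arg (Complex x y) + S2 (x, y)) (at y)"
  proof (rule has_field_derivative_transform_within_open)
    show "((\<lambda>t. singular_part (x, t) + S (x, t)) has_real_derivative - 2 * pi * sgn y + Arg (Complex x y) + S2 (x, y)) (at y)"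
      by (intro DERIV_add singular_part_derivatives xy expands_has_partial2[OF expands_S4 bnd(3,2)])
    show "y \<in> {-r<..<r}" using xy by auto
  qed (use action_formula xy in \<open>auto simp: action_fun_def\<close>)
  ultimately show "2 * pi * partial2 action_fun (H (x, y), y) + H2 (x, y) * (2 * pi * partial1 action_fun (H (x, y), y)) =
      - 2 * pi * sgn y + Arg (Complex x y) + S2 (x, y)"
    by (rule DERIV_unique)
qed

end

section \<open>The logarithmic terms\<close>

text \<open>Let \<open>J(h, l)\<close> be the solution \<open>j1\<close> of \<open>H(j1, l) = h\<close>. Implicit differentiation gives
\<open>H_1^3 J_hh = - H_11\<close>, and the next two expressions are \<open>- H_1^3 J_ll\<close> and \<open>H_1^3 J_hl\<close>.\<close>

definition inverse_ll :: "'a::comm_ring_1 \<Rightarrow> 'a \<Rightarrow> 'a \<Rightarrow> 'a \<Rightarrow> 'a \<Rightarrow> 'a" where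
  "inverse_ll h1 h2 h11 h12 h22 = h22 * h1\<^sup>2 - 2 * h2 * h12 * h1 + h2\<^sup>2 * h11"

definition inverse_hl :: "'a::comm_ring_1 \<Rightarrow> 'a \<Rightarrow> 'a \<Rightarrow> 'a \<Rightarrow> 'a" where
  "inverse_hl h1 h2 h11 h12 = h2 * h11 - h12 * h1"

text \<open>The two differential equations of the action, for \<open>J\<close> in place of \<open>I\<close>, multiplied by \<open>H_1^3\<close>; \<open>y\<close>
stands for \<open>l = j2\<close>. They are stated for commutative rings because they are needed both for functions
and for formal power series.\<close>

definition inverse_pde1 :: "'a::comm_ring_1 \<Rightarrow> 'a \<Rightarrow> 'a \<Rightarrow> 'a \<Rightarrow> 'a \<Rightarrow> 'a \<Rightarrow> 'a \<Rightarrow> 'a" where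
  "inverse_pde1 y h h1 h2 h11 h12 h22 = (1 + h) * y * inverse_ll h1 h2 h11 h12 h22 - 3 * y * h11
     - 2 * h * (2 + h) * inverse_hl h1 h2 h11 h12"

definition inverse_pde2 :: "'a::comm_ring_1 \<Rightarrow> 'a \<Rightarrow> 'a \<Rightarrow> 'a \<Rightarrow> 'a \<Rightarrow> 'a \<Rightarrow> 'a \<Rightarrow> 'a" where
  "inverse_pde2 y h h1 h2 h11 h12 h22 = h1\<^sup>2 - 2 * inverse_ll h1 h2 h11 h12 h22 - 2 * (1 + h) * h11
     + 3 * y * inverse_hl h1 h2 h11 h12"

text \<open>For \<open>N = |j|^2\<close> these are \<open>2 \<pi> N H_1^3 I_hh\<close>, \<open>2 \<pi> N H_1^3 I_hl\<close> and \<open>2 \<pi> N H_1^3 I_ll\<close> without their terms in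
\<open>ln |j|\<close>. The factor \<open>N H_1^3\<close> makes them polynomials in the derivatives of \<open>H\<close> and \<open>S\<close>.\<close>

definition rest_hh :: "real \<Rightarrow> real \<Rightarrow> real \<Rightarrow> real \<Rightarrow> real \<Rightarrow> real \<Rightarrow> real" where
  "rest_hh x N h1 h11 s1 s11 = h1 * (N * s11 - x) - N * h11 * s1"

definition rest_hl :: "real \<Rightarrow> real \<Rightarrow> real \<Rightarrow> real \<Rightarrow> real \<Rightarrow> real \<Rightarrow> real \<Rightarrow> real \<Rightarrow> real" where
  "rest_hl y N h1 h2 h12 s1 s12 bh = h1\<^sup>2 * (N * s12 - y) - N * h1 * h12 * s1 - h2 * bh"

definition rest_ll :: "real \<Rightarrow> real \<Rightarrow> real \<Rightarrow> real \<Rightarrow> real \<Rightarrow> real \<Rightarrow> real \<Rightarrow> real \<Rightarrow> real \<Rightarrow> real" where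
  "rest_ll x N h1 h2 h22 s1 s22 bh bl = h1 ^ 3 * (N * s22 + x) - N * h1\<^sup>2 * h22 * s1 - h2\<^sup>2 * bh - 2 * h2 * bl"

text \<open>Here \<open>L = ln |j|\<close>, and \<open>T, Thh, Thl, Tll\<close> are \<open>2 \<pi>\<close> times \<open>I_h, I_hh, I_hl, I_ll\<close>. The equations
\<open>e0\<close> to \<open>e3\<close> are linear in these; solving them and inserting the result into the differential equations
\<open>p1\<close> and \<open>p2\<close> isolates the coefficient of \<open>L\<close>.\<close>

lemma log_elimination:
  fixes x y N L h h1 h2 h11 h12 h22 s1 s11 s12 s22 T Thh Thl Tll :: real
  assumes N: "N \<noteq> 0"
    and e0: "h1 * T = - L + s1"
    and e1: "h11 * T + h1 * (h1 * Thh) = - (x / N) + s11"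
    and e2: "h12 * T + h1 * (h2 * Thh + Thl) = - (y / N) + s12"
    and e3: "(h2 * Thl + Tll) + (h22 * T + h2 * (h2 * Thh + Thl)) = x / N + s22"
    and p1: "3 * y * Thh - (1 + h) * y * Tll - 2 * h * (2 + h) * Thl = 0"
    and p2: "T + 2 * Tll + 2 * (1 + h) * Thh + 3 * y * Thl = 0"
  defines "bh \<equiv> rest_hh x N h1 h11 s1 s11"
  defines "bl \<equiv> rest_hl y N h1 h2 h12 s1 s12 bh"
  defines "bv \<equiv> rest_ll x N h1 h2 h22 s1 s22 bh bl"
  shows "N * inverse_pde1 y h h1 h2 h11 h12 h22 * L =
      3 * y * bh - (1 + h) * y * bv - 2 * h * (2 + h) * bl" (is ?A)
    and "N * inverse_pde2 y h h1 h2 h11 h12 h22 * L =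
      N * h1\<^sup>2 * s1 + 2 * bv + 2 * (1 + h) * bh + 3 * y * bl" (is ?B)
proof -
  have L: "L = s1 - h1 * T" using e0 by simp
  define a b where "a = x / N" and "b = y / N"
  have x: "x = N * a" and y: "y = N * b" using N by (simp_all add: a_def b_def)
  have s11: "s11 = h11 * T + h1 * (h1 * Thh) + a" and s12: "s12 = h12 * T + h1 * (h2 * Thh + Thl) + b"
    and s22: "s22 = (h2 * Thl + Tll) + (h22 * T + h2 * (h2 * Thh + Thl)) - a"
    using e1 e2 e3 by (simp_all add: a_def b_def)
  have bh: "bh = N * (h1 ^ 3 * Thh - h11 * L)"
    unfolding bh_def rest_hh_def s11 x L by algebra
  have bl: "bl = N * (h1 ^ 3 * Thl + inverse_hl h1 h2 h11 h12 * L)"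
    unfolding bl_def rest_hl_def bh s12 inverse_hl_def L y by algebra
  have bv: "bv = N * (h1 ^ 3 * Tll - inverse_ll h1 h2 h11 h12 h22 * L)"
    unfolding bv_def rest_ll_def bh bl s22 inverse_ll_def inverse_hl_def L x by algebra
  have "3 * y * bh - (1 + h) * y * bv - 2 * h * (2 + h) * bl =
      N * h1 ^ 3 * (3 * y * Thh - (1 + h) * y * Tll - 2 * h * (2 + h) * Thl) + N * inverse_pde1 y h h1 h2 h11 h12 h22 * L"
    unfolding bh bl bv inverse_pde1_def by algebra
  thus ?A unfolding p1 by simp
  have "N * h1\<^sup>2 * s1 + 2 * bv + 2 * (1 + h) * bh + 3 * y * bl =
      N * h1 ^ 3 * (T + 2 * Tll + 2 * (1 + h) * Thh + 3 * y * Thl) + N * inverse_pde2 y h h1 h2 h11 h12 h22 * L"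
    unfolding bh bl bv inverse_pde2_def L by algebra
  thus ?B unfolding p2 by simp
qed

context near_equilibrium
begin

text \<open>The derivatives of the two equations of \<open>first_order\<close>. It is enough to have them in the half-plane
\<open>y > 0\<close>, where \<open>sgn\<close> is constant, because this determines the power series that occur.\<close>

lemma second_order:
  assumes xy: "\<bar>x\<bar> < r" "0 < y" "y < r"
  defines "z \<equiv> (H (x, y), y)"
  shows "H11 (x, y) * (2 * pi * partial1 action_fun z) +
      H1 (x, y) * (H1 (x, y) * (2 * pi * partial1 (partial1 action_fun) z)) = - (x / (x\<^sup>2 + y\<^sup>2)) + S11 (x, y)"
    and "H12 (x, y) * (2 * pi * partial1 action_fun z) +
      H1 (x, y) * (H2 (x, y) * (2 * pi * partial1 (partial1 action_fun) z) + 2 * pi * partial1 (partial2 action_fun) z)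
      = - (y / (x\<^sup>2 + y\<^sup>2)) + S12 (x, y)"
    and "(H2 (x, y) * (2 * pi * partial1 (partial2 action_fun) z) + 2 * pi * partial2 (partial2 action_fun) z) +
      (H22 (x, y) * (2 * pi * partial1 action_fun z) +
       H2 (x, y) * (H2 (x, y) * (2 * pi * partial1 (partial1 action_fun) z) + 2 * pi * partial1 (partial2 action_fun) z))
      = x / (x\<^sup>2 + y\<^sup>2) + S22 (x, y)"
proof -
  have y0: "y \<noteq> 0" and ay: "\<bar>y\<bar> < r" using xy by auto
  have bnd: "\<bar>x\<bar> < 4 * r" "\<bar>y\<bar> < 4 * r" "\<bar>x\<bar> \<le> 4 * r" "\<bar>y\<bar> \<le> 4 * r"
    "\<bar>x\<bar> < 2 * r" "\<bar>y\<bar> < 2 * r" "\<bar>x\<bar> \<le> 2 * r" "\<bar>y\<bar> \<le> 2 * r" using xy by auto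
  have reg: "(H (x, y), y) \<in> regular_values" using regular[of x y] xy by simp
  note A = action_fun_twice_differentiable(2,3)[OF reg]
  note HX = expands_has_partial1[OF expands_H4 bnd(1,4)]
  note HY = expands_has_partial2[OF expands_H4 bnd(3,2)]
  have Tx: "((\<lambda>t. 2 * pi * partial1 action_fun (H (t, y), y)) has_real_derivative
      H1 (x, y) * (2 * pi * partial1 (partial1 action_fun) z)) (at x)"
    using DERIV_cmult[OF has_real_derivative_compose_plane[OF A(1) HX DERIV_const], of "2 * pi"]
    by (simp add: z_def mult_ac)
  have Ty: "((\<lambda>t. 2 * pi * partial1 action_fun (H (x, t), t)) has_real_derivative
      H2 (x, y) * (2 * pi * partial1 (partial1 action_fun) z) + 2 * pi * partial1 (partial2 action_fun) z) (at y)"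
    using DERIV_cmult[OF has_real_derivative_compose_plane[OF A(1) HY DERIV_ident], of "2 * pi"]
    by (simp add: z_def algebra_simps)
  have Vy: "((\<lambda>t. 2 * pi * partial2 action_fun (H (x, t), t)) has_real_derivative
      H2 (x, y) * (2 * pi * partial1 (partial2 action_fun) z) + 2 * pi * partial2 (partial2 action_fun) z) (at y)"
    using DERIV_cmult[OF has_real_derivative_compose_plane[OF A(2) HY DERIV_ident], of "2 * pi"]
    by (simp add: z_def algebra_simps)
  have "((\<lambda>t. H1 (t, y) * (2 * pi * partial1 action_fun (H (t, y), y))) has_real_derivative
      (H11 (x, y) * (2 * pi * partial1 action_fun (H (x, y), y)) +
       H1 (x, y) * (2 * pi * partial1 (partial1 action_fun) z) * H1 (x, y))) (at x)"
    by (rule DERIV_mult[OF expands_has_partial1[OF expands_first(1) bnd(5,8)] Tx])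
  moreover have "((\<lambda>t. H1 (t, y) * (2 * pi * partial1 action_fun (H (t, y), y))) has_real_derivative
      - (x / (x\<^sup>2 + y\<^sup>2)) + S11 (x, y)) (at x)"
  proof (rule has_field_derivative_transform_within_open)
    show "((\<lambda>t. - (ln (t\<^sup>2 + y\<^sup>2) / 2) + S1 (t, y)) has_real_derivative - (x / (x\<^sup>2 + y\<^sup>2)) + S11 (x, y)) (at x)"
      by (intro DERIV_add singular_part_second_derivatives xy expands_has_partial1[OF expands_first(3) bnd(5,8)])
    show "x \<in> {-r<..<r}" using xy by auto
    show "- (ln (t\<^sup>2 + y\<^sup>2) / 2) + S1 (t, y) = H1 (t, y) * (2 * pi * partial1 action_fun (H (t, y), y))"
      if "t \<in> {-r<..<r}" for t
      using first_order(1)[of t y] that y0 ay by (simp add: abs_less_iff)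
  qed simp
  ultimately have "H11 (x, y) * (2 * pi * partial1 action_fun (H (x, y), y)) +
       H1 (x, y) * (2 * pi * partial1 (partial1 action_fun) z) * H1 (x, y) = - (x / (x\<^sup>2 + y\<^sup>2)) + S11 (x, y)"
    by (rule DERIV_unique)
  thus "H11 (x, y) * (2 * pi * partial1 action_fun z) +
      H1 (x, y) * (H1 (x, y) * (2 * pi * partial1 (partial1 action_fun) z)) = - (x / (x\<^sup>2 + y\<^sup>2)) + S11 (x, y)"
    by (simp only: z_def mult_ac)
  have "((\<lambda>t. H1 (x, t) * (2 * pi * partial1 action_fun (H (x, t), t))) has_real_derivative
      (H12 (x, y) * (2 * pi * partial1 action_fun (H (x, y), y)) +
       (H2 (x, y) * (2 * pi * partial1 (partial1 action_fun) z) + 2 * pi * partial1 (partial2 action_fun) z) * H1 (x, y))) (at y)"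
    by (rule DERIV_mult[OF expands_has_partial2[OF expands_first(1) bnd(7,6)] Ty])
  moreover have "((\<lambda>t. H1 (x, t) * (2 * pi * partial1 action_fun (H (x, t), t))) has_real_derivative
      - (y / (x\<^sup>2 + y\<^sup>2)) + S12 (x, y)) (at y)"
  proof (rule has_field_derivative_transform_within_open)
    show "((\<lambda>t. - (ln (x\<^sup>2 + t\<^sup>2) / 2) + S1 (x, t)) has_real_derivative - (y / (x\<^sup>2 + y\<^sup>2)) + S12 (x, y)) (at y)"
      by (intro DERIV_add singular_part_second_derivatives xy expands_has_partial2[OF expands_first(3) bnd(7,6)])
    show "y \<in> {0<..<r}" using xy by auto
    show "- (ln (x\<^sup>2 + t\<^sup>2) / 2) + S1 (x, t) = H1 (x, t) * (2 * pi * partial1 action_fun (H (x, t), t))"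
      if "t \<in> {0<..<r}" for t
      using first_order(1)[of x t] that xy by simp
  qed simp
  ultimately have "H12 (x, y) * (2 * pi * partial1 action_fun (H (x, y), y)) +
       (H2 (x, y) * (2 * pi * partial1 (partial1 action_fun) z) + 2 * pi * partial1 (partial2 action_fun) z) * H1 (x, y)
       = - (y / (x\<^sup>2 + y\<^sup>2)) + S12 (x, y)"
    by (rule DERIV_unique)
  thus "H12 (x, y) * (2 * pi * partial1 action_fun z) +
      H1 (x, y) * (H2 (x, y) * (2 * pi * partial1 (partial1 action_fun) z) + 2 * pi * partial1 (partial2 action_fun) z)
      = - (y / (x\<^sup>2 + y\<^sup>2)) + S12 (x, y)"
    by (simp only: z_def mult_ac)
  have "((\<lambda>t. 2 * pi * partial2 action_fun (H (x, t), t) + H2 (x, t) * (2 * pi * partial1 action_fun (H (x, t), t)))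
     has_real_derivative
      ((H2 (x, y) * (2 * pi * partial1 (partial2 action_fun) z) + 2 * pi * partial2 (partial2 action_fun) z) +
      (H22 (x, y) * (2 * pi * partial1 action_fun (H (x, y), y)) +
       (H2 (x, y) * (2 * pi * partial1 (partial1 action_fun) z) + 2 * pi * partial1 (partial2 action_fun) z) * H2 (x, y)))) (at y)"
    by (rule DERIV_add[OF Vy DERIV_mult[OF expands_has_partial2[OF expands_first(2) bnd(7,6)] Ty]])
  moreover have "((\<lambda>t. 2 * pi * partial2 action_fun (H (x, t), t) + H2 (x, t) * (2 * pi * partial1 action_fun (H (x, t), t)))
     has_real_derivative x / (x\<^sup>2 + y\<^sup>2) + S22 (x, y)) (at y)"
  proof (rule has_field_derivative_transform_within_open)
    show "((\<lambda>t. (- 2 * pi * sgn t + Arg (Complex x t)) + S2 (x, t)) has_real_derivative x / (x\<^sup>2 + y\<^sup>2) + S22 (x, y)) (at y)"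
      by (intro DERIV_add singular_part_second_derivatives xy expands_has_partial2[OF expands_first(4) bnd(7,6)])
    show "y \<in> {0<..<r}" using xy by auto
    show "(- 2 * pi * sgn t + Arg (Complex x t)) + S2 (x, t) =
        2 * pi * partial2 action_fun (H (x, t), t) + H2 (x, t) * (2 * pi * partial1 action_fun (H (x, t), t))"
      if "t \<in> {0<..<r}" for t
      using first_order(2)[of x t] that xy by simp
  qed simp
  ultimately have "(H2 (x, y) * (2 * pi * partial1 (partial2 action_fun) z) + 2 * pi * partial2 (partial2 action_fun) z) +
      (H22 (x, y) * (2 * pi * partial1 action_fun (H (x, y), y)) +
       (H2 (x, y) * (2 * pi * partial1 (partial1 action_fun) z) + 2 * pi * partial1 (partial2 action_fun) z) * H2 (x, y))
      = x / (x\<^sup>2 + y\<^sup>2) + S22 (x, y)"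
    by (rule DERIV_unique)
  thus "(H2 (x, y) * (2 * pi * partial1 (partial2 action_fun) z) + 2 * pi * partial2 (partial2 action_fun) z) +
      (H22 (x, y) * (2 * pi * partial1 action_fun z) +
       H2 (x, y) * (H2 (x, y) * (2 * pi * partial1 (partial1 action_fun) z) + 2 * pi * partial1 (partial2 action_fun) z))
      = x / (x\<^sup>2 + y\<^sup>2) + S22 (x, y)"
    by (simp only: z_def mult_ac)
qed

lemmas expands_intros = expands_all expands_add expands_diff expands_mult expands_power
  expands_numeral[OF r] expands_one[OF r] expands_fst[OF r] expands_snd[OF r]

text \<open>The coefficient of \<open>ln |j|\<close> vanishes as a formal power series, and the factor \<open>N\<close> can be cancelled.\<close>

lemma formal_relations:
  "inverse_pde1 (fps_const fps_X) FH (fps_D1 FH) (fps_D2 FH) (fps_D1 (fps_D1 FH)) (fps_D2 (fps_D1 FH)) (fps_D2 (fps_D2 FH)) = 0" (is "?R1 = 0")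
  "inverse_pde2 (fps_const fps_X) FH (fps_D1 FH) (fps_D2 FH) (fps_D1 (fps_D1 FH)) (fps_D2 (fps_D1 FH)) (fps_D2 (fps_D2 FH)) = 0" (is "?R2 = 0")
proof -
  define NF :: "real fps fps" where "NF = fps_X\<^sup>2 + (fps_const fps_X)\<^sup>2"
  define N where "N = (\<lambda>j::real \<times> real. (fst j)\<^sup>2 + (snd j)\<^sup>2)"
  have N: "expands r NF N" unfolding NF_def N_def by (intro expands_intros)
  have "NF $ 2 $ 0 = 1" by (simp add: NF_def fps_X_power_nth)
  hence NF0: "NF \<noteq> 0" by auto
  define R1 where "R1 = (\<lambda>j. inverse_pde1 (snd j) (H j) (H1 j) (H2 j) (H11 j) (H12 j) (H22 j))"
  define R2 where "R2 = (\<lambda>j. inverse_pde2 (snd j) (H j) (H1 j) (H2 j) (H11 j) (H12 j) (H22 j))"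
  have R1: "expands r ?R1 R1" unfolding R1_def inverse_pde1_def inverse_ll_def inverse_hl_def by (intro expands_intros)
  have R2: "expands r ?R2 R2" unfolding R2_def inverse_pde2_def inverse_ll_def inverse_hl_def by (intro expands_intros)
  define bh where "bh = (\<lambda>j. rest_hh (fst j) (N j) (H1 j) (H11 j) (S1 j) (S11 j))"
  define bl where "bl = (\<lambda>j. rest_hl (snd j) (N j) (H1 j) (H2 j) (H12 j) (S1 j) (S12 j) (bh j))"
  define bv where "bv = (\<lambda>j. rest_ll (fst j) (N j) (H1 j) (H2 j) (H22 j) (S1 j) (S22 j) (bh j) (bl j))"
  have "\<exists>B. expands r B bh"
    unfolding bh_def rest_hh_def by (rule exI) (rule expands_intros N)+
  then obtain Bh where Bh: "expands r Bh bh" ..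
  have "\<exists>B. expands r B bl"
    unfolding bl_def rest_hl_def by (rule exI) (rule expands_intros N Bh)+
  then obtain Bl where Bl: "expands r Bl bl" ..
  have "\<exists>B. expands r B bv"
    unfolding bv_def rest_ll_def by (rule exI) (rule expands_intros N Bh Bl)+
  then obtain Bv where Bv: "expands r Bv bv" ..
  have "\<exists>G. expands r G (\<lambda>j. - (2 * (3 * snd j * bh j - (1 + H j) * snd j * bv j - 2 * H j * (2 + H j) * bl j)))"
    by (rule exI) (rule expands_intros expands_uminus Bh Bl Bv)+
  then obtain G1 where G1: "expands r G1 (\<lambda>j. - (2 * (3 * snd j * bh j - (1 + H j) * snd j * bv j - 2 * H j * (2 + H j) * bl j)))" ..
  have "\<exists>G. expands r G (\<lambda>j. - (2 * (N j * (H1 j)\<^sup>2 * S1 j + 2 * bv j + 2 * (1 + H j) * bh j + 3 * snd j * bl j)))"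
    by (rule exI) (rule expands_intros expands_uminus Bh Bl Bv N)+
  then obtain G2 where G2: "expands r G2 (\<lambda>j. - (2 * (N j * (H1 j)\<^sup>2 * S1 j + 2 * bv j + 2 * (1 + H j) * bh j + 3 * snd j * bl j)))" ..
  have key: "N (x, y) * R1 (x, y) * (ln (x\<^sup>2 + y\<^sup>2) / 2) =
        3 * y * bh (x, y) - (1 + H (x, y)) * y * bv (x, y) - 2 * H (x, y) * (2 + H (x, y)) * bl (x, y)" (is ?K1)
    "N (x, y) * R2 (x, y) * (ln (x\<^sup>2 + y\<^sup>2) / 2) =
        N (x, y) * (H1 (x, y))\<^sup>2 * S1 (x, y) + 2 * bv (x, y) + 2 * (1 + H (x, y)) * bh (x, y) + 3 * y * bl (x, y)" (is ?K2)
    if xy: "0 < y" "y < r" "\<bar>x\<bar> \<le> y" for x y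
  proof -
    let ?z = "(H (x, y), y)"
    have x: "\<bar>x\<bar> < r" using xy by simp
    have ay: "\<bar>y\<bar> < r" "y \<noteq> 0" using xy by auto
    have reg: "?z \<in> regular_values" using regular[of x y] x ay by simp
    have Nxy: "N (x, y) = x\<^sup>2 + y\<^sup>2" by (simp add: N_def)
    have N0: "x\<^sup>2 + y\<^sup>2 \<noteq> 0" using ay by (simp add: sum_power2_eq_zero_iff)
    have p1: "3 * y * (2 * pi * partial1 (partial1 action_fun) ?z)
        - (1 + H (x, y)) * y * (2 * pi * partial2 (partial2 action_fun) ?z)
        - 2 * H (x, y) * (2 + H (x, y)) * (2 * pi * partial1 (partial2 action_fun) ?z) = 0"
      using arg_cong[OF action_fun_twice_differentiable(4)[OF reg], of "\<lambda>u. 2 * pi * u"] by (simp add: algebra_simps)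
    have p2: "2 * pi * partial1 action_fun ?z + 2 * (2 * pi * partial2 (partial2 action_fun) ?z)
        + 2 * (1 + H (x, y)) * (2 * pi * partial1 (partial1 action_fun) ?z)
        + 3 * y * (2 * pi * partial1 (partial2 action_fun) ?z) = 0"
      using arg_cong[OF action_fun_twice_differentiable(5)[OF reg], of "\<lambda>u. 2 * pi * u"] by (simp add: algebra_simps)
    from log_elimination[OF N0 first_order(1)[OF x ay] second_order[OF x xy(1,2)] p1 p2]
    show ?K1 ?K2 by (simp_all only: R1_def R2_def bh_def bl_def bv_def Nxy fst_conv snd_conv)
  qed
  have "NF * ?R1 = 0"
  proof (rule expands_ln_independent[OF expands_mult[OF N R1] G1])
    fix x y :: real assume "0 < y" "y < r" "\<bar>x\<bar> \<le> y"
    note k = key(1)[OF this, symmetric]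
    show "N (x, y) * R1 (x, y) * ln (x\<^sup>2 + y\<^sup>2) + - (2 * (3 * snd (x, y) * bh (x, y) - (1 + H (x, y)) * snd (x, y) * bv (x, y) - 2 * H (x, y) * (2 + H (x, y)) * bl (x, y))) = 0"
      unfolding snd_conv k by simp
  qed
  thus "?R1 = 0" using NF0 by simp
  have "NF * ?R2 = 0"
  proof (rule expands_ln_independent[OF expands_mult[OF N R2] G2])
    fix x y :: real assume "0 < y" "y < r" "\<bar>x\<bar> \<le> y"
    note k = key(2)[OF this, symmetric]
    show "N (x, y) * R2 (x, y) * ln (x\<^sup>2 + y\<^sup>2) + - (2 * (N (x, y) * (H1 (x, y))\<^sup>2 * S1 (x, y) + 2 * bv (x, y) + 2 * (1 + H (x, y)) * bh (x, y) + 3 * snd (x, y) * bl (x, y))) = 0"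
      unfolding snd_conv k by simp
  qed
  thus "?R2 = 0" using NF0 by simp
qed

end

section \<open>Taylor coefficients of the Hamiltonian\<close>

lemma fps_nth_nth_mult:
  fixes P Q :: "real fps fps"
  shows "(P * Q) $ m $ n = (\<Sum>i\<le>m. \<Sum>j\<le>n. P $ i $ j * Q $ (m - i) $ (n - j))"
  by (simp add: fps_mult_nth fps_sum_nth atLeast0AtMost)

lemma fps_numeral_mult_nth_nth: "(numeral k * P :: real fps fps) $ m $ n = numeral k * P $ m $ n"
  by (simp add: numeral_fps_const)

lemma fps_numeral_nth_nth: "(numeral k :: real fps fps) $ m $ n = (if m = 0 \<and> n = 0 then numeral k else 0)"
  by (simp add: numeral_fps_const)

text \<open>The coefficients of degree \<open>k\<close> enter linearly into the part of degree \<open>k - 2\<close> of the second equation and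
the part of degree \<open>k - 1\<close> of the first, with lower coefficients on the right-hand side. The
components \<open>(k - 1, 0)\<close> and \<open>(k - 2, 1)\<close> of the first equation fix the harmonic part, which has two
parameters and is left open by the second equation.\<close>

lemma hamiltonian_coefficients:
  fixes F :: "real fps fps"
  assumes F: "F $ 0 $ 0 = 0" "F $ 1 $ 0 = 1" "F $ 0 $ 1 = 0"
    and R1: "inverse_pde1 (fps_const fps_X) F (fps_D1 F) (fps_D2 F) (fps_D1 (fps_D1 F)) (fps_D2 (fps_D1 F)) (fps_D2 (fps_D2 F)) = 0"
    and R2: "inverse_pde2 (fps_const fps_X) F (fps_D1 F) (fps_D2 F) (fps_D1 (fps_D1 F)) (fps_D2 (fps_D1 F)) (fps_D2 (fps_D2 F)) = 0"
  shows "F $ 2 $ 0 = 1/16 \<and> F $ 1 $ 1 = 0 \<and> F $ 0 $ 2 = 3/16"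
    and "F $ 3 $ 0 = -1/256 \<and> F $ 2 $ 1 = 0 \<and> F $ 1 $ 2 = -9/256 \<and> F $ 0 $ 3 = 0"
    and "F $ 4 $ 0 = 5/8192 \<and> F $ 3 $ 1 = 0 \<and> F $ 2 $ 2 = 51/4096 \<and> F $ 1 $ 3 = 0 \<and> F $ 0 $ 4 = 33/8192"
    and "F $ 5 $ 0 = -33/262144 \<and> F $ 4 $ 1 = 0 \<and> F $ 3 $ 2 = -615/131072 \<and> F $ 2 $ 3 = 0 \<and> F $ 1 $ 4 = -813/262144 \<and> F $ 0 $ 5 = 0"
proof -
  define Y :: "real fps fps" where "Y = fps_const fps_X"
  define V where "V = inverse_ll (fps_D1 F) (fps_D2 F) (fps_D1 (fps_D1 F)) (fps_D2 (fps_D1 F)) (fps_D2 (fps_D2 F))"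
  define W where "W = inverse_hl (fps_D1 F) (fps_D2 F) (fps_D1 (fps_D1 F)) (fps_D2 (fps_D1 F))"
  have Ynth: "Y $ m $ n = (if m = 0 \<and> n = Suc 0 then 1 else 0)" for m n
    by (simp add: Y_def)
  have "(1 + F) * (Y * V) - 3 * (Y * fps_D1 (fps_D1 F)) - 2 * (F * ((2 + F) * W)) = 0"
    using R1 unfolding inverse_pde1_def V_def W_def Y_def by (simp only: mult.assoc)
  hence "((1 + F) * (Y * V) - 3 * (Y * fps_D1 (fps_D1 F)) - 2 * (F * ((2 + F) * W))) $ m $ n = 0" for m n
    by (simp only: fps_zero_nth)
  hence r1: "((1 + F) * (Y * V)) $ m $ n - 3 * (Y * fps_D1 (fps_D1 F)) $ m $ n - 2 * (F * ((2 + F) * W)) $ m $ n = 0" for m n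
    by (simp only: fps_sub_nth fps_numeral_mult_nth_nth)
  have "fps_D1 F * fps_D1 F - 2 * V - 2 * ((1 + F) * fps_D1 (fps_D1 F)) + 3 * (Y * W) = 0"
    using R2 unfolding inverse_pde2_def V_def W_def Y_def by (simp only: mult.assoc power2_eq_square)
  hence "(fps_D1 F * fps_D1 F - 2 * V - 2 * ((1 + F) * fps_D1 (fps_D1 F)) + 3 * (Y * W)) $ m $ n = 0" for m n
    by (simp only: fps_zero_nth)
  hence r2: "(fps_D1 F * fps_D1 F) $ m $ n - 2 * V $ m $ n - 2 * ((1 + F) * fps_D1 (fps_D1 F)) $ m $ n + 3 * (Y * W) $ m $ n = 0" for m n
    by (simp only: fps_sub_nth fps_add_nth fps_numeral_mult_nth_nth)
  note [simp del] = fps_mult_nth_0 fps_mult_nth_1 fps_mult_nth_1'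
  note V = V_def inverse_ll_def power2_eq_square mult.assoc
  note W = W_def inverse_hl_def
  note calc = fps_nth_nth_mult fps_numeral_mult_nth_nth fps_numeral_nth_nth fps_numeral_nth Ynth eval_nat_numeral
  note F' = F[simplified eval_nat_numeral One_nat_def]
  have a0: "-4 * F $ 2 $ 0 + -4 * F $ 0 $ 2 = -1"
    using r2[of 0 0] unfolding V W by (simp add: calc F')
  have a1: "4 * F $ 1 $ 1 = 0"
    using r1[of 1 0] unfolding V W by (simp add: calc F')
  have a2: "-6 * F $ 2 $ 0 + 2 * F $ 0 $ 2 = 0"
    using r1[of 0 1] unfolding V W by (simp add: calc F')
  have a: "F $ 2 $ 0 = 1/16" "F $ 1 $ 1 = 0" "F $ 0 $ 2 = 3/16"
    using a0 a1 a2 by linarith+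
  have a': "F $ Suc (Suc 0) $ 0 = 1/16" "F $ Suc 0 $ Suc 0 = 0" "F $ 0 $ Suc (Suc 0) = 3/16"
    using a by (simp_all add: eval_nat_numeral)
  have b0: "-12 * F $ 3 $ 0 + -4 * F $ 1 $ 2 = 3/16"
    using r2[of 1 0] unfolding V W by (simp add: calc F' a')
  have b1: "-4 * F $ 2 $ 1 + -12 * F $ 0 $ 3 = 0"
    using r2[of 0 1] unfolding V W by (simp add: calc F' a')
  have b2: "8 * F $ 2 $ 1 = 0"
    using r1[of 2 0] unfolding V W by (simp add: calc F' a')
  have b3: "-18 * F $ 3 $ 0 + 10 * F $ 1 $ 2 = -9/32"
    using r1[of 1 1] unfolding V W by (simp add: calc F' a')
  have b: "F $ 3 $ 0 = -1/256" "F $ 2 $ 1 = 0" "F $ 1 $ 2 = -9/256" "F $ 0 $ 3 = 0"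
    using b0 b1 b2 b3 by linarith+
  have b': "F $ Suc (Suc (Suc 0)) $ 0 = -1/256" "F $ Suc (Suc 0) $ Suc 0 = 0" "F $ Suc 0 $ Suc (Suc 0) = -9/256" "F $ 0 $ Suc (Suc (Suc 0)) = 0"
    using b by (simp_all add: eval_nat_numeral)
  have c0: "-24 * F $ 4 $ 0 + -4 * F $ 2 $ 2 = -33/512"
    using r2[of 2 0] unfolding V W by (simp add: calc F' a' b')
  have c1: "-12 * F $ 3 $ 1 + -12 * F $ 1 $ 3 = 0"
    using r2[of 1 1] unfolding V W by (simp add: calc F' a' b')
  have c2: "-4 * F $ 2 $ 2 + -24 * F $ 0 $ 4 = -75/512"
    using r2[of 0 2] unfolding V W by (simp add: calc F' a' b')
  have c3: "12 * F $ 3 $ 1 = 0"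
    using r1[of 3 0] unfolding V W by (simp add: calc F' a' b')
  have c4: "-36 * F $ 4 $ 0 + 18 * F $ 2 $ 2 = 207/1024"
    using r1[of 2 1] unfolding V W by (simp add: calc F' a' b')
  have c: "F $ 4 $ 0 = 5/8192" "F $ 3 $ 1 = 0" "F $ 2 $ 2 = 51/4096" "F $ 1 $ 3 = 0" "F $ 0 $ 4 = 33/8192"
    using c0 c1 c2 c3 c4 by linarith+
  have c': "F $ Suc (Suc (Suc (Suc 0))) $ 0 = 5/8192" "F $ Suc (Suc (Suc 0)) $ Suc 0 = 0" "F $ Suc (Suc 0) $ Suc (Suc 0) = 51/4096" "F $ Suc 0 $ Suc (Suc (Suc 0)) = 0" "F $ 0 $ Suc (Suc (Suc (Suc 0))) = 33/8192"
    using c by (simp_all add: eval_nat_numeral)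
  have d0: "-40 * F $ 5 $ 0 + -4 * F $ 3 $ 2 = 195/8192"
    using r2[of 3 0] unfolding V W by (simp add: calc F' a' b' c')
  have d1: "-24 * F $ 4 $ 1 + -12 * F $ 2 $ 3 = 0"
    using r2[of 2 1] unfolding V W by (simp add: calc F' a' b' c')
  have d2: "-12 * F $ 3 $ 2 + -24 * F $ 1 $ 4 = 1071/8192"
    using r2[of 1 2] unfolding V W by (simp add: calc F' a' b' c')
  have d3: "-4 * F $ 2 $ 3 + -40 * F $ 0 $ 5 = 0"
    using r2[of 0 3] unfolding V W by (simp add: calc F' a' b' c')
  have d4: "16 * F $ 4 $ 1 = 0"
    using r1[of 4 0] unfolding V W by (simp add: calc F' a' b' c')
  have d5: "-60 * F $ 5 $ 0 + 26 * F $ 3 $ 2 = -1875/16384"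
    using r1[of 3 1] unfolding V W by (simp add: calc F' a' b' c')
  have d: "F $ 5 $ 0 = -33/262144" "F $ 4 $ 1 = 0" "F $ 3 $ 2 = -615/131072" "F $ 2 $ 3 = 0" "F $ 1 $ 4 = -813/262144" "F $ 0 $ 5 = 0"
    using d0 d1 d2 d3 d4 d5 by linarith+
  show "F $ 2 $ 0 = 1/16 \<and> F $ 1 $ 1 = 0 \<and> F $ 0 $ 2 = 3/16"
    "F $ 3 $ 0 = -1/256 \<and> F $ 2 $ 1 = 0 \<and> F $ 1 $ 2 = -9/256 \<and> F $ 0 $ 3 = 0"
    "F $ 4 $ 0 = 5/8192 \<and> F $ 3 $ 1 = 0 \<and> F $ 2 $ 2 = 51/4096 \<and> F $ 1 $ 3 = 0 \<and> F $ 0 $ 4 = 33/8192"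
    "F $ 5 $ 0 = -33/262144 \<and> F $ 4 $ 1 = 0 \<and> F $ 3 $ 2 = -615/131072 \<and> F $ 2 $ 3 = 0 \<and> F $ 1 $ 4 = -813/262144 \<and> F $ 0 $ 5 = 0"
    using a b c d by blast+
qed

section \<open>The expansion of the frequency ratio and the rotation number\<close>

text \<open>The coefficients of the polynomial in the theorem, multiplied out.\<close>

definition ratio_table :: "nat \<Rightarrow> nat \<Rightarrow> real" where
  "ratio_table m n = (if (m, n) = (0, 1) then 3/8 else if (m, n) = (1, 1) then -15/128
     else if (m, n) = (2, 1) then 45/1024 else if (m, n) = (0, 3) then 15/512
     else if (m, n) = (3, 1) then -1125/65536 else if (m, n) = (1, 3) then -1935/65536 else 0)"

text \<open>Comparing coefficients in \<open>A H_1 = H_2\<close>, degree by degree; the constant term of \<open>H_1\<close> is 1.\<close>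

lemma ratio_coefficients:
  fixes F A :: "real fps fps"
  assumes F: "F $ 0 $ 0 = 0" "F $ 1 $ 0 = 1" "F $ 0 $ 1 = 0"
    and R1: "inverse_pde1 (fps_const fps_X) F (fps_D1 F) (fps_D2 F) (fps_D1 (fps_D1 F)) (fps_D2 (fps_D1 F)) (fps_D2 (fps_D2 F)) = 0"
    and R2: "inverse_pde2 (fps_const fps_X) F (fps_D1 F) (fps_D2 F) (fps_D1 (fps_D1 F)) (fps_D2 (fps_D1 F)) (fps_D2 (fps_D2 F)) = 0"
    and A: "A * fps_D1 F = fps_D2 F"
    and mn: "m + n < 5"
  shows "A $ m $ n = ratio_table m n"
proof -
  note calc = fps_nth_nth_mult eval_nat_numeral
  note [simp del] = fps_mult_nth_0 fps_mult_nth_1 fps_mult_nth_1'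
  have F': "F $ 0 $ 0 = 0" "F $ Suc 0 $ 0 = 1" "F $ 0 $ Suc 0 = 0" "F $ Suc (Suc 0) $ 0 = 1/16" "F $ Suc 0 $ Suc 0 = 0" "F $ 0 $ Suc (Suc 0) = 3/16" "F $ Suc (Suc (Suc 0)) $ 0 = -1/256" "F $ Suc (Suc 0) $ Suc 0 = 0" "F $ Suc 0 $ Suc (Suc 0) = -9/256" "F $ 0 $ Suc (Suc (Suc 0)) = 0" "F $ Suc (Suc (Suc (Suc 0))) $ 0 = 5/8192" "F $ Suc (Suc (Suc 0)) $ Suc 0 = 0" "F $ Suc (Suc 0) $ Suc (Suc 0) = 51/4096" "F $ Suc 0 $ Suc (Suc (Suc 0)) = 0" "F $ 0 $ Suc (Suc (Suc (Suc 0))) = 33/8192" "F $ Suc (Suc (Suc (Suc (Suc 0)))) $ 0 = -33/262144" "F $ Suc (Suc (Suc (Suc 0))) $ Suc 0 = 0" "F $ Suc (Suc (Suc 0)) $ Suc (Suc 0) = -615/131072" "F $ Suc (Suc 0) $ Suc (Suc (Suc 0)) = 0" "F $ Suc 0 $ Suc (Suc (Suc (Suc 0))) = -813/262144" "F $ 0 $ Suc (Suc (Suc (Suc (Suc 0)))) = 0"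
    using F hamiltonian_coefficients[OF F R1 R2] by (simp_all add: eval_nat_numeral)
  have eq: "(A * fps_D1 F) $ m $ n = fps_D2 F $ m $ n" for m n by (simp only: A)
  have a: "A $ 0 $ 0 = 0"
    using eq[of "0" "0"]
    by (simp_all add: calc F')
  have b: "A $ Suc 0 $ 0 = 0" "A $ 0 $ Suc 0 = 3/8"
    using eq[of "Suc 0" "0"] eq[of "0" "Suc 0"]
    by (simp_all add: calc F' a)
  have c: "A $ Suc (Suc 0) $ 0 = 0" "A $ Suc 0 $ Suc 0 = -15/128" "A $ 0 $ Suc (Suc 0) = 0"
    using eq[of "Suc (Suc 0)" "0"] eq[of "Suc 0" "Suc 0"] eq[of "0" "Suc (Suc 0)"]
    by (simp_all add: calc F' a b)
  have d: "A $ Suc (Suc (Suc 0)) $ 0 = 0" "A $ Suc (Suc 0) $ Suc 0 = 45/1024" "A $ Suc 0 $ Suc (Suc 0) = 0" "A $ 0 $ Suc (Suc (Suc 0)) = 15/512"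
    using eq[of "Suc (Suc (Suc 0))" "0"] eq[of "Suc (Suc 0)" "Suc 0"] eq[of "Suc 0" "Suc (Suc 0)"] eq[of "0" "Suc (Suc (Suc 0))"]
    by (simp_all add: calc F' a b c)
  have e: "A $ Suc (Suc (Suc (Suc 0))) $ 0 = 0" "A $ Suc (Suc (Suc 0)) $ Suc 0 = -1125/65536" "A $ Suc (Suc 0) $ Suc (Suc 0) = 0" "A $ Suc 0 $ Suc (Suc (Suc 0)) = -1935/65536" "A $ 0 $ Suc (Suc (Suc (Suc 0))) = 0"
    using eq[of "Suc (Suc (Suc (Suc 0)))" "0"] eq[of "Suc (Suc (Suc 0))" "Suc 0"] eq[of "Suc (Suc 0)" "Suc (Suc 0)"] eq[of "Suc 0" "Suc (Suc (Suc 0))"] eq[of "0" "Suc (Suc (Suc (Suc 0)))"]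
    by (simp_all add: calc F' a b c d)
  have "m = 0 \<or> m = 1 \<or> m = 2 \<or> m = 3 \<or> m = 4" "n = 0 \<or> n = 1 \<or> n = 2 \<or> n = 3 \<or> n = 4"
    using mn by linarith+
  thus ?thesis using mn
    by (elim disjE; simp add: ratio_table_def eval_nat_numeral a b c d e)
qed

lemma expands_ratio_table:
  assumes "0 < r"
  shows "expands r (Abs_fps (\<lambda>m. Abs_fps (\<lambda>n. ratio_table m n)))
    (\<lambda>(j1, j2). 3/8 * j2 - 15/128 * j1 * j2 + 15/1024 * j2 * (3 * j1\<^sup>2 + 2 * j2\<^sup>2)
                - 45/65536 * j1 * j2 * (25 * j1\<^sup>2 + 43 * j2\<^sup>2))"
  unfolding expands_def
proof (intro conjI allI impI)
  fix x y :: real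
  show "((\<lambda>(m, n). Abs_fps (\<lambda>m. Abs_fps (\<lambda>n. ratio_table m n)) $ m $ n * x ^ m * y ^ n) has_sum
     (case (x, y) of (j1, j2) \<Rightarrow> 3/8 * j2 - 15/128 * j1 * j2 + 15/1024 * j2 * (3 * j1\<^sup>2 + 2 * j2\<^sup>2)
                - 45/65536 * j1 * j2 * (25 * j1\<^sup>2 + 43 * j2\<^sup>2))) UNIV"
    by (rule has_sum_finite_neutralI[where B = "{(0, 1), (1, 1), (2, 1), (0, 3), (3, 1), (1, 3)}"])
       (auto simp: ratio_table_def algebra_simps add_divide_distrib power2_eq_square power3_eq_cube split: if_splits)
qed (fact assms)

lemma eventually_nhds_box:
  assumes "\<forall>\<^sub>F j in nhds (0::real, 0::real). P j"
  shows "\<exists>\<delta>>0. \<forall>x y. \<bar>x\<bar> < \<delta> \<longrightarrow> \<bar>y\<bar> < \<delta> \<longrightarrow> P (x, y)"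
proof -
  obtain d where d: "0 < d" "\<And>j. dist j (0, 0) < d \<Longrightarrow> P j"
    using assms unfolding eventually_nhds_metric by blast
  have "P (x, y)" if "\<bar>x\<bar> < d / 2" "\<bar>y\<bar> < d / 2" for x y
  proof (rule d(2))
    have "dist (x, y) (0, 0) \<le> \<bar>x\<bar> + \<bar>y\<bar>"
      using norm_Pair_le[of x y] by (simp add: dist_norm)
    with that show "dist (x, y) (0, 0) < d" by simp
  qed
  with d(1) show ?thesis by (intro exI[of _ "d / 2"]) auto
qed

lemma (in near_equilibrium) rotation_number_formula:
  assumes xy: "\<bar>x\<bar> < r" "\<bar>y\<bar> < r" "y \<noteq> 0"
  shows "(\<lambda>l. action1 (H (x, y)) l) field_differentiable (at y)"
    and "2 * pi * rotation_number (H (x, y)) y =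
      2 * pi * sgn y - Arg (Complex x y) - frequency_ratio H (x, y) * ln (cmod (Complex x y))
        + frequency_ratio H (x, y) * S1 (x, y) - S2 (x, y)"
proof -
  let ?z = "(H (x, y), y)"
  have reg: "?z \<in> regular_values" using regular[of x y] xy by simp
  have "((\<lambda>l. action_fun (H (x, y), l)) has_real_derivative
      0 * partial1 action_fun ?z + 1 * partial2 action_fun ?z) (at y)"
    by (rule has_real_derivative_compose_plane[OF action_fun_twice_differentiable(1)[OF reg] DERIV_const DERIV_ident])
  hence d: "((\<lambda>l. action1 (H (x, y)) l) has_real_derivative partial2 action_fun ?z) (at y)"
    by (simp add: action_fun_def)
  thus "(\<lambda>l. action1 (H (x, y)) l) field_differentiable (at y)"
    unfolding field_differentiable_def by blast
  have W: "rotation_number (H (x, y)) y = - partial2 action_fun ?z"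
    unfolding rotation_number_def using DERIV_imp_deriv[OF d] by simp
  have H1: "H1 (x, y) \<noteq> 0" using H1_nonzero[of x y] xy by simp
  define T where "T = 2 * pi * partial1 action_fun ?z"
  have T: "T = (- (ln (x\<^sup>2 + y\<^sup>2) / 2) + S1 (x, y)) / H1 (x, y)"
    using first_order(1)[OF xy] H1 unfolding T_def[symmetric] by (simp add: eq_divide_eq mult.commute)
  have "2 * pi * partial2 action_fun ?z = - 2 * pi * sgn y + Arg (Complex x y) + S2 (x, y) - H2 (x, y) * T"
    using first_order(2)[OF xy] unfolding T_def[symmetric] by simp
  moreover have "H2 (x, y) * T = frequency_ratio H (x, y) * (- (ln (x\<^sup>2 + y\<^sup>2) / 2) + S1 (x, y))"
    unfolding T frequency_ratio_def by simp
  ultimately show "2 * pi * rotation_number (H (x, y)) y =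
      2 * pi * sgn y - Arg (Complex x y) - frequency_ratio H (x, y) * ln (cmod (Complex x y))
        + frequency_ratio H (x, y) * S1 (x, y) - S2 (x, y)"
    unfolding W ln_cmod_Complex by (simp add: algebra_simps)
qed

lemma (in near_equilibrium) frequency_ratio_expansion:
  assumes "FH $ 0 $ 0 = 0" "FH $ 1 $ 0 = 1" "FH $ 0 $ 1 = 0"
  shows "power_series_from_degree 5
           (\<lambda>(j1, j2). frequency_ratio H (j1, j2) -
              (3/8 * j2 - 15/128 * j1 * j2 + 15/1024 * j2 * (3 * j1\<^sup>2 + 2 * j2\<^sup>2)
                - 45/65536 * j1 * j2 * (25 * j1\<^sup>2 + 43 * j2\<^sup>2))) 0"
proof -
  have "fps_D1 FH $ 0 $ 0 \<noteq> 0" using assms by simp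
  from expands_inverse[OF expands_all(3) this]
  obtain \<rho> G where \<rho>: "0 < \<rho>" "\<rho> \<le> r" and G: "expands \<rho> G (\<lambda>j. 1 / H1 j)" "fps_D1 FH * G = 1" by blast
  let ?A = "fps_D2 FH * G" and ?T = "Abs_fps (\<lambda>m. Abs_fps (\<lambda>n. ratio_table m n))"
  let ?p = "\<lambda>(j1, j2). 3/8 * j2 - 15/128 * j1 * j2 + 15/1024 * j2 * (3 * j1\<^sup>2 + 2 * j2\<^sup>2)
                - 45/65536 * j1 * j2 * (25 * j1\<^sup>2 + 43 * j2\<^sup>2) :: real"
  have "expands \<rho> ?A (\<lambda>j. H2 j * (1 / H1 j))"
    by (rule expands_mult[OF expands_mono[OF expands_all(4) \<rho>] G(1)])
  from expands_diff[OF this expands_ratio_table[OF \<rho>(1)]]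
  have "expands \<rho> (?A - ?T) (\<lambda>j. H2 j * (1 / H1 j) - ?p j)" .
  hence "expands \<rho> (?A - ?T) (\<lambda>(j1, j2). frequency_ratio H (j1, j2) -
              (3/8 * j2 - 15/128 * j1 * j2 + 15/1024 * j2 * (3 * j1\<^sup>2 + 2 * j2\<^sup>2)
                - 45/65536 * j1 * j2 * (25 * j1\<^sup>2 + 43 * j2\<^sup>2)))"
    by (rule expands_cong) (simp add: frequency_ratio_def)
  moreover have "?A * fps_D1 FH = fps_D2 FH" using G(2) by (simp add: mult.assoc mult.commute[of G])
  hence "(?A - ?T) $ m $ n = 0" if "m + n < 5" for m n
    using ratio_coefficients[OF assms formal_relations _ that, of ?A] by simp
  ultimately show ?thesis unfolding power_series_from_degree_iff by blast
qed

theorem mainTheorem4: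
  fixes U :: "((real^2) \<times> (real^2)) set"
    and \<Phi> :: "(real^2) \<times> (real^2) \<Rightarrow> (real^3) \<times> (real^3)"
    and \<H> S A :: "real \<times> real \<Rightarrow> real"
  assumes "A = frequency_ratio \<H>"
    and "eliasson_coordinates U \<Phi> \<H>"
    and "symplectic_invariant \<H> S"
  shows "(\<forall>\<^sub>F (j1, j2) in nhds (0, 0). j2 \<noteq> 0 \<longrightarrow>
           (\<lambda>l. action1 (\<H> (j1, j2)) l) field_differentiable (at j2) \<and>
           2 * pi * rotation_number (\<H> (j1, j2)) j2 =
             2 * pi * sgn j2 - Arg (Complex j1 j2) - A (j1, j2) * ln (cmod (Complex j1 j2))
               + A (j1, j2) * partial1 S (j1, j2) - partial2 S (j1, j2)) \<and>
         power_series_from_degree 5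
           (\<lambda>(j1, j2). A (j1, j2) -
              (3/8 * j2 - 15/128 * j1 * j2 + 15/1024 * j2 * (3 * j1\<^sup>2 + 2 * j2\<^sup>2)
                - 45/65536 * j1 * j2 * (25 * j1\<^sup>2 + 43 * j2\<^sup>2))) 0"
proof -
  obtain r1 F0 where F0: "expands r1 F0 (\<lambda>j. \<H> j - fst j)" and F0z: "\<And>m n. m + n < 2 \<Longrightarrow> F0 $ m $ n = 0"
    using assms(2) unfolding eliasson_coordinates_def power_series_from_degree_iff by blast
  obtain r2 FS where FS: "expands r2 FS S"
    using assms(3) unfolding symplectic_invariant_def power_series_from_degree_iff by blast
  define FH where "FH = F0 + fps_X"
  have FH: "expands r1 FH \<H>"
    using expands_add[OF F0 expands_fst[OF expands_pos[OF F0]]] by (simp add: FH_def)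
  have FHz: "FH $ 0 $ 0 = 0" "FH $ 1 $ 0 = 1" "FH $ 0 $ 1 = 0"
    using F0z[of 0 0] F0z[of 1 0] F0z[of 0 1] by (simp_all add: FH_def)
  have "(\<H> \<longlongrightarrow> 0) (nhds (0, 0))" using expands_tendsto[OF FH] FHz by simp
  from tendsto_rabs[OF this] have "\<forall>\<^sub>F j in nhds (0, 0). \<bar>\<H> j\<bar> < 1/2"
    by (rule order_tendstoD(2)) simp
  moreover have "(partial1 \<H> \<longlongrightarrow> 1) (nhds (0, 0))" using expands_tendsto[OF expands_partial1[OF FH]] FHz by simp
  hence "\<forall>\<^sub>F j in nhds (0, 0). 0 < partial1 \<H> j" by (rule order_tendstoD(1)) simp
  moreover have "\<forall>\<^sub>F j in nhds (0, 0). 2 * pi * action1 (\<H> j) (snd j) = singular_part j + S j"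
    using assms(3) unfolding symplectic_invariant_def by (auto simp: singular_part_def case_prod_unfold)
  ultimately have "\<forall>\<^sub>F j in nhds (0, 0). \<bar>\<H> j\<bar> < 1/2 \<and> 0 < partial1 \<H> j \<and>
      2 * pi * action1 (\<H> j) (snd j) = singular_part j + S j"
    by eventually_elim simp
  from eventually_nhds_box[OF this] obtain \<delta> where \<delta>: "0 < \<delta>" "\<And>x y. \<bar>x\<bar> < \<delta> \<Longrightarrow> \<bar>y\<bar> < \<delta> \<Longrightarrow> \<bar>\<H> (x, y)\<bar> < 1/2 \<and> 0 < partial1 \<H> (x, y) \<and>
      2 * pi * action1 (\<H> (x, y)) (snd (x, y)) = singular_part (x, y) + S (x, y)"
    by blast
  \<comment> \<open>values below 1/2 keep \<open>(\<H> j, j2)\<close> among the regular values\<close>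
  define r where "r = Min {r1 / 4, r2 / 4, \<delta> / 2, 1 / 3}"
  have r: "0 < r" "4 * r \<le> r1" "4 * r \<le> r2" "r < \<delta>" "r < 1/2"
    using expands_pos[OF FH] expands_pos[OF FS] \<delta>(1) unfolding r_def by (auto simp: min_def)
  interpret near_equilibrium \<H> S FH FS r
  proof
    show "expands (4 * r) FH \<H>" "expands (4 * r) FS S"
      using r by (auto intro: expands_mono[OF FH] expands_mono[OF FS])
    fix x y :: real assume "\<bar>x\<bar> \<le> r" "\<bar>y\<bar> \<le> r"
    hence "\<bar>x\<bar> < \<delta>" "\<bar>y\<bar> < \<delta>" using r by auto
    from \<delta>(2)[OF this] show "\<bar>\<H> (x, y)\<bar> < 1/2" "partial1 \<H> (x, y) \<noteq> 0"
      "2 * pi * action1 (\<H> (x, y)) y = singular_part (x, y) + S (x, y)" by auto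
  qed (fact r(5))
  have "\<forall>\<^sub>F j in nhds (0::real, 0::real). norm j < r"
    using r(1) by (auto simp: eventually_nhds_metric dist_norm intro!: exI[of _ r])
  hence "\<forall>\<^sub>F (j1, j2) in nhds (0, 0). j2 \<noteq> 0 \<longrightarrow>
           (\<lambda>l. action1 (\<H> (j1, j2)) l) field_differentiable (at j2) \<and>
           2 * pi * rotation_number (\<H> (j1, j2)) j2 =
             2 * pi * sgn j2 - Arg (Complex j1 j2) - A (j1, j2) * ln (cmod (Complex j1 j2))
               + A (j1, j2) * partial1 S (j1, j2) - partial2 S (j1, j2)"
  proof eventually_elim
    case (elim j)
    obtain x y where j: "j = (x, y)" by (cases j)
    have "\<bar>x\<bar> < r" "\<bar>y\<bar> < r"
      using elim norm_fst_le[of x y] norm_snd_le[of y x] by (auto simp: j)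
    with rotation_number_formula[of x y] show ?case by (auto simp: j assms(1))
  qed
  with frequency_ratio_expansion[OF FHz] show ?thesis by (simp only: assms(1))
qed

end
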